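(* Let $z, w, a, E$ be indeterminates and let $R=R(w,a)$ denote the regular isotopy version of the Homflypt polynomial in the variables $w,a$. There exists a unique regular isotopy invariant of classical oriented links $H[R]:\mathcal{L}\to \mathbb{Z}[z, w^{\pm 1}, a^{\pm 1}, E^{\pm 1}]$ satisfying the following two rules: (1) For every oriented Conway triple $L_+, L_-, L_0$ whose specified crossing involves two different components of the link, $$H[R](L_+) - H[R](L_-) = z\, H[R](L_0).$$ (2) For every union $\mathcal{K}^r=\sqcup_{i=1}^r K_i$ of $r$ unlinked knots, $r\geq 1$, $$H[R](\mathcal{K}^r) = E^{1-r}\, R(\mathcal{K}^r).$$
   Context: $\mathcal{L}$ is the set of (non-empty) classical oriented link diagrams in the plane. Regular isotopy is the equivalence relation on diagrams generated by planar isotopy and Reidemeister moves II and III (with all orientations); a regular isotopy invariant is a function on diagrams constant on regular isotopy classes. An oriented Conway triple $L_+,L_-,L_0$ consists of three oriented diagrams identical except near one specified crossing, which is positive in $L_+$, switched (negative) in $L_-$, and replaced in $L_0$ by the smoothing compatible with the orientations. A union of $r$ unlinked knots $\mathcal{K}^r=\sqcup_{i=1}^r K_i$ is an $r$-component link diagram representing a split link whose $r$ split components are (possibly non-trivial) knots $K_1,\dots,K_r$. $R(w,a)\in\mathbb{Z}[w^{\pm1},a^{\pm1}]$, the (known) regular isotopy version of the Homflypt polynomial, is the regular isotopy invariant of oriented links determined by: (R1) $R(L_+)-R(L_-)=w\,R(L_0)$ for every oriented Conway triple (any crossing); (R2) removing a positive (respectively negative) curl (a Reidemeister I kink) from a diagram: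 $R(\text{diagram with a positive curl})=a\,R(\text{diagram without the curl})$ and $R(\text{diagram with a negative curl})=a^{-1}R(\text{diagram without the curl})$; (R3) $R=1$ on the standard crossingless unknot diagram. It follows that $R(U)=a^{wr(U)}$ for a diagram $U$ of the unknot, where $wr$ is the writhe, and $R(\mathcal{K}^r)=\eta^{r-1}\prod_{i=1}^r R(K_i)$ with $\eta=\frac{a-a^{-1}}{w}$. *)

theory Defs
  imports Main "HOL-Library.Product_Plus" "HOL-Library.Poly_Mapping"
begin

section \<open>Oriented link diagrams in the plane\<close>

text \<open>
  A plane diagram is put in general position with respect to the height function and cut by
  horizontal lines into slices that each contain one local minimum, one local maximum or one
  crossing. Reading from bottom to top, this is a word of elementary events. The horizontal lines
  between consecutive events meet the diagram in finitely many strands, numbered from the left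
  starting with 0, each of which is directed upwards or downwards.
\<close>

datatype direction = Up | Down

fun opposite :: "direction \<Rightarrow> direction" where
  "opposite Up = Down"
| "opposite Down = Up"

text \<open>
  \<open>Cup i d\<close> is a local minimum creating the strands \<open>i\<close> and \<open>i + 1\<close>, with directions \<open>d\<close> and
  \<open>opposite d\<close>. \<open>Cap i\<close> is a local maximum joining the strands \<open>i\<close> and \<open>i + 1\<close>.
  \<open>Cross i b\<close> is a crossing of the strands \<open>i\<close> and \<open>i + 1\<close>; the strand running from lower left to
  upper right is the overcrossing one if \<open>b\<close> holds, and the undercrossing one otherwise.
\<close>

datatype event = Cup nat direction | Cap nat | Cross nat bool

type_synonym level = "direction list"

fun apply_event :: "event \<Rightarrow> level \<Rightarrow> level option" where
  "apply_event (Cup i d) s =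
     (if i \<le> length s then Some (take i s @ [d, opposite d] @ drop i s) else None)"
| "apply_event (Cap i) s =
     (if Suc i < length s \<and> s ! i \<noteq> s ! Suc i then Some (take i s @ drop (i + 2) s) else None)"
| "apply_event (Cross i b) s =
     (if Suc i < length s then Some (take i s @ [s ! Suc i, s ! i] @ drop (i + 2) s) else None)"

fun run :: "event list \<Rightarrow> level \<Rightarrow> level option" where
  "run [] s = Some s"
| "run (e # es) s = (case apply_event e s of None \<Rightarrow> None | Some t \<Rightarrow> run es t)"

typedef link_diagram = "{es :: event list. es \<noteq> [] \<and> run es [] = Some []}"
  morphisms events Abs_link_diagram
proof
  show "[Cup 0 Up, Cap 0] \<in> {es :: event list. es \<noteq> [] \<and> run es [] = Some []}"
    by simp
qed

section \<open>Components\<close>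

fun pos :: "event \<Rightarrow> nat" where
  "pos (Cup i d) = i"
| "pos (Cap i) = i"
| "pos (Cross i b) = i"

fun strands_in :: "event \<Rightarrow> nat" where
  "strands_in (Cup i d) = 0"
| "strands_in (Cap i) = 2"
| "strands_in (Cross i b) = 2"

fun strands_out :: "event \<Rightarrow> nat" where
  "strands_out (Cup i d) = 2"
| "strands_out (Cap i) = 0"
| "strands_out (Cross i b) = 2"

text \<open>
  The pair \<open>(k, j)\<close> stands for the point of strand \<open>j\<close> on the horizontal line just below the event
  with index \<open>k\<close>. Two points are \<open>linked_in_slice\<close> if they are the two ends of an arc of the
  diagram running inside a single slice.
\<close>

definition strand_points :: "link_diagram \<Rightarrow> (nat \<times> nat) set" where
  "strand_points D =
     {(k, j). k \<le> length (events D) \<and>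
        (\<exists>s. run (take k (events D)) [] = Some s \<and> j < length s)}"

inductive linked_in_slice :: "event list \<Rightarrow> nat \<times> nat \<Rightarrow> nat \<times> nat \<Rightarrow> bool" for es where
  left: "k < length es \<Longrightarrow> j < pos (es ! k) \<Longrightarrow> linked_in_slice es (k, j) (Suc k, j)"
| right: "k < length es \<Longrightarrow> linked_in_slice es
    (k, pos (es ! k) + strands_in (es ! k) + j) (Suc k, pos (es ! k) + strands_out (es ! k) + j)"
| cup: "k < length es \<Longrightarrow> es ! k = Cup i d \<Longrightarrow> linked_in_slice es (Suc k, i) (Suc k, Suc i)"
| cap: "k < length es \<Longrightarrow> es ! k = Cap i \<Longrightarrow> linked_in_slice es (k, i) (k, Suc i)"
| cross_rising: "k < length es \<Longrightarrow> es ! k = Cross i b \<Longrightarrow>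
    linked_in_slice es (k, i) (Suc k, Suc i)"
| cross_falling: "k < length es \<Longrightarrow> es ! k = Cross i b \<Longrightarrow>
    linked_in_slice es (k, Suc i) (Suc k, i)"

definition same_component :: "link_diagram \<Rightarrow> ((nat \<times> nat) \<times> (nat \<times> nat)) set" where
  "same_component D =
     {(p, q). p \<in> strand_points D \<and> q \<in> strand_points D \<and>
        equivclp (linked_in_slice (events D)) p q}"

definition components :: "link_diagram \<Rightarrow> (nat \<times> nat) set set" where
  "components D = strand_points D // same_component D"

definition knot_diagram :: "link_diagram \<Rightarrow> bool" where
  "knot_diagram D \<longleftrightarrow> card (components D) = 1"

section \<open>Planar isotopy and the Reidemeister moves\<close>

text \<open>
  Planar isotopies are generated by the generic changes of the sequence of slices: exchanging the
  heights of two events that lie side by side, creating or cancelling a minimum and a maximum, and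
  moving a strand through a local minimum or maximum that it crosses. The conditions on directions
  are enforced by requiring both words to be diagrams.
\<close>

inductive planar_move :: "event list \<Rightarrow> event list \<Rightarrow> bool" where
  exchange: "pos e + strands_out e \<le> pos f \<Longrightarrow>
     f' = (case f of Cup j d \<Rightarrow> Cup (j - strands_out e + strands_in e) d
            | Cap j \<Rightarrow> Cap (j - strands_out e + strands_in e)
            | Cross j b \<Rightarrow> Cross (j - strands_out e + strands_in e) b) \<Longrightarrow>
     planar_move [e, f] [f', e]"
| zigzag_right: "planar_move [Cup (Suc i) d, Cap i] []"
| zigzag_left: "planar_move [Cup i d, Cap (Suc i)] []"
| through_cup: "planar_move [Cup i d, Cross (Suc i) b] [Cup (Suc i) d, Cross i (\<not> b)]"
| through_cap: "planar_move [Cross i b, Cap (Suc i)] [Cross (Suc i) (\<not> b), Cap i]"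

inductive reidemeister_2 :: "event list \<Rightarrow> event list \<Rightarrow> bool" where
  "reidemeister_2 [Cross i b, Cross i (\<not> b)] []"

text \<open>
  In the third move, the strands \<open>i\<close> and \<open>i + 1\<close> at the bottom cross in \<open>b\<^sub>1\<close>, the strands \<open>i\<close> and
  \<open>i + 2\<close> in \<open>b\<^sub>2\<close>, and the strands \<open>i + 1\<close> and \<open>i + 2\<close> in \<open>b\<^sub>3\<close>. The side condition says that
  ``lies over'' is not cyclic on the three strands.
\<close>

inductive reidemeister_3 :: "event list \<Rightarrow> event list \<Rightarrow> bool" where
  "b\<^sub>2 = b\<^sub>1 \<or> b\<^sub>2 = b\<^sub>3 \<Longrightarrow>
   reidemeister_3 [Cross i b\<^sub>1, Cross (Suc i) b\<^sub>2, Cross i b\<^sub>3]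
                  [Cross (Suc i) b\<^sub>3, Cross i b\<^sub>2, Cross (Suc i) b\<^sub>1]"

text \<open>
  A curl on a vertical strand, with its loop to the right or to the left of the strand. The two
  strands meeting in the crossing have the same direction, so the curl is positive iff \<open>b\<close> holds.
\<close>

inductive curl :: "bool \<Rightarrow> event list \<Rightarrow> bool" for b where
  loop_right: "curl b [Cup (Suc i) d, Cross i b, Cap (Suc i)]"
| loop_left: "curl b [Cup i d, Cross (Suc i) b, Cap i]"

definition reidemeister_1 :: "event list \<Rightarrow> event list \<Rightarrow> bool" where
  "reidemeister_1 u v \<longleftrightarrow> (\<exists>b. curl b u) \<and> v = []"

definition local_move ::
    "(event list \<Rightarrow> event list \<Rightarrow> bool) \<Rightarrow> link_diagram \<Rightarrow> link_diagram \<Rightarrow> bool" where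
  "local_move M D D' \<longleftrightarrow>
     (\<exists>xs ys u v. M u v \<and> events D = xs @ u @ ys \<and> events D' = xs @ v @ ys)"

definition regular_isotopic :: "link_diagram \<Rightarrow> link_diagram \<Rightarrow> bool" where
  "regular_isotopic =
     equivclp (local_move (\<lambda>u v. planar_move u v \<or> reidemeister_2 u v \<or> reidemeister_3 u v))"

definition ambient_isotopic :: "link_diagram \<Rightarrow> link_diagram \<Rightarrow> bool" where
  "ambient_isotopic =
     equivclp (local_move (\<lambda>u v. planar_move u v \<or>
       reidemeister_1 u v \<or> reidemeister_2 u v \<or> reidemeister_3 u v))"

definition regular_isotopy_invariant :: "(link_diagram \<Rightarrow> 'a) \<Rightarrow> bool" where
  "regular_isotopy_invariant f \<longleftrightarrow> (\<forall>D D'. regular_isotopic D D' \<longrightarrow> f D = f D')"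

section \<open>Conway triples, curls and unlinked knots\<close>

text \<open>
  If both strands point the same way, then \<open>Cross i True\<close> is positive and the oriented smoothing
  consists of two vertical arcs; otherwise \<open>Cross i False\<close> is positive and the oriented smoothing
  is a maximum below a minimum. The specified crossing is the event with index \<open>k\<close>, at strand \<open>i\<close>.
\<close>

definition smoothing :: "nat \<Rightarrow> direction \<Rightarrow> direction \<Rightarrow> event list" where
  "smoothing i p q = (if p = q then [] else [Cap i, Cup i q])"

definition conway_triple ::
    "nat \<Rightarrow> nat \<Rightarrow> link_diagram \<Rightarrow> link_diagram \<Rightarrow> link_diagram \<Rightarrow> bool" where
  "conway_triple k i Lpos Lneg Lzero \<longleftrightarrow>
     (\<exists>xs ys s. length xs = k \<and> run xs [] = Some s \<and> Suc i < length s \<and>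
        events Lpos = xs @ [Cross i (s ! i = s ! Suc i)] @ ys \<and>
        events Lneg = xs @ [Cross i (s ! i \<noteq> s ! Suc i)] @ ys \<and>
        events Lzero = xs @ smoothing i (s ! i) (s ! Suc i) @ ys)"

definition mixed_crossing :: "link_diagram \<Rightarrow> nat \<Rightarrow> nat \<Rightarrow> bool" where
  "mixed_crossing D k i \<longleftrightarrow> ((k, i), (k, Suc i)) \<notin> same_component D"

definition removes_curl :: "bool \<Rightarrow> link_diagram \<Rightarrow> link_diagram \<Rightarrow> bool" where
  "removes_curl b = local_move (\<lambda>u v. curl b u \<and> v = [])"

definition standard_circle :: "link_diagram \<Rightarrow> bool" where
  "standard_circle D \<longleftrightarrow> (\<exists>d. events D = [Cup 0 d, Cap 0])"

text \<open>
  Concatenating words stacks diagrams in disjoint horizontal strips of the plane, so this is their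
  split union.
\<close>

definition unlinked_knots :: "nat \<Rightarrow> link_diagram \<Rightarrow> bool" where
  "unlinked_knots r D \<longleftrightarrow>
     (\<exists>Ks D'. length Ks = r \<and> (\<forall>K \<in> set Ks. knot_diagram K) \<and>
        events D' = concat (map events Ks) \<and> ambient_isotopic D D')"

section \<open>Laurent polynomial rings\<close>

text \<open>
  Monoid rings of exponent vectors: \<open>laurent_wa\<close> is \<open>\<int>[w\<^sup>\<plusminus>\<^sup>1, a\<^sup>\<plusminus>\<^sup>1]\<close>, and \<open>laurent_zwaE\<close> is
  \<open>\<int>[z, w\<^sup>\<plusminus>\<^sup>1, a\<^sup>\<plusminus>\<^sup>1, E\<^sup>\<plusminus>\<^sup>1]\<close>, in which only \<open>z\<close> has its exponents restricted to \<open>nat\<close>.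
\<close>

type_synonym laurent_wa = "(int \<times> int) \<Rightarrow>\<^sub>0 int"

type_synonym laurent_zwaE = "(nat \<times> int \<times> int \<times> int) \<Rightarrow>\<^sub>0 int"

definition w_var :: laurent_wa where
  "w_var = Poly_Mapping.single (1, 0) 1"

definition a_pow :: "int \<Rightarrow> laurent_wa" where
  "a_pow n = Poly_Mapping.single (0, n) 1"

definition z_var :: laurent_zwaE where
  "z_var = Poly_Mapping.single (1, 0, 0, 0) 1"

definition E_pow :: "int \<Rightarrow> laurent_zwaE" where
  "E_pow n = Poly_Mapping.single (0, 0, 0, n) 1"

definition include_wa :: "laurent_wa \<Rightarrow> laurent_zwaE" where
  "include_wa p =
     (\<Sum>(m, n) \<in> Poly_Mapping.keys p.
        Poly_Mapping.single (0, m, n, 0) (Poly_Mapping.lookup p (m, n)))"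

section \<open>The regular isotopy version of the Homflypt polynomial\<close>

definition regular_homflypt :: "(link_diagram \<Rightarrow> laurent_wa) \<Rightarrow> bool" where
  "regular_homflypt R \<longleftrightarrow>
     regular_isotopy_invariant R \<and>
     (\<forall>k i Lpos Lneg Lzero. conway_triple k i Lpos Lneg Lzero \<longrightarrow>
        R Lpos - R Lneg = w_var * R Lzero) \<and>
     (\<forall>D D'. removes_curl True D D' \<longrightarrow> R D = a_pow 1 * R D') \<and>
     (\<forall>D D'. removes_curl False D D' \<longrightarrow> R D = a_pow (- 1) * R D') \<and>
     (\<forall>D. standard_circle D \<longrightarrow> R D = 1)"

end

(* Existence comes from a closed formula of Lickorish: H[R](L) is a weighted sum of the products of
   the polynomials R of the sublinks of L, over all partitions of the components into blocks. At a
   mixed crossing only the partitions that put both components into one block contribute to the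
   skein relation, and for these it is the relation of R. The weights are chosen such that the sum
   collapses on unlinked knots. This uses that R is multiplicative up to eta under split union: every
   diagram reduces, by regular isotopy, curls and the skein relation, to a circle, so that a
   functional with the properties of R is determined by its value on the circle.

   The components of a diagram are handled through colourings of its strands that are constant along
   the components: a move transports colourings, and the colouring by the components is universal.

   For uniqueness, order the components. Switching mixed crossings makes smaller components pass over
   larger ones, at the cost of diagrams with fewer crossings; then the components can be pulled apart
   one after the other, which leaves unlinked knots. *)

theory Submission
  imports Defs "HOL-Library.Disjoint_Sets"
begin

section \<open>Regular isotopy of words\<close>

text \<open>The split-union formula for \<open>R\<close> is not among the properties listed in
  \<open>regular_homflypt\<close>; it has to be derived from them. The reduction behind it proceeds
  event by event, hence through words that do not close up: this is why isotopy and spanning are set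
  up for arbitrary levels, and why the induction runs over the number of strands.

  Components are sets of points of one particular word, so those of two diagrams related by a move
  are unrelated as sets. A colouring is carried by the word itself and follows the move. That a
  transported colouring still separates all components is obtained by counting: colourings
  transported both ways give two inequalities between the numbers of components.

  The factor \<open>eta^(k - 1)\<close> belonging to \<open>k\<close> blocks makes a summand the
  value that \<open>R\<close> would take if the sublinks of the blocks were pulled apart. The rest
  of the coefficient comes from a recursion: a new component joins each of the \<open>k\<close>
  present blocks with weight \<open>y\<close>, or opens a block with weight \<open>e - k y\<close>,
  and this adds up to \<open>e\<close>.\<close>

definition word_move :: "event list \<Rightarrow> event list \<Rightarrow> bool" where
  "word_move u v \<longleftrightarrow> planar_move u v \<or> reidemeister_2 u v \<or> reidemeister_3 u v"

text \<open>The moves carry no directions; requiring both words to run from \<open>s\<close>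
  enforces them. The level \<open>s\<close> may be non-empty, so that words can stand for parts of
  diagrams.\<close>

definition word_step :: "level \<Rightarrow> event list \<Rightarrow> event list \<Rightarrow> bool" where
  "word_step s u v \<longleftrightarrow> (\<exists>xs ys a b. word_move a b \<and> u = xs @ a @ ys \<and> v = xs @ b @ ys) \<and>
     run u s \<noteq> None \<and> run v s \<noteq> None"

definition word_isotopic :: "level \<Rightarrow> event list \<Rightarrow> event list \<Rightarrow> bool" where
  "word_isotopic s = equivclp (word_step s)"

lemma run_append: "run (u @ v) s = Option.bind (run u s) (run v)"
  by (induction u arbitrary: s) (auto split: option.splits)

lemma run_append_Some [simp]: "run u s = Some t \<Longrightarrow> run (u @ v) s = run v t"
  by (simp add: run_append)

lemma run_append_SomeE:
  assumes "run (u @ v) s = Some t"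
  obtains r where "run u s = Some r" "run v r = Some t"
  using assms by (auto simp: run_append bind_eq_Some_conv)

lemma run_ConsE:
  assumes "run (e # u) s = Some t"
  obtains r where "apply_event e s = Some r" "run u r = Some t"
  using assms by (auto split: option.splits)

lemma word_isotopic_refl [simp, intro]: "word_isotopic s u u"
  by (simp add: word_isotopic_def)

lemma word_isotopic_sym: "word_isotopic s u v \<Longrightarrow> word_isotopic s v u"
  by (simp add: word_isotopic_def equivclp_sym)

lemma word_isotopic_trans [trans]:
  "word_isotopic s u v \<Longrightarrow> word_isotopic s v w \<Longrightarrow> word_isotopic s u w"
  unfolding word_isotopic_def by (rule equivclp_trans)

section \<open>Words placed beside further strands\<close>

definition shift :: "nat \<Rightarrow> event \<Rightarrow> event" where
  "shift n e = (case e of Cup i d \<Rightarrow> Cup (i + n) d | Cap i \<Rightarrow> Cap (i + n) | Cross i b \<Rightarrow> Cross (i + n) b)"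

lemma shift_simps [simp]:
  "shift n (Cup i d) = Cup (i + n) d" "shift n (Cap i) = Cap (i + n)"
  "shift n (Cross i b) = Cross (i + n) b"
  by (simp_all add: shift_def)

lemma pos_shift [simp]: "pos (shift n e) = pos e + n"
  by (cases e) auto

lemma strands_shift [simp]: "strands_in (shift n e) = strands_in e" "strands_out (shift n e) = strands_out e"
  by (cases e; auto)+

lemma shift_shift [simp]: "shift m (shift n e) = shift (n + m) e"
  by (cases e) auto

lemma shift_0 [simp]: "shift 0 e = e"
  by (cases e) auto

lemma shift_pos_obtain: 
  assumes "n \<le> pos e" obtains e' where "e = shift n e'" "pos e' = pos e - n"
proof (cases e)
  case (Cup i d)
  then show ?thesis using assms that[of "Cup (i - n) d"] by auto
next
  case (Cap i)
  then show ?thesis using assms that[of "Cap (i - n)"] by auto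
next
  case (Cross i b)
  then show ?thesis using assms that[of "Cross (i - n) b"] by auto
qed

lemma apply_shift:
  "length c = n \<Longrightarrow> apply_event (shift n e) (c @ s) = map_option ((@) c) (apply_event e s)"
  by (cases e) (auto simp: nth_append)

lemma run_shift:
  "length c = n \<Longrightarrow> run (map (shift n) u) (c @ s) = map_option ((@) c) (run u s)"
  by (induction u arbitrary: s) (auto simp: apply_shift split: option.splits)

lemma apply_append_right:
  "apply_event e s = Some t \<Longrightarrow> apply_event e (s @ d) = Some (t @ d)"
  by (cases e) (auto simp: nth_append split: if_splits)

lemma run_append_right: "run u s = Some t \<Longrightarrow> run u (s @ d) = Some (t @ d)"
proof (induction u arbitrary: s)
  case (Cons e u)
  then obtain r where r: "apply_event e s = Some r" "run u r = Some t"
    by (auto split: option.splits)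
  show ?case using apply_append_right[OF r(1), of d] Cons.IH[OF r(2)] by simp
qed auto

text \<open>An event sees only \<open>strands_in e\<close> strands. The clause with arbitrary
  \<open>b'\<close> lets a second event act to their right without disturbing it, as needed in
  \<open>run_exchange\<close>.\<close>

lemma apply_event_local:
  assumes "apply_event e s = Some t"
  obtains a m m' b where "s = a @ m @ b" "t = a @ m' @ b" "length a = pos e"
    "length m = strands_in e" "length m' = strands_out e"
    "\<And>b'. apply_event e (a @ m @ b') = Some (a @ m' @ b')"
proof (cases e)
  case (Cup i d)
  show ?thesis
    by (rule that[of "take i s" "[]" "drop i s" "[d, opposite d]"])
      (use assms Cup in \<open>auto split: if_splits\<close>)
next
  case (Cap i)
  with assms have i: "Suc i < length s" by (auto split: if_splits)
  then have "drop i s = s ! i # s ! Suc i # drop (i + 2) s"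
    by (metis Cons_nth_drop_Suc Suc_lessD add_2_eq_Suc')
  then have "s = take i s @ [s ! i, s ! Suc i] @ drop (i + 2) s"
    by (metis append_Cons append_Nil append_take_drop_id)
  then show ?thesis
    by (rule that[of _ _ _ "[]"]) (use assms Cap i in \<open>auto simp: nth_append split: if_splits\<close>)
next
  case (Cross i c)
  with assms have i: "Suc i < length s" by (auto split: if_splits)
  then have "drop i s = s ! i # s ! Suc i # drop (i + 2) s"
    by (metis Cons_nth_drop_Suc Suc_lessD add_2_eq_Suc')
  then have "s = take i s @ [s ! i, s ! Suc i] @ drop (i + 2) s"
    by (metis append_Cons append_Nil append_take_drop_id)
  then show ?thesis
    by (rule that[of _ _ _ "[s ! Suc i, s ! i]"]) (use assms Cross i in \<open>auto simp: nth_append split: if_splits\<close>)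
qed

text \<open>One-sided because a move may enlarge the set of levels from which a word runs: the empty
  word runs from every level, the zigzag that it replaces does not. Quantifying over all levels
  makes the relation transitive and stable in context with no levels to carry along.\<close>

definition reduces :: "event list \<Rightarrow> event list \<Rightarrow> bool" (infix "\<leadsto>" 50) where
  "u \<leadsto> v \<longleftrightarrow> (\<forall>s t. run u s = Some t \<longrightarrow> run v s = Some t \<and> word_isotopic s u v)"

lemma reducesD: "u \<leadsto> v \<Longrightarrow> run u s = Some t \<Longrightarrow> run v s = Some t"
  "u \<leadsto> v \<Longrightarrow> run u s = Some t \<Longrightarrow> word_isotopic s u v"
  by (auto simp: reduces_def)

lemma reduces_refl [simp, intro]: "u \<leadsto> u"
  by (simp add: reduces_def)

lemma reduces_trans [trans]: "u \<leadsto> v \<Longrightarrow> v \<leadsto> w \<Longrightarrow> u \<leadsto> w"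
  unfolding reduces_def using word_isotopic_trans by blast

lemma word_stepI:
  assumes "word_move a b" "run a s = Some t" "run b s = Some t"
  shows "word_isotopic s a b"
  unfolding word_isotopic_def
  by (rule r_into_equivclp)
    (use assms in \<open>simp add: word_step_def, metis append_Nil append_Nil2\<close>)

lemma reduces_move:
  assumes "word_move u v \<or> word_move v u" "\<And>s t. run u s = Some t \<Longrightarrow> run v s = Some t"
  shows "u \<leadsto> v"
  using assms unfolding reduces_def by (metis word_stepI word_isotopic_sym)


section \<open>Effect of both sides of a move on the level\<close>

lemma split1: 
  assumes "i < length s" obtains a x c where "s = a @ x # c" "length a = i"
  using assms id_take_nth_drop[of i s] by (metis length_take min.absorb4)

lemma split2:
  assumes "Suc i < length s" obtains a x y c where "s = a @ x # y # c" "length a = i"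
proof -
  obtain a x c where s: "s = a @ x # c" "length a = i"
    using assms split1[of i s] by auto
  moreover from s assms obtain y d where "c = y # d"
    by (cases c) auto
  ultimately show ?thesis using that by auto
qed

lemma split3:
  assumes "Suc (Suc i) < length s" obtains a x y z c where "s = a @ x # y # z # c" "length a = i"
proof -
  obtain a x y c where s: "s = a @ x # y # c" "length a = i"
    using assms by (meson Suc_lessD split2)
  moreover from s assms obtain z d where "c = z # d"
    by (cases c) auto
  ultimately show ?thesis using that by auto
qed

lemma apply_Cup_append [simp]:
  "length a = i \<Longrightarrow> apply_event (Cup i d) (a @ c) = Some (a @ d # opposite d # c)"
  by auto

lemma apply_Cross_append [simp]:
  "length a = i \<Longrightarrow> apply_event (Cross i b) (a @ x # y # c) = Some (a @ y # x # c)"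
  by (auto simp: nth_append)

lemma apply_Cap_append [simp]:
  "length a = i \<Longrightarrow> apply_event (Cap i) (a @ x # y # c) = (if x \<noteq> y then Some (a @ c) else None)"
  by (auto simp: nth_append)

lemma opposite_opposite [simp]: "opposite (opposite d) = d"
  by (cases d) auto

lemma opposite_neq [simp]: "opposite d \<noteq> d" "d \<noteq> opposite d"
  by (cases d; simp)+

lemma opposite_eq_iff: "x \<noteq> y \<longleftrightarrow> y = opposite x"
  by (cases x; cases y) auto

lemma run_zigzag_right: 
  "run [Cup (Suc i) d, Cap i] s = Some t \<longleftrightarrow> t = s \<and> i < length s \<and> s ! i = opposite d"
proof (cases "i < length s")
  case True
  then obtain a x c where s: "s = a @ x # c" "length a = i"
    by (rule split1)
  have "apply_event (Cup (Suc i) d) ((a @ [x]) @ c) = Some ((a @ [x]) @ d # opposite d # c)"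
    using s by (intro apply_Cup_append) simp
  then show ?thesis
    using s by (auto simp del: apply_event.simps simp: opposite_eq_iff)
next
  case False
  then show ?thesis by auto
qed

lemma run_zigzag_left: 
  "run [Cup i d, Cap (Suc i)] s = Some t \<longleftrightarrow> t = s \<and> i < length s \<and> s ! i = d"
proof (cases "i < length s")
  case True
  then obtain a x c where s: "s = a @ x # c" "length a = i"
    by (rule split1)
  have "apply_event (Cap (Suc i)) ((a @ [d]) @ opposite d # x # c) =
      (if opposite d \<noteq> x then Some ((a @ [d]) @ c) else None)"
    using s by (intro apply_Cap_append) simp
  then show ?thesis
    using s by (auto simp del: apply_event.simps simp: opposite_eq_iff)
next
  case False
  then show ?thesis by auto
qed

lemma run_Cross_Cross: 
  "run [Cross i b, Cross i b'] s = Some t \<longleftrightarrow> t = s \<and> Suc i < length s"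
proof (cases "Suc i < length s")
  case True
  then obtain a x y c where s: "s = a @ x # y # c" "length a = i"
    by (rule split2)
  then show ?thesis
    by (auto simp del: apply_event.simps)
next
  case False
  then show ?thesis by auto
qed

lemma run_through_cup:
  "run [Cup i d, Cross (Suc i) b] s = run [Cup (Suc i) d, Cross i b'] s"
proof (cases "i < length s")
  case True
  then obtain a x c where s: "s = a @ x # c" "length a = i"
    by (rule split1)
  have "apply_event (Cup (Suc i) d) ((a @ [x]) @ c) = Some ((a @ [x]) @ d # opposite d # c)"
    "apply_event (Cross (Suc i) b) ((a @ [d]) @ opposite d # x # c) = 
       Some ((a @ [d]) @ x # opposite d # c)"
    using s by (intro apply_Cup_append apply_Cross_append; simp)+
  then show ?thesis
    using s by (auto simp del: apply_event.simps)
next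
  case False
  then show ?thesis by auto
qed

lemma run_through_cap:
  "run [Cross i b, Cap (Suc i)] s = run [Cross (Suc i) b', Cap i] s"
proof (cases "Suc (Suc i) < length s")
  case True
  then obtain a x y z c where s: "s = a @ x # y # z # c" "length a = i"
    by (rule split3)
  have "apply_event (Cap (Suc i)) ((a @ [y]) @ x # z # c) = (if x \<noteq> z then Some ((a @ [y]) @ c) else None)"
    "apply_event (Cross (Suc i) b') ((a @ [x]) @ y # z # c) = Some ((a @ [x]) @ z # y # c)"
    using s by (intro apply_Cap_append apply_Cross_append; simp)+
  then show ?thesis
    using s by (auto simp del: apply_event.simps)
next
  case False
  then show ?thesis by auto
qed

lemma run_reidemeister_3:
  "run [Cross i b1, Cross (Suc i) b2, Cross i b3] s = run [Cross (Suc i) b3, Cross i b2, Cross (Suc i) b1] s"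
proof (cases "Suc (Suc i) < length s")
  case True
  then obtain a x y z c where s: "s = a @ x # y # z # c" "length a = i"
    by (rule split3)
  have *: "apply_event (Cross (Suc i) b) ((a @ [x]) @ y # z # c) = Some ((a @ [x]) @ z # y # c)" for b x y z
    using s by (intro apply_Cap_append apply_Cross_append; simp)+
  show ?thesis
    using s *[of _ x] *[of _ y] *[of _ z] by (auto simp del: apply_event.simps)
next
  case False
  then show ?thesis by auto
qed

lemma run_exchange:
  assumes "pos e \<le> pos f"
  shows "run [e, shift (strands_out e) f] s = run [shift (strands_in e) f, e] s"
proof (cases "apply_event e s")
  case None
  obtain f' where f: "f = shift (pos e) f'"
    using assms by (metis shift_pos_obtain)
  \<comment> \<open>The shifted \<open>f\<close> acts to the right of the strands that
    \<open>e\<close> reads and leaves them untouched; so if \<open>e\<close> fails on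
    \<open>s\<close>, it fails after \<open>f\<close> as well.\<close>
  have "run [shift (strands_in e) f, e] s = None"
  proof (rule ccontr)
    assume "run [shift (strands_in e) f, e] s \<noteq> None"
    then obtain r where r: "apply_event (shift (strands_in e) f) s = Some r" "apply_event e r \<noteq> None"
      by (auto split: option.splits)
    then have "pos e + strands_in e \<le> length s"
      using assms by (cases f; cases e) (auto split: if_splits)
    then obtain c s' where s: "s = c @ s'" "length c = pos e + strands_in e"
      by (metis append_take_drop_id length_take min.absorb2)
    with r f obtain r' where "r = c @ r'" 
      by (auto simp: apply_shift add.commute)
    with s r None show False
      by (cases e) (auto simp: nth_append split: if_splits)
  qed
  then show ?thesis using None by simp
next
  case (Some t)
  obtain f' where f: "f = shift (pos e) f'"
    using assms by (metis shift_pos_obtain)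
  obtain a m m' b where l: "s = a @ m @ b" "t = a @ m' @ b" "length a = pos e"
    "length m = strands_in e" "length m' = strands_out e"
    "\<And>b'. apply_event e (a @ m @ b') = Some (a @ m' @ b')"
    using apply_event_local[OF Some] by metis
  have 1: "apply_event (shift (strands_out e) f) t = map_option ((@) (a @ m')) (apply_event f' b)"
    using l apply_shift[of "a @ m'" _ f' b] by (simp add: f)
  have 2: "apply_event (shift (strands_in e) f) s = map_option ((@) (a @ m)) (apply_event f' b)"
    using l apply_shift[of "a @ m" _ f' b] by (simp add: f)
  show ?thesis using Some 1 2 l
    by (cases "apply_event f' b") auto
qed

text \<open>With the position of \<open>f\<close> counted without the strands of \<open>e\<close>,
  both positions in the exchange rule become shifts, and the truncated subtraction on
  \<open>nat\<close> disappears.\<close>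

lemma planar_move_exchange:
  assumes "pos e \<le> pos f"
  shows "planar_move [e, shift (strands_out e) f] [shift (strands_in e) f, e]"
  by (rule planar_move.exchange) (use assms in \<open>cases f; auto\<close>)+

lemma exchange_cases:
  assumes "pos e + strands_out e \<le> pos f"
     "f' = (case f of Cup j d \<Rightarrow> Cup (j - strands_out e + strands_in e) d
            | Cap j \<Rightarrow> Cap (j - strands_out e + strands_in e)
            | Cross j b \<Rightarrow> Cross (j - strands_out e + strands_in e) b)"
  obtains g where "pos e \<le> pos g" "f = shift (strands_out e) g" "f' = shift (strands_in e) g"
proof -
  obtain g where g: "f = shift (strands_out e) g" "pos g = pos f - strands_out e"
    using assms shift_pos_obtain[of "strands_out e" f] by auto
  moreover have "f' = shift (strands_in e) g"
    using g(1) by (cases g) (auto simp: assms(2))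
  ultimately show ?thesis using assms that[of g] by auto
qed

lemma word_move_run: 
  assumes "word_move u v" "run u s = Some t" shows "run v s = Some t"
  using assms(1) unfolding word_move_def
proof (elim disjE)
  assume "planar_move u v"
  then show ?thesis
  proof cases
    case (exchange e f f')
    then show ?thesis using assms(2) by (metis exchange_cases run_exchange)
  next
    case through_cup
    then show ?thesis using assms(2) run_through_cup by metis
  next
    case through_cap
    then show ?thesis using assms(2) run_through_cap by metis
  qed (use assms(2) in \<open>auto simp del: run.simps simp: run_zigzag_left run_zigzag_right\<close>, auto)
next
  assume "reidemeister_2 u v"
  then show ?thesis
    by cases (use assms(2) in \<open>auto simp del: run.simps simp: run_Cross_Cross\<close>, auto)
next
  assume "reidemeister_3 u v"
  then show ?thesis
    by cases (use assms(2) run_reidemeister_3 in metis)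
qed

lemma word_step_run:
  assumes "word_step s u v" shows "run u s = run v s"
proof -
  from assms obtain xs ys a b t where m: "word_move a b" "u = xs @ a @ ys" "v = xs @ b @ ys"
    "run u s = Some t"
    unfolding word_step_def by blast
  from m obtain r r' where "run xs s = Some r" "run a r = Some r'" "run ys r' = Some t"
    by (auto simp: run_append bind_eq_Some_conv)
  with m word_move_run[OF m(1)] show ?thesis by simp
qed

lemma word_isotopic_run: "word_isotopic s u v \<Longrightarrow> run u s = run v s"
  unfolding word_isotopic_def
  by (induction rule: equivclp_induct) (auto dest: word_step_run)

lemma word_isotopic_context:
  assumes "word_isotopic r u v" "run p s = Some r" "run u r = Some t" "run q t = Some t'"
  shows "word_isotopic s (p @ u @ q) (p @ v @ q)"
  using assms(1) unfolding word_isotopic_def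
proof (induction rule: equivclp_induct)
  case base
  show ?case by simp
next
  case (step v w)
  have *: "word_step s (p @ v @ q) (p @ w @ q)"
    if vw: "word_step r v w" and iv: "run v r = Some t" and iw: "run w r = Some t" for v w
  proof -
    obtain xs ys a b where m: "word_move a b" "v = xs @ a @ ys" "w = xs @ b @ ys"
      using vw unfolding word_step_def by blast
    have "run (p @ v @ q) s \<noteq> None" "run (p @ w @ q) s \<noteq> None"
      using iv iw assms by (auto simp: run_append)
    moreover have "p @ v @ q = (p @ xs) @ a @ (ys @ q)" "p @ w @ q = (p @ xs) @ b @ (ys @ q)"
      using m by simp_all
    ultimately show ?thesis
      using m(1) unfolding word_step_def by blast
  qed
  have "run v r = Some t" "run w r = Some t"
    using step(1,2) assms(3) word_isotopic_run word_step_run unfolding word_isotopic_def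
    by (metis)+
  with step(2) * have "word_step s (p @ v @ q) (p @ w @ q) \<or> word_step s (p @ w @ q) (p @ v @ q)"
    by blast
  with step.IH show ?case
    by (rule equivclp_into_equivclp)
qed

lemma reduces_context:
  assumes "u \<leadsto> v" shows "p @ u @ q \<leadsto> p @ v @ q"
  unfolding reduces_def
proof (intro allI impI)
  fix s t assume "run (p @ u @ q) s = Some t"
  then obtain r r' where r: "run p s = Some r" "run u r = Some r'" "run q r' = Some t"
    by (auto simp: run_append bind_eq_Some_conv)
  moreover have "run v r = Some r'"
    using assms r reducesD by blast
  moreover have "word_isotopic s (p @ u @ q) (p @ v @ q)"
    using word_isotopic_context reducesD(2)[OF assms r(2)] r by blast
  ultimately show "run (p @ v @ q) s = Some t \<and> word_isotopic s (p @ u @ q) (p @ v @ q)"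
    by simp
qed

lemma reduces_prefix: "u \<leadsto> v \<Longrightarrow> p @ u \<leadsto> p @ v"
  using reduces_context[of u v p "[]"] by simp

lemma reduces_suffix: "u \<leadsto> v \<Longrightarrow> u @ q \<leadsto> v @ q"
  using reduces_context[of u v "[]" q] by simp

lemma reduces_Cons: "u \<leadsto> v \<Longrightarrow> e # u \<leadsto> e # v"
  using reduces_prefix[of u v "[e]"] by simp

section \<open>The individual moves as reductions\<close>

lemma word_move_reduces: "word_move u v \<Longrightarrow> u \<leadsto> v"
  by (rule reduces_move) (auto intro: word_move_run)

lemma red_exchange:
  assumes "pos e \<le> pos f"
  shows "[e, shift (strands_out e) f] \<leadsto> [shift (strands_in e) f, e]"
    "[shift (strands_in e) f, e] \<leadsto> [e, shift (strands_out e) f]"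
  by (rule reduces_move; use assms planar_move_exchange run_exchange in \<open>simp add: word_move_def del: run.simps\<close>)+

lemma red_zigzag_right: "[Cup (Suc i) d, Cap i] \<leadsto> []"
  and red_zigzag_left: "[Cup i d, Cap (Suc i)] \<leadsto> []"
  by (rule word_move_reduces, simp add: word_move_def planar_move.intros)+

lemma red_reidemeister_2: "b' = (\<not> b) \<Longrightarrow> [Cross i b, Cross i b'] \<leadsto> []"
  by (rule word_move_reduces, simp add: word_move_def reidemeister_2.intros)

lemma red_reidemeister_3: 
  assumes "b2 = b1 \<or> b2 = b3"
  shows "[Cross i b1, Cross (Suc i) b2, Cross i b3] \<leadsto> [Cross (Suc i) b3, Cross i b2, Cross (Suc i) b1]"
   "[Cross (Suc i) b3, Cross i b2, Cross (Suc i) b1] \<leadsto> [Cross i b1, Cross (Suc i) b2, Cross i b3]"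
  by (rule reduces_move; use assms run_reidemeister_3 in \<open>simp add: word_move_def reidemeister_3.intros del: run.simps\<close>)+

lemma red_through_cup:
  "[Cup i d, Cross (Suc i) b] \<leadsto> [Cup (Suc i) d, Cross i (\<not> b)]"
  "[Cup (Suc i) d, Cross i b] \<leadsto> [Cup i d, Cross (Suc i) (\<not> b)]"
  by (rule reduces_move; use planar_move.through_cup[of i d b] planar_move.through_cup[of i d "\<not> b"] in \<open>simp add: word_move_def del: run.simps\<close>;
      metis run_through_cup)+

lemma red_through_cap:
  "[Cross i b, Cap (Suc i)] \<leadsto> [Cross (Suc i) (\<not> b), Cap i]"
  "[Cross (Suc i) b, Cap i] \<leadsto> [Cross i (\<not> b), Cap (Suc i)]"
  by (rule reduces_move; use planar_move.through_cap[of i b] planar_move.through_cap[of i "\<not> b"] in \<open>simp add: word_move_def del: run.simps\<close>;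
      metis run_through_cap)+

section \<open>A strand passing over its neighbours\<close>

text \<open>The strand at position \<open>p\<close> travels to position \<open>p + n\<close>, over
  the \<open>n\<close> strands to its right: in \<open>Cross p True\<close> the strand rising to the
  right lies on top.\<close>

primrec overpass :: "nat \<Rightarrow> nat \<Rightarrow> event list" where
  "overpass p 0 = []"
| "overpass p (Suc n) = Cross p True # overpass (Suc p) n"

lemma overpass_add: "overpass p (m + n) = overpass p m @ overpass (p + m) n"
  by (induction m arbitrary: p) auto

lemma overpass_snoc: "overpass p (Suc n) = overpass p n @ [Cross (p + n) True]"
  using overpass_add[of p n 1] by simp

lemma run_overpass:
  "length a = p \<Longrightarrow> length b = n \<Longrightarrow> run (overpass p n) (a @ x # b @ c) = Some (a @ b @ x # c)"
proof (induction n arbitrary: p a b)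
  case (Suc n)
  then obtain y b' where b: "b = y # b'" "length b' = n"
    by (cases b) auto
  have "run (overpass (Suc p) n) ((a @ [y]) @ x # b' @ c) = Some ((a @ [y]) @ b' @ x # c)"
    using Suc b by (intro Suc.IH) auto
  then show ?case
    using Suc.prems b by (simp del: apply_event.simps)
qed simp

lemma run_overpass_length:
  "run (overpass p n) s = Some t \<Longrightarrow> length t = length s \<and> (n = 0 \<or> p + n < length s)"
proof (induction n arbitrary: p s)
  case (Suc n)
  then obtain r where r: "apply_event (Cross p True) s = Some r" "run (overpass (Suc p) n) r = Some t"
    by (auto split: option.splits if_splits)
  then have "Suc p < length s" "length r = length s"
    by (auto split: if_splits)
  with Suc.IH[OF r(2)] show ?case by auto
qed simp

text \<open>Events to the left only renumber the travelling strand, by the strands that they consume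
  or create.\<close>

lemma overpass_exchange_left:
  assumes "pos e \<le> q"
  shows "e # overpass (q + strands_out e) n \<leadsto> overpass (q + strands_in e) n @ [e]"
    "overpass (q + strands_in e) n @ [e] \<leadsto> e # overpass (q + strands_out e) n"
  using assms
proof (induction n arbitrary: q)
  case (Suc n)
  case 1
  have "e # overpass (q + strands_out e) (Suc n) = [e, shift (strands_out e) (Cross q True)] @ overpass (Suc q + strands_out e) n"
    by simp
  also have "\<dots> \<leadsto> [shift (strands_in e) (Cross q True), e] @ overpass (Suc q + strands_out e) n"
    using 1 by (intro reduces_suffix red_exchange) simp
  also have "\<dots> = shift (strands_in e) (Cross q True) # (e # overpass (Suc q + strands_out e) n)"
    by simp
  also have "\<dots> \<leadsto> shift (strands_in e) (Cross q True) # (overpass (Suc q + strands_in e) n @ [e])"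
    using 1 by (intro reduces_Cons Suc.IH) simp
  finally show ?case by simp
next
  case (Suc n)
  case 2
  have "overpass (q + strands_in e) (Suc n) @ [e] = shift (strands_in e) (Cross q True) # (overpass (Suc q + strands_in e) n @ [e])"
    by simp
  also have "\<dots> \<leadsto> shift (strands_in e) (Cross q True) # (e # overpass (Suc q + strands_out e) n)"
    using 2 by (intro reduces_Cons Suc.IH) simp
  also have "\<dots> = [shift (strands_in e) (Cross q True), e] @ overpass (Suc q + strands_out e) n"
    by simp
  also have "\<dots> \<leadsto> [e, shift (strands_out e) (Cross q True)] @ overpass (Suc q + strands_out e) n"
    using 2 by (intro reduces_suffix red_exchange) simp
  finally show ?case by simp
qed auto

lemma cross_exchange_right:
  assumes "p + 1 < pos e"
  shows "[Cross p b, e] \<leadsto> [e, Cross p b]" "[e, Cross p b] \<leadsto> [Cross p b, e]"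
proof -
  from assms obtain f where f: "e = shift 2 f" "pos f = pos e - 2"
    using shift_pos_obtain[of 2 e] by auto
  from f(2) assms have "p \<le> pos f" by linarith
  with red_exchange[of "Cross p b" f] f(1)
  show "[Cross p b, e] \<leadsto> [e, Cross p b]" "[e, Cross p b] \<leadsto> [Cross p b, e]"
    by auto
qed

lemma overpass_exchange_right:
  assumes "p + n < pos e"
  shows "overpass p n @ [e] \<leadsto> e # overpass p n" "e # overpass p n \<leadsto> overpass p n @ [e]"
  using assms
proof (induction n arbitrary: p)
  case (Suc n)
  case 1
  have "overpass p (Suc n) @ [e] = Cross p True # (overpass (Suc p) n @ [e])"
    by simp
  also have "\<dots> \<leadsto> Cross p True # (e # overpass (Suc p) n)"
    using 1 by (intro reduces_Cons Suc.IH) simp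
  also have "\<dots> = [Cross p True, e] @ overpass (Suc p) n"
    by simp
  also have "\<dots> \<leadsto> [e, Cross p True] @ overpass (Suc p) n"
    using 1 by (intro reduces_suffix cross_exchange_right) simp
  finally show ?case by simp
next
  case (Suc n)
  case 2
  have "e # overpass p (Suc n) = [e, Cross p True] @ overpass (Suc p) n"
    by simp
  also have "\<dots> \<leadsto> [Cross p True, e] @ overpass (Suc p) n"
    using 2 by (intro reduces_suffix cross_exchange_right) simp
  also have "\<dots> = Cross p True # (e # overpass (Suc p) n)"
    by simp
  also have "\<dots> \<leadsto> Cross p True # (overpass (Suc p) n @ [e])"
    using 2 by (intro reduces_Cons Suc.IH) simp
  finally show ?case by simp
qed auto

lemma overpass_split3:
  "k + j + r = n \<Longrightarrow> overpass p n = overpass p k @ overpass (p + k) j @ overpass (p + k + j) r"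
  using overpass_add[of p k "j + r"] overpass_add[of "p + k" j r] by (simp add: add.assoc)

lemma overpass_split2:
  "k + 2 + r = n \<Longrightarrow> overpass p n = overpass p k @ [Cross (p + k) True, Cross (Suc (p + k)) True] @ overpass (p + k + 2) r"
  using overpass_split3[of k 2 r n p] by (simp add: numeral_2_eq_2)

text \<open>Only two steps of the overpass meet the crossing. There it is Reidemeister III,
  admissible for both values of \<open>b\<close> since the travelling strand lies above the two
  others.\<close>

lemma overpass_cross:
  assumes "k + 2 \<le> n"
  shows "overpass p n @ [Cross (p + k) b] \<leadsto> Cross (Suc (p + k)) b # overpass p n"
proof -
  obtain r where r: "k + 2 + r = n" using assms le_Suc_ex by blast
  let ?A = "overpass p k" let ?B = "overpass (p + k + 2) r"
  have *: "overpass p n = ?A @ [Cross (p + k) True, Cross (Suc (p + k)) True] @ ?B"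
    by (rule overpass_split2[OF r])
  have "overpass p n @ [Cross (p + k) b] = (?A @ [Cross (p + k) True, Cross (Suc (p + k)) True]) @ (?B @ [Cross (p + k) b])"
    by (simp add: *)
  also have "\<dots> \<leadsto> (?A @ [Cross (p + k) True, Cross (Suc (p + k)) True]) @ (Cross (p + k) b # ?B)"
    using overpass_exchange_left(2)[of "Cross (p + k) b" "p + k"] by (intro reduces_prefix) simp
  also have "\<dots> = ?A @ [Cross (p + k) True, Cross (Suc (p + k)) True, Cross (p + k) b] @ ?B"
    by simp
  also have "\<dots> \<leadsto> ?A @ [Cross (Suc (p + k)) b, Cross (p + k) True, Cross (Suc (p + k)) True] @ ?B"
    by (intro reduces_context red_reidemeister_3) simp
  also have "\<dots> = (?A @ [Cross (Suc (p + k)) b]) @ [Cross (p + k) True, Cross (Suc (p + k)) True] @ ?B"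
    by simp
  also have "\<dots> \<leadsto> (Cross (Suc (p + k)) b # ?A) @ [Cross (p + k) True, Cross (Suc (p + k)) True] @ ?B"
    by (intro reduces_suffix overpass_exchange_right) simp
  finally show ?thesis by (simp add: *)
qed

lemma run_crossings:
  "\<forall>e \<in> set u. \<exists>i b. e = Cross i b \<and> Suc i < n \<Longrightarrow> length s = n \<Longrightarrow> \<exists>t. run u s = Some t \<and> length t = n"
  by (induction u arbitrary: s) (auto 0 3)

lemma set_overpass: "set (overpass p n) = (\<lambda>i. Cross i True) ` {p..<p + n}"
  by (induction n arbitrary: p) (auto simp: image_iff Bex_def)

text \<open>Crossings never fail on a level that is wide enough, and \<open>k + 2 \<le> n\<close>
  keeps the crossing within the range of the overpass. So both words run from the same levels, and
  the reduction can be reversed.\<close>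

lemma cross_overpass:
  assumes "k + 2 \<le> n"
  shows "Cross (Suc (p + k)) b # overpass p n \<leadsto> overpass p n @ [Cross (p + k) b]"
  unfolding reduces_def
proof (intro allI impI)
  fix s t assume t: "run (Cross (Suc (p + k)) b # overpass p n) s = Some t"
  then obtain r where "apply_event (Cross (Suc (p + k)) b) s = Some r" "run (overpass p n) r = Some t"
    by (auto split: option.splits)
  moreover from this(1) have "length r = length s"
    by (auto split: if_splits)
  ultimately have "p + n < length s"
    using run_overpass_length[of p n r t] assms by auto
  then obtain t' where t': "run (overpass p n @ [Cross (p + k) b]) s = Some t'"
    using run_crossings[of "overpass p n @ [Cross (p + k) b]" "length s" s] assms
    by (auto simp: set_overpass)
  with reducesD[OF overpass_cross[OF assms] t'] t
  show "run (overpass p n @ [Cross (p + k) b]) s = Some t \<and>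
     word_isotopic s (Cross (Suc (p + k)) b # overpass p n) (overpass p n @ [Cross (p + k) b])"
    by (simp add: word_isotopic_sym)
qed

text \<open>The travelling strand passes over both legs of the minimum: \<open>through_cup\<close>
  turns one of the two crossings so that it cancels the other by Reidemeister II.\<close>

lemma cup_overpass:
  assumes "k \<le> n"
  shows "Cup (Suc (p + k)) d # overpass p (n + 2) \<leadsto> overpass p n @ [Cup (p + k) d]"
proof -
  obtain r where r: "k + r = n" using assms le_Suc_ex by blast
  let ?A = "overpass p k" let ?B = "\<lambda>q. overpass (p + k + q) r"
  let ?c = "Cross (p + k) True" let ?c' = "Cross (Suc (p + k)) True"
  have *: "overpass p (n + 2) = ?A @ [?c, ?c'] @ ?B 2"
    by (rule overpass_split2) (use r in simp)
  have "Cup (Suc (p + k)) d # overpass p (n + 2) = (Cup (Suc (p + k)) d # ?A) @ [?c, ?c'] @ ?B 2"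
    unfolding * by simp
  also have "\<dots> \<leadsto> (?A @ [Cup (Suc (p + k)) d]) @ [?c, ?c'] @ ?B 2"
    by (intro reduces_suffix overpass_exchange_right) simp
  also have "\<dots> = ?A @ [Cup (Suc (p + k)) d, ?c] @ (?c' # ?B 2)"
    by simp
  also have "\<dots> \<leadsto> ?A @ [Cup (p + k) d, Cross (Suc (p + k)) (\<not> True)] @ (?c' # ?B 2)"
    by (intro reduces_context red_through_cup)
  also have "\<dots> = (?A @ [Cup (p + k) d]) @ [Cross (Suc (p + k)) (\<not> True), ?c'] @ ?B 2"
    by simp
  also have "\<dots> \<leadsto> (?A @ [Cup (p + k) d]) @ [] @ ?B 2"
    by (intro reduces_context red_reidemeister_2) simp
  also have "\<dots> = ?A @ (Cup (p + k) d # ?B 2)"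
    by simp
  also have "\<dots> \<leadsto> ?A @ (?B 0 @ [Cup (p + k) d])"
    using overpass_exchange_left(1)[of "Cup (p + k) d" "p + k" r] by (intro reduces_prefix) simp
  also have "\<dots> = overpass p n @ [Cup (p + k) d]"
    using overpass_add[of p k r] r by simp
  finally show ?thesis .
qed

lemma overpass_cap:
  assumes "k \<le> n"
  shows "overpass p (n + 2) @ [Cap (p + k)] \<leadsto> Cap (Suc (p + k)) # overpass p n"
proof -
  obtain r where r: "k + r = n" using assms le_Suc_ex by blast
  let ?A = "overpass p k" let ?B = "\<lambda>q. overpass (p + k + q) r"
  let ?c = "Cross (p + k) True" let ?c' = "Cross (Suc (p + k)) True"
  have *: "overpass p (n + 2) = ?A @ [?c, ?c'] @ ?B 2"
    by (rule overpass_split2) (use r in simp)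
  have "overpass p (n + 2) @ [Cap (p + k)] = (?A @ [?c, ?c']) @ (?B 2 @ [Cap (p + k)])"
    unfolding * by simp
  also have "\<dots> \<leadsto> (?A @ [?c, ?c']) @ (Cap (p + k) # ?B 0)"
    using overpass_exchange_left(2)[of "Cap (p + k)" "p + k" r] by (intro reduces_prefix) simp
  also have "\<dots> = (?A @ [?c]) @ [?c', Cap (p + k)] @ ?B 0"
    by simp
  also have "\<dots> \<leadsto> (?A @ [?c]) @ [Cross (p + k) (\<not> True), Cap (Suc (p + k))] @ ?B 0"
    by (intro reduces_context red_through_cap)
  also have "\<dots> = ?A @ [?c, Cross (p + k) (\<not> True)] @ (Cap (Suc (p + k)) # ?B 0)"
    by simp
  also have "\<dots> \<leadsto> ?A @ [] @ (Cap (Suc (p + k)) # ?B 0)"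
    by (intro reduces_context red_reidemeister_2) simp
  also have "\<dots> = (?A @ [Cap (Suc (p + k))]) @ ?B 0"
    by simp
  also have "\<dots> \<leadsto> (Cap (Suc (p + k)) # ?A) @ ?B 0"
    by (intro reduces_suffix overpass_exchange_right) simp
  also have "\<dots> = Cap (Suc (p + k)) # overpass p n"
    using overpass_add[of p k r] r by simp
  finally show ?thesis .
qed

text \<open>The crossings of the first overpass are pushed one at a time through the second, whose
  strand lies above all of them.\<close>

lemma overpass_overpass:
  assumes "k + m + 1 \<le> n"
  shows "overpass (Suc (p + k)) m @ overpass p n \<leadsto> overpass p n @ overpass (p + k) m"
  using assms
proof (induction m arbitrary: k)
  case (Suc m)
  have "overpass (Suc (p + k)) (Suc m) @ overpass p n = Cross (Suc (p + k)) True # (overpass (Suc (p + Suc k)) m @ overpass p n)"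
    by simp
  also have "\<dots> \<leadsto> Cross (Suc (p + k)) True # (overpass p n @ overpass (p + Suc k) m)"
    using Suc.prems by (intro reduces_Cons Suc.IH) simp
  also have "\<dots> = (Cross (Suc (p + k)) True # overpass p n) @ overpass (p + Suc k) m"
    by simp
  also have "\<dots> \<leadsto> (overpass p n @ [Cross (p + k) True]) @ overpass (p + Suc k) m"
    using Suc.prems by (intro reduces_suffix cross_overpass) simp
  finally show ?case by simp
qed simp

text \<open>A crossing directly below a maximum is a curl in disguise: turning the maximum over
  exhibits the loop on one of its legs. The sign parameter flips because the legs of a maximum have
  opposite directions, while the strands at the crossing of a curl have equal ones.\<close>

lemma curl_before_cap: "[Cup i d, Cross (Suc i) (\<not> b), Cap i, Cap i] \<leadsto> [Cross i b, Cap i]"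
proof -
  have "[Cup i d, Cross (Suc i) (\<not> b), Cap i, Cap i] = [Cup i d, Cross (Suc i) (\<not> b)] @ [Cap i, shift (strands_out (Cap i)) (Cap i)]"
    by simp
  also have "\<dots> \<leadsto> [Cup i d, Cross (Suc i) (\<not> b)] @ [shift (strands_in (Cap i)) (Cap i), Cap i]"
    by (intro reduces_prefix red_exchange) simp
  also have "\<dots> = [Cup i d] @ [Cross (Suc i) (\<not> b), Cap (Suc (Suc i))] @ [Cap i]"
    by simp
  also have "\<dots> \<leadsto> [Cup i d] @ [Cross (Suc (Suc i)) (\<not> \<not> b), Cap (Suc i)] @ [Cap i]"
    by (intro reduces_context red_through_cap)
  also have "\<dots> = [Cup i d, shift (strands_out (Cup i d)) (Cross i b)] @ [Cap (Suc i), Cap i]"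
    by simp
  also have "\<dots> \<leadsto> [shift (strands_in (Cup i d)) (Cross i b), Cup i d] @ [Cap (Suc i), Cap i]"
    by (intro reduces_suffix red_exchange) simp
  also have "\<dots> = [Cross i b] @ [Cup i d, Cap (Suc i)] @ [Cap i]"
    by simp
  also have "\<dots> \<leadsto> [Cross i b] @ [] @ [Cap i]"
    by (intro reduces_context red_zigzag_left)
  finally show ?thesis by simp
qed

text \<open>Upside-down counterpart: a crossing directly above a minimum is a curl on one of its
  legs.\<close>

lemma cup_curl: "[Cup i e, Cup i d, Cross (Suc i) (\<not> b), Cap i] \<leadsto> [Cup i d, Cross i b]"
proof -
  have "[Cup i e, Cup i d, Cross (Suc i) (\<not> b), Cap i] = [shift (strands_in (Cup i d)) (Cup i e), Cup i d] @ [Cross (Suc i) (\<not> b), Cap i]"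
    by simp
  also have "\<dots> \<leadsto> [Cup i d, shift (strands_out (Cup i d)) (Cup i e)] @ [Cross (Suc i) (\<not> b), Cap i]"
    by (intro reduces_suffix red_exchange) simp
  also have "\<dots> = [Cup i d] @ [Cup (Suc (Suc i)) e, Cross (Suc i) (\<not> b)] @ [Cap i]"
    by simp
  also have "\<dots> \<leadsto> [Cup i d] @ [Cup (Suc i) e, Cross (Suc (Suc i)) (\<not> \<not> b)] @ [Cap i]"
    by (intro reduces_context red_through_cup)
  also have "\<dots> = [Cup i d, Cup (Suc i) e] @ [shift (strands_in (Cap i)) (Cross i b), Cap i]"
    by simp
  also have "\<dots> \<leadsto> [Cup i d, Cup (Suc i) e] @ [Cap i, shift (strands_out (Cap i)) (Cross i b)]"
    by (intro reduces_prefix red_exchange) simp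
  also have "\<dots> = [Cup i d] @ [Cup (Suc i) e, Cap i] @ [Cross i b]"
    by simp
  also have "\<dots> \<leadsto> [Cup i d] @ [] @ [Cross i b]"
    by (intro reduces_context red_zigzag_right)
  finally show ?thesis by simp
qed

section \<open>Words spanning the skein modules\<close>

text \<open>The words to which all others are reduced are stacks of arcs: every new arc starts at the left
  margin, and its right end passes over the \<open>n\<close> leftmost of the earlier strands.\<close>

definition block :: "direction \<Rightarrow> nat \<Rightarrow> event list" where
  "block d n = Cup 0 d # overpass 1 n"

inductive basis :: "event list \<Rightarrow> bool" where
  Nil: "basis []"
| snoc: "basis u \<Longrightarrow> basis (u @ block d n)"

text \<open>Each rule is a relation by which a skein functional is determined on the conclusion by
  its values on the premises. The condition on \<open>s\<close> in \<open>circle\<close> puts a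
  strand beside the circle or the circle at the bottom, the two situations in which its value is
  computed.\<close>

inductive spanned :: "level \<Rightarrow> event list \<Rightarrow> bool" where
  basis: "basis u \<Longrightarrow> run u [] = Some t \<Longrightarrow> spanned t u"
| isotopic: "spanned t u \<Longrightarrow> word_isotopic [] u v \<Longrightarrow> spanned t v"
| curl: "spanned t (u @ q) \<Longrightarrow> curl b c \<Longrightarrow> run (u @ c @ q) [] = Some t \<Longrightarrow> spanned t (u @ c @ q)"
| skein: "spanned t (u @ [Cross i b] @ q) \<Longrightarrow> run u [] = Some s \<Longrightarrow>
    spanned t (u @ smoothing i (s ! i) (s ! Suc i) @ q) \<Longrightarrow> spanned t (u @ [Cross i (\<not> b)] @ q)"
| circle: "spanned t (u @ q) \<Longrightarrow> run u [] = Some s \<Longrightarrow> s \<noteq> [] \<or> u = [] \<Longrightarrow>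
    spanned t (u @ [Cup 0 d, Cap 0] @ q)"

lemma run_block: "length b = n \<Longrightarrow> run (block d n) (b @ c) = Some (d # b @ opposite d # c)"
  using run_overpass[of "[d]" 1 b n "opposite d" c] by (simp add: block_def)

lemma run_block_ge: 
  assumes "n \<le> length s" 
  obtains t where "run (block d n) s = Some t" "length t = length s + 2"
  using run_block[of "take n s" n d "drop n s"] assms that by auto

lemma run_block_SomeD: 
  assumes "run (block d n) s = Some t"
  shows "n \<le> length s \<and> length t = length s + 2"
proof -
  have "run (overpass 1 n) (d # opposite d # s) = Some t"
    using assms by (simp add: block_def)
  from run_overpass_length[OF this] show ?thesis by auto
qed

lemma spanned_run: "spanned t u \<Longrightarrow> run u [] = Some t"
proof (induction rule: spanned.induct)
  case (isotopic t u v)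
  then show ?case using word_isotopic_run by metis
next
  case (skein t u i b q s)
  then show ?case by (simp add: run_append)
next
  case (circle t u q s d)
  then show ?case by (simp add: run_append)
qed auto

text \<open>Every rule stays valid with \<open>q\<close> appended on top, so a claim about attaching
  \<open>q\<close> needs to be checked for basis words only.\<close>

lemma spanned_append:
  assumes "spanned t u" "run q t = Some t'"
    and "\<And>g. basis g \<Longrightarrow> run g [] = Some t \<Longrightarrow> spanned t' (g @ q)"
  shows "spanned t' (u @ q)"
  using assms
proof (induction rule: spanned.induct)
  case (isotopic t u v)
  then have "spanned t' (u @ q)" by blast
  moreover have "word_isotopic [] (u @ q) (v @ q)"
    using word_isotopic_context[OF isotopic(2), of "[]" "[]" t q] spanned_run isotopic by fastforce
  ultimately show ?case by (rule spanned.isotopic)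
next
  case (curl t u q' b c)
  then show ?case using spanned.curl[of t' u "q' @ q" b c] 
    by (metis append.assoc run_append_Some)
next
  case (skein t u i b q' s)
  then show ?case using spanned.skein[of t' u i b "q' @ q" s] by simp
next
  case (circle t u q' s d)
  then show ?case using spanned.circle[of t' u "q' @ q" s d] by simp
qed auto

lemma spanned_reduces:
  assumes "u \<leadsto> v" "run u [] = Some t"
  shows "spanned t u \<longleftrightarrow> spanned t v"
  using reducesD(2)[OF assms] spanned.isotopic word_isotopic_sym by blast

lemma spanned_block:
  assumes "spanned s u" "run (block d n) s = Some t"
  shows "spanned t (u @ block d n)"
  by (rule spanned_append[OF assms]) (use assms in \<open>auto intro!: spanned.basis basis.snoc\<close>)

lemma basis_length: "basis u \<Longrightarrow> run u [] = Some t \<Longrightarrow> u = [] \<and> t = [] \<or> u \<noteq> [] \<and> 2 \<le> length t"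
proof (induction arbitrary: t rule: basis.induct)
  case (snoc u d n)
  from snoc.prems obtain r where "run u [] = Some r" "run (block d n) r = Some t"
    by (rule run_append_SomeE)
  with run_block_SomeD[of d n r t] show ?case
    by (simp add: block_def)
qed simp

section \<open>Events sliding below the arc drawn last\<close>

lemma block_cup_under:
  assumes "k \<le> n" shows "Cup k e # block d (n + 2) \<leadsto> block d n @ [Cup (Suc k) e]"
proof -
  have "Cup k e # block d (n + 2) = [shift (strands_in (Cup 0 d)) (Cup k e), Cup 0 d] @ overpass 1 (n + 2)"
    by (simp add: block_def del: overpass.simps)
  also have "\<dots> \<leadsto> [Cup 0 d, shift (strands_out (Cup 0 d)) (Cup k e)] @ overpass 1 (n + 2)"
    by (intro reduces_suffix red_exchange) simp
  also have "\<dots> = [Cup 0 d] @ (Cup (Suc (1 + k)) e # overpass 1 (n + 2))"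
    by (simp del: overpass.simps)
  also have "\<dots> \<leadsto> [Cup 0 d] @ (overpass 1 n @ [Cup (1 + k) e])"
    using assms by (intro reduces_prefix cup_overpass)
  finally show ?thesis by (simp add: block_def)
qed

lemma block_cap_under:
  assumes "k \<le> n" shows "block d (n + 2) @ [Cap (Suc k)] \<leadsto> Cap k # block d n"
proof -
  have "block d (n + 2) @ [Cap (Suc k)] = [Cup 0 d] @ (overpass 1 (n + 2) @ [Cap (1 + k)])"
    by (simp add: block_def del: overpass.simps)
  also have "\<dots> \<leadsto> [Cup 0 d] @ (Cap (Suc (1 + k)) # overpass 1 n)"
    using assms by (intro reduces_prefix overpass_cap)
  also have "\<dots> = [Cup 0 d, shift (strands_out (Cup 0 d)) (Cap k)] @ overpass 1 n"
    by simp
  also have "\<dots> \<leadsto> [shift (strands_in (Cup 0 d)) (Cap k), Cup 0 d] @ overpass 1 n"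
    by (intro reduces_suffix red_exchange) simp
  finally show ?thesis by (simp add: block_def)
qed

lemma block_cross_under:
  assumes "k + 2 \<le> n" shows "block d n @ [Cross (Suc k) b] \<leadsto> Cross k b # block d n"
proof -
  have "block d n @ [Cross (Suc k) b] = [Cup 0 d] @ (overpass 1 n @ [Cross (1 + k) b])"
    by (simp add: block_def)
  also have "\<dots> \<leadsto> [Cup 0 d] @ (Cross (Suc (1 + k)) b # overpass 1 n)"
    using assms by (intro reduces_prefix overpass_cross)
  also have "\<dots> = [Cup 0 d, shift (strands_out (Cup 0 d)) (Cross k b)] @ overpass 1 n"
    by simp
  also have "\<dots> \<leadsto> [shift (strands_in (Cup 0 d)) (Cross k b), Cup 0 d] @ overpass 1 n"
    by (intro reduces_suffix red_exchange) simp
  finally show ?thesis by (simp add: block_def)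
qed

lemma block_exchange:
  assumes "n \<le> pos e"
  shows "block d n @ [shift 2 e] \<leadsto> e # block d n" "e # block d n \<leadsto> block d n @ [shift 2 e]"
proof -
  have "block d n @ [shift 2 e] = [Cup 0 d] @ (overpass 1 n @ [shift 2 e])"
    by (simp add: block_def)
  also have "\<dots> \<leadsto> [Cup 0 d] @ (shift 2 e # overpass 1 n)"
    using assms by (intro reduces_prefix overpass_exchange_right) simp
  also have "\<dots> = [Cup 0 d, shift (strands_out (Cup 0 d)) e] @ overpass 1 n"
    by simp
  also have "\<dots> \<leadsto> [shift (strands_in (Cup 0 d)) e, Cup 0 d] @ overpass 1 n"
    by (intro reduces_suffix red_exchange) simp
  finally show "block d n @ [shift 2 e] \<leadsto> e # block d n" by (simp add: block_def)
  have "e # block d n = [shift (strands_in (Cup 0 d)) e, Cup 0 d] @ overpass 1 n"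
    by (simp add: block_def)
  also have "\<dots> \<leadsto> [Cup 0 d, shift (strands_out (Cup 0 d)) e] @ overpass 1 n"
    by (intro reduces_suffix red_exchange) simp
  also have "\<dots> = [Cup 0 d] @ (shift 2 e # overpass 1 n)"
    by simp
  also have "\<dots> \<leadsto> [Cup 0 d] @ (overpass 1 n @ [shift 2 e])"
    using assms by (intro reduces_prefix overpass_exchange_right) simp
  finally show "e # block d n \<leadsto> block d n @ [shift 2 e]" by (simp add: block_def)
qed

primrec leftpass :: "nat \<Rightarrow> event list" where
  "leftpass 0 = []"
| "leftpass (Suc n) = Cross n False # leftpass n"

text \<open>Joining the right end of the arc to the next strand straightens the arc: what remains is
  that strand travelling to the left margin, over the \<open>n\<close> others. The crossings of
  \<open>leftpass\<close> are \<open>False\<close> because now the strand rising to the left is the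
  upper one.\<close>

lemma block_cap_end: "block d n @ [Cap (Suc n)] \<leadsto> leftpass n"
proof (induction n)
  case 0
  show ?case by (simp add: block_def red_zigzag_left)
next
  case (Suc n)
  have "block d (Suc n) @ [Cap (Suc (Suc n))] = (Cup 0 d # overpass 1 n) @ [Cross (Suc n) True, Cap (Suc (Suc n))]"
    by (simp add: block_def overpass_snoc del: overpass.simps)
  also have "\<dots> \<leadsto> (Cup 0 d # overpass 1 n) @ [Cross (Suc (Suc n)) (\<not> True), Cap (Suc n)]"
    by (intro reduces_prefix red_through_cap)
  also have "\<dots> = [Cup 0 d] @ (overpass 1 n @ [Cross (Suc (Suc n)) False]) @ [Cap (Suc n)]"
    by simp
  also have "\<dots> \<leadsto> [Cup 0 d] @ (Cross (Suc (Suc n)) False # overpass 1 n) @ [Cap (Suc n)]"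
    by (intro reduces_context overpass_exchange_right) simp
  also have "\<dots> = [Cup 0 d, shift (strands_out (Cup 0 d)) (Cross n False)] @ overpass 1 n @ [Cap (Suc n)]"
    by simp
  also have "\<dots> \<leadsto> [shift (strands_in (Cup 0 d)) (Cross n False), Cup 0 d] @ overpass 1 n @ [Cap (Suc n)]"
    by (intro reduces_suffix red_exchange) simp
  also have "\<dots> = Cross n False # (block d n @ [Cap (Suc n)])"
    by (simp add: block_def)
  also have "\<dots> \<leadsto> Cross n False # leftpass n"
    by (intro reduces_Cons Suc.IH)
  finally show ?case by simp
qed

text \<open>The arc that is created last lies on top and can therefore be drawn first.\<close>

lemma block_block_cross:
  assumes "p \<le> n"
  shows "block d' p @ block d (n + 2) @ [Cross 0 False] \<leadsto> block d n @ block d' (Suc p)"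
proof -
  have "block d' p @ block d (n + 2) @ [Cross 0 False] =
      [Cup 0 d'] @ (overpass (1 + strands_in (Cup 0 d)) p @ [Cup 0 d]) @ overpass 1 (n + 2) @ [Cross 0 False]"
    by (simp add: block_def del: overpass.simps)
  also have "\<dots> \<leadsto> [Cup 0 d'] @ (Cup 0 d # overpass (1 + strands_out (Cup 0 d)) p) @ overpass 1 (n + 2) @ [Cross 0 False]"
    by (intro reduces_context overpass_exchange_left) simp
  also have "\<dots> = [shift (strands_in (Cup 0 d)) (Cup 0 d'), Cup 0 d] @ overpass 3 p @ overpass 1 (n + 2) @ [Cross 0 False]"
    by (simp del: overpass.simps add: numeral_3_eq_3)
  also have "\<dots> \<leadsto> [Cup 0 d, shift (strands_out (Cup 0 d)) (Cup 0 d')] @ overpass 3 p @ overpass 1 (n + 2) @ [Cross 0 False]"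
    by (intro reduces_suffix red_exchange) simp
  also have "\<dots> = [Cup 0 d, Cup 2 d'] @ (overpass (Suc (1 + 1)) p @ overpass 1 (n + 2)) @ [Cross 0 False]"
    by (simp del: overpass.simps add: numeral_2_eq_2 numeral_3_eq_3)
  also have "\<dots> \<leadsto> [Cup 0 d, Cup 2 d'] @ (overpass 1 (n + 2) @ overpass (1 + 1) p) @ [Cross 0 False]"
    using assms by (intro reduces_context overpass_overpass) simp
  also have "\<dots> = [Cup 0 d] @ (Cup (Suc (1 + 0)) d' # overpass 1 (n + 2)) @ overpass 2 p @ [Cross 0 False]"
    by (simp del: overpass.simps add: eval_nat_numeral)
  also have "\<dots> \<leadsto> [Cup 0 d] @ (overpass 1 n @ [Cup (1 + 0) d']) @ overpass 2 p @ [Cross 0 False]"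
    by (intro reduces_context cup_overpass) simp
  also have "\<dots> = (block d n @ [Cup 1 d']) @ (overpass (0 + strands_in (Cross 0 False)) p @ [Cross 0 False])"
    by (simp add: block_def numeral_2_eq_2)
  also have "\<dots> \<leadsto> (block d n @ [Cup 1 d']) @ (Cross 0 False # overpass (0 + strands_out (Cross 0 False)) p)"
    by (intro reduces_prefix overpass_exchange_left) simp
  also have "\<dots> = block d n @ [Cup (Suc 0) d', Cross 0 False] @ overpass 2 p"
    by (simp add: numeral_2_eq_2)
  also have "\<dots> \<leadsto> block d n @ [Cup 0 d', Cross (Suc 0) (\<not> False)] @ overpass 2 p"
    by (intro reduces_context red_through_cup)
  also have "\<dots> = block d n @ block d' (Suc p)"
    by (simp add: block_def numeral_2_eq_2)
  finally show ?thesis .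
qed

text \<open>A minimum at the left margin is a block with \<open>n = 0\<close>; any other one is
  pulled below the last arc, and the induction continues underneath. The reduction points from the
  new basis word to the given one because \<open>block_cup_under\<close> removes crossings.\<close>

lemma basis_cup:
  assumes "basis u" "run u [] = Some s" "i \<le> length s"
  shows "\<exists>v. basis v \<and> run v [] \<noteq> None \<and> v \<leadsto> u @ [Cup i e]"
  using assms
proof (induction arbitrary: i s rule: basis.induct)
  case Nil
  then show ?case using basis.snoc[OF basis.Nil, of e 0] by (intro exI[of _ "[Cup 0 e]"]) (simp add: block_def)
next
  case (snoc u d n)
  from snoc.prems(1) obtain s' where s': "run u [] = Some s'" "run (block d n) s' = Some s"
    by (rule run_append_SomeE)
  note len = run_block_SomeD[OF s'(2)]
  have run: "\<exists>t. run (v @ block d m) [] = Some t" if "v \<leadsto> u @ [Cup k e]" "k \<le> length s'" "m \<le> length s' + 2" "run v [] \<noteq> None" for v m k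
  proof -
    from that(4) obtain r where r: "run v [] = Some r" by blast
    then have "run (u @ [Cup k e]) [] = Some r" using reducesD that(1) by blast
    with s' that have "length r = length s' + 2" by auto
    then show ?thesis using r that(3) by (metis run_append_Some run_block_ge)
  qed
  show ?case
  proof (cases "i = 0")
    case True
    have "run (u @ block d n @ [Cup 0 e]) [] \<noteq> None" using s' by simp
    moreover have "basis (u @ block d n @ [Cup 0 e])"
      using basis.snoc[OF basis.snoc[OF snoc.hyps(1)], of d n e 0] by (simp add: block_def)
    ultimately show ?thesis using True by (intro exI[of _ "u @ block d n @ [Cup 0 e]"]) simp
  next
    case False
    \<comment> \<open>Up to position \<open>n + 1\<close> the minimum lies inside the arc, which
      then passes over two more strands; beyond that only positions change.\<close>
    define k m where "k = (if i \<le> Suc n then i - 1 else i - 2)" "m = (if i \<le> Suc n then n + 2 else n)"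
    have red: "Cup k e # block d m \<leadsto> block d n @ [Cup i e]"
    proof (cases "i \<le> Suc n")
      case True
      then show ?thesis using block_cup_under[of "i - 1" n e d] False by (simp add: k_m_def)
    next
      case 2: False
      have "shift 2 (Cup (i - 2) e) = Cup i e" "n \<le> pos (Cup (i - 2) e)" using 2 by simp_all
      then show ?thesis using block_exchange(2)[of n "Cup (i - 2) e" d] 2 by (simp add: k_m_def)
    qed
    have k: "k \<le> length s'" "m \<le> length s' + 2"
      using len snoc.prems(2) by (auto simp: k_m_def)
    from snoc.IH[OF s'(1) k(1)] obtain v where v: "basis v" "run v [] \<noteq> None" "v \<leadsto> u @ [Cup k e]" by blast
    have "v @ block d m \<leadsto> (u @ [Cup k e]) @ block d m"
      using v(3) by (intro reduces_suffix)
    also have "\<dots> = u @ (Cup k e # block d m)" by simp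
    also have "\<dots> \<leadsto> u @ (block d n @ [Cup i e])"
      using red by (rule reduces_prefix)
    finally have "v @ block d m \<leadsto> (u @ block d n) @ [Cup i e]" by simp
    then show ?thesis using run[OF v(3) k v(2)] basis.snoc[OF v(1), of d m] by blast
  qed
qed

lemma spanned_cup:
  assumes "spanned s u" "run [Cup i e] s = Some t"
  shows "spanned t (u @ [Cup i e])"
proof (rule spanned_append[OF assms])
  fix g assume g: "basis g" "run g [] = Some s"
  from assms have "i \<le> length s" by (auto split: if_splits)
  with basis_cup[OF g] obtain v r where v: "basis v" "run v [] = Some r" "v \<leadsto> g @ [Cup i e]" by blast
  from v(2,3) have "run (g @ [Cup i e]) [] = Some r" by (rule reducesD(1)[rotated])
  with g assms have "r = t" by simp
  with v show "spanned t (g @ [Cup i e])"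
    using spanned_reduces spanned.basis by blast
qed

text \<open>Crossings keep the number of strands, so a hypothesis for levels as long as
  \<open>s\<close> serves at every step.\<close>

lemma spanned_events:
  assumes "spanned s u" "run q s = Some t" "\<forall>e \<in> set q. \<exists>i b. e = Cross i b"
    and "\<And>v i b s' t'. spanned s' v \<Longrightarrow> length s' = length s \<Longrightarrow> run [Cross i b] s' = Some t' \<Longrightarrow> spanned t' (v @ [Cross i b])"
  shows "spanned t (u @ q)"
  using assms
proof (induction q arbitrary: u s)
  case (Cons e q)
  then obtain i b where e: "e = Cross i b" by auto
  from Cons.prems(2) obtain r where r: "apply_event e s = Some r" "run q r = Some t"
    by (rule run_ConsE)
  have l: "length r = length s" using r(1) e by (auto split: if_splits)
  have "spanned r (u @ [e])" using Cons.prems(1,4) r e by simp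
  from Cons.IH[OF this r(2)] Cons.prems(3,4) l show ?case by simp
qed simp

lemma leftpass_crossings: "\<forall>e \<in> set (leftpass n). \<exists>i b. e = Cross i b"
  by (induction n) auto

lemma overpass_crossings: "\<forall>e \<in> set (overpass p n). \<exists>i b. e = Cross i b"
  by (auto simp: set_overpass)

section \<open>One event on top of a basis word, by induction on the number of strands\<close>

context
  fixes m :: nat
  assumes shorter: "\<And>u s e t. spanned s u \<Longrightarrow> length s < m \<Longrightarrow> run [e] s = Some t \<Longrightarrow> spanned t (u @ [e])"
begin

text \<open>This is how the induction hypothesis enters: an event that slides below the last block
  acts on a level with two strands fewer.\<close>

lemma spanned_reduces_block:
  assumes "block d n @ [e] \<leadsto> e' # block d' n'" "basis u" "run (u @ block d n @ [e]) [] = Some t"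
    and "length (the (run u [])) < m"
  shows "spanned t (u @ block d n @ [e])"
proof -
  from assms(3) obtain s where s: "run u [] = Some s" by (rule run_append_SomeE)
  have red: "u @ block d n @ [e] \<leadsto> u @ e' # block d' n'"
    using assms(1) by (rule reduces_prefix)
  from reducesD(1)[OF red assms(3)] s obtain r where r: "apply_event e' s = Some r" "run (block d' n') r = Some t"
    by (auto split: option.splits)
  have "spanned r (u @ [e'])"
    using shorter[OF spanned.basis[OF assms(2) s]] assms(4) s r by simp
  from spanned_block[OF this r(2)] show ?thesis
    using spanned_reduces[OF red assms(3)] by simp
qed

text \<open>The last arc has its ends at positions \<open>0\<close> and \<open>n + 1\<close>. A
  maximum touching neither end slides below the arc; one joining the right end to the strand beyond
  it, at \<open>i = n + 1\<close>, straightens the arc into crossings on a narrower level.\<close>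

lemma spanned_basis_cap_far:
  assumes u: "basis u" "run u [] = Some s'" "run (block d n) s' = Some s" "length s = m"
    and t: "run [Cap i] s = Some t" and i: "i \<noteq> 0" "i \<noteq> n"
  shows "spanned t (u @ block d n @ [Cap i])"
proof -
  note len = run_block_SomeD[OF u(3)]
  have run: "run (u @ block d n @ [Cap i]) [] = Some t"
    using u t by simp
  consider "i = Suc n" | "i \<ge> n + 2" | "Suc i \<le> n"
    using i by linarith
  then show ?thesis
  proof cases
    case 1
    have red: "u @ block d n @ [Cap i] \<leadsto> u @ leftpass n"
      using 1 block_cap_end by (intro reduces_prefix) simp
    from reducesD(1)[OF this run] u have "run (leftpass n) s' = Some t" by simp
    then have "spanned t (u @ leftpass n)"
      by (rule spanned_events[OF spanned.basis[OF u(1,2)] _ leftpass_crossings])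
        (use shorter u len in auto)
    then show ?thesis using spanned_reduces[OF red run] by simp
  next
    case 2
    have "block d n @ [shift 2 (Cap (i - 2))] \<leadsto> Cap (i - 2) # block d n"
      using 2 by (intro block_exchange) simp
    moreover have "shift 2 (Cap (i - 2)) = Cap i" using 2 by simp
    ultimately have "block d n @ [Cap i] \<leadsto> Cap (i - 2) # block d n" by metis
    then show ?thesis
      using spanned_reduces_block[OF _ u(1) run] u len by simp
  next
    case 3
    have "block d (n - 2 + 2) @ [Cap (Suc (i - 1))] \<leadsto> Cap (i - 1) # block d (n - 2)"
      using 3 by (intro block_cap_under) simp
    moreover have "n - 2 + 2 = n" "Suc (i - 1) = i" using 3 i by auto
    ultimately have "block d n @ [Cap i] \<leadsto> Cap (i - 1) # block d (n - 2)" by metis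
    then show ?thesis
      using spanned_reduces_block[OF _ u(1) run] u len by simp
  qed
qed

text \<open>In the remaining positions the maximum closes the arc to a circle
  (\<open>n = 0\<close>), or joins its left end to the first strand passed over, or its right end to
  the last one. The latter two produce curls.\<close>

lemma spanned_basis_cap:
  assumes u: "basis u" "run u [] = Some s'" "run (block d n) s' = Some s" "length s = m"
    and t: "run [Cap i] s = Some t"
  shows "spanned t (u @ block d n @ [Cap i])"
proof -
  note len = run_block_SomeD[OF u(3)]
  have run: "run (u @ block d n @ [Cap i]) [] = Some t"
    using u t by simp
  consider "i \<noteq> 0" "i \<noteq> n" | "i = 0" "n = 0" | "0 < n" "i = 0" | k where "n = Suc k" "i = n"
    by (metis not0_implies_Suc not_gr_zero)
  then show ?thesis
  proof cases
    case 1
    then show ?thesis using spanned_basis_cap_far[OF u t] by blast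
  next
    case 2
    from basis_length[OF u(1,2)] have "s' \<noteq> [] \<or> u = []" by auto
    moreover have "t = s'" using t u(3) 2 by (auto simp: block_def)
    ultimately show ?thesis
      using spanned.circle[of s' u "[]" s' d] spanned.basis[OF u(1,2)] u(2) 2 by (simp add: block_def)
  next
    case 3
    then obtain k where k: "n = Suc k" by (cases n) auto
    let ?c = "[Cup 0 d, Cross (Suc 0) True, Cap 0]"
    have "block d n @ [Cap i] = [Cup 0 d, Cross 1 True] @ (overpass (0 + strands_in (Cap 0)) k @ [Cap 0])"
      using k 3 by (simp add: block_def numeral_2_eq_2)
    also have "\<dots> \<leadsto> [Cup 0 d, Cross 1 True] @ (Cap 0 # overpass (0 + strands_out (Cap 0)) k)"
      by (intro reduces_prefix overpass_exchange_left) simp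
    also have "\<dots> = ?c @ overpass 0 k" by simp
    finally have red: "u @ block d n @ [Cap i] \<leadsto> u @ ?c @ overpass 0 k"
      by (rule reduces_prefix)
    have run': "run (u @ ?c @ overpass 0 k) [] = Some t" using red run by (rule reducesD)
    then obtain r where r: "run ?c s' = Some r" "run (overpass 0 k) r = Some t"
      using u(2) by (auto simp: run_append bind_eq_Some_conv simp del: run.simps append.simps)
    have "r = s'"
    proof -
      from k len obtain x c where "s' = x # c" by (cases s') auto
      with r(1) show ?thesis by (cases x; cases d) (auto split: if_splits)
    qed
    with r have "run (overpass 0 k) s' = Some t" by simp
    then have "spanned t (u @ overpass 0 k)"
      by (rule spanned_events[OF spanned.basis[OF u(1,2)] _ overpass_crossings])
        (use shorter u len in auto)
    then have "spanned t (u @ ?c @ overpass 0 k)"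
      using run' by (rule spanned.curl[OF _ curl.loop_left])
    then show ?thesis using spanned_reduces[OF red run] by simp
  next
    case 4
    let ?v = "u @ block d k"
    have n: "block d n = block d k @ [Cross i True]"
      using 4 by (simp add: block_def overpass_snoc del: overpass.simps)
    from u(3) n obtain r where r: "run (block d k) s' = Some r" "run [Cross i True] r = Some s"
      by (metis run_append_SomeE)
    from r(2) have i: "Suc i < length r" "length r = length s" by (auto split: if_splits)
    then obtain a x y c where rs: "r = a @ x # y # c" "length a = i" by (elim split2)
    with r(2) have "s = a @ y # x # c" by (simp del: apply_event.simps)
    with t rs have txy: "x \<noteq> y" "t = a @ c" by (auto simp del: apply_event.simps split: if_splits)
    have cap: "run [Cap i] r = Some t" using rs txy by (simp del: apply_event.simps)
    have "spanned t (u @ block d k @ [Cap i])"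
      using spanned_basis_cap_far[OF u(1,2) r(1) _ cap] 4 i u(4) by simp
    then have "spanned t (?v @ [Cap i])" by simp
    moreover define e where "e = opposite x"
    let ?c = "[Cup i e, Cross (Suc i) (\<not> True), Cap i]"
    have "curl (\<not> True) ?c" by (rule curl.loop_left)
    moreover have "run (?v @ ?c @ [Cap i]) [] = Some t"
    proof -
      have "apply_event (Cross (Suc i) (\<not> True)) ((a @ [e]) @ opposite e # x # y # c) = Some ((a @ [e]) @ x # opposite e # y # c)"
        using rs by (intro apply_Cross_append) simp
      then have "run ?c r = Some r"
        using rs by (simp del: apply_event.simps add: e_def)
      moreover have "run ?v [] = Some r" using u(2) r(1) by simp
      ultimately show ?thesis using cap by (simp only: run_append_Some)
    qed
    ultimately have sp: "spanned t (?v @ ?c @ [Cap i])" by (rule spanned.curl)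
    have red: "?v @ ?c @ [Cap i] \<leadsto> u @ block d n @ [Cap i]"
      using reduces_prefix[OF curl_before_cap[of i e True], of ?v] n by simp
    with sp show ?thesis using spanned_reduces spanned_run by blast
  qed
qed

text \<open>With opposite directions the smoothing is a maximum followed by a minimum, and both
  kinds of events have been dealt with; with equal directions nothing is attached.\<close>

lemma spanned_basis_smoothing:
  assumes u: "basis u" "run u [] = Some s" "length s = m" "Suc i < length s"
  shows "\<exists>t. spanned t (u @ smoothing i (s ! i) (s ! Suc i)) \<and> t = (take i s @ [s ! Suc i, s ! i] @ drop (i + 2) s)"
proof (cases "s ! i = s ! Suc i")
  case True
  have "s = take i s @ [s ! Suc i, s ! i] @ drop (i + 2) s"
    using u(4) True by (metis Cons_nth_drop_Suc Suc_lessD add_2_eq_Suc' append_Cons append_Nil append_take_drop_id)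
  then show ?thesis using True spanned.basis[OF u(1,2)] by (simp add: smoothing_def)
next
  case False
  from u(4) obtain a x y c where s: "s = a @ x # y # c" "length a = i" by (elim split2)
  from u(1) obtain u' d n where u': "u = u' @ block d n" "basis u'"
    by cases (use u(2,4) in auto)
  from u(2) u'(1) obtain s' where s': "run u' [] = Some s'" "run (block d n) s' = Some s"
    by (metis run_append_SomeE)
  from s False have y: "y = opposite x" by (simp add: nth_append opposite_eq_iff)
  have "run [Cap i] s = Some (a @ c)" using s y by (simp del: apply_event.simps)
  from spanned_basis_cap[OF u'(2) s' u(3) this] u'(1) have "spanned (a @ c) (u @ [Cap i])" by simp
  moreover have "run [Cup i y] (a @ c) = Some (a @ y # opposite y # c)" using s by (simp del: apply_event.simps)
  ultimately have "spanned (a @ y # opposite y # c) ((u @ [Cap i]) @ [Cup i y])"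
    by (rule spanned_cup)
  then show ?thesis using s y by (simp add: smoothing_def nth_append)
qed

text \<open>Since the smoothing is spanned, the skein rule passes from either crossing to the other.
  Hence it suffices to treat, at every position, the sign for which the picture simplifies.\<close>

lemma spanned_basis_flip:
  assumes u: "basis u" "run u [] = Some s" "length s = m" 
    and "spanned t (u @ [Cross i b])"
  shows "spanned t (u @ [Cross i b'])"
proof (cases "b' = b")
  case False
  have "run [Cross i b] s = Some t" using spanned_run[OF assms(4)] u(2) by simp
  then have i: "Suc i < length s" "t = take i s @ [s ! Suc i, s ! i] @ drop (i + 2) s"
    by (auto split: if_splits)
  from spanned_basis_smoothing[OF u i(1)] i(2) have "spanned t (u @ smoothing i (s ! i) (s ! Suc i) @ [])" by simp
  moreover have "spanned t (u @ [Cross i b] @ [])" using assms(4) by simp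
  ultimately have "spanned t (u @ [Cross i (\<not> b)] @ [])"
    using u(2) by (intro spanned.skein)
  moreover have "b' = (\<not> b)" using False by blast
  ultimately show ?thesis by simp
qed (use assms in simp)

lemma spanned_basis_cross:
  assumes u: "basis u" "run u [] = Some s" "length s = m"
    and t: "run [Cross i b] s = Some t"
  shows "spanned t (u @ [Cross i b])"
proof -
  have *: "\<exists>b. spanned t (u @ [Cross i b])"
  proof -
    have tb: "run [Cross i b] s = Some t" for b using t by (auto split: if_splits)
    from t have i: "Suc i < length s" by (auto split: if_splits)
    from u(1) obtain u' d n where u': "u = u' @ block d n" "basis u'"
      by cases (use u(2) i in auto)
    from u(2) u'(1) obtain s' where s': "run u' [] = Some s'" "run (block d n) s' = Some s"
      by (metis run_append_SomeE)
    note len = run_block_SomeD[OF s'(2)]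
    have run: "run (u' @ block d n @ [Cross i b]) [] = Some t" for b
      using s' tb[of b] by simp
    have step: "\<exists>b. spanned t (u @ [Cross i b])" if "block d n @ [Cross i b] \<leadsto> e' # block d' n'" for b e' d' n'
    proof -
      have "length (the (run u' [])) < m" using s' len u(3) by simp
      from spanned_reduces_block[OF that u'(2) run this] show ?thesis using u'(1) by auto
    qed
    \<comment> \<open>Positions relative to the ends \<open>0\<close> and \<open>n + 1\<close> of
      the last arc: beyond it, at its right end, at its left end, or inside.\<close>
    have "i \<ge> n + 2 \<or> i = Suc n \<or> i = n \<and> n = 0 \<or> i = n \<and> n = Suc (n - 1) \<or> i = 0 \<and> 0 < n \<or> i = Suc (i - 1) \<and> i < n"
      by arith
    then consider "i \<ge> n + 2" | "i = Suc n" | "i = n" "n = 0" | k where "i = n" "n = Suc k" | "i = 0" "0 < n" | k where "i = Suc k" "i < n"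
      by blast
    then show ?thesis
    proof cases
      case 1
      then have "block d n @ [shift 2 (Cross (i - 2) True)] \<leadsto> Cross (i - 2) True # block d n"
        by (intro block_exchange) simp
      moreover have "shift 2 (Cross (i - 2) True) = Cross i True" using 1 by simp
      ultimately have "block d n @ [Cross i True] \<leadsto> Cross (i - 2) True # block d n" by metis
      then show ?thesis by (rule step)
    next
      case 2
      have "u @ [Cross i True] = u' @ block d (Suc n)"
        using u' 2 by (simp add: block_def overpass_snoc del: overpass.simps)
      moreover have "run (u @ [Cross i True]) [] = Some t"
        using u(2) tb by (rule trans[OF run_append_Some])
      ultimately have "spanned t (u @ [Cross i True])"
        using basis.snoc[OF u'(2), of d "Suc n"] by (intro spanned.basis) simp_all
      then show ?thesis by blast
    next
      case 3
      define e where "e = opposite d"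
      let ?v = "u' @ [Cup 0 e]" and ?c = "[Cup 0 d, Cross (Suc 0) (\<not> True), Cap 0]"
      have cs: "s = d # opposite d # s'" "t = e # opposite e # s'" 
        using s'(2) tb[of True] 3 by (auto simp: block_def e_def)
      have "spanned t (?v @ [])"
        using spanned_cup[OF spanned.basis[OF u'(2) s'(1)], of 0 e t] cs by simp
      moreover have "curl (\<not> True) ?c" by (rule curl.loop_left)
      moreover have "run (?v @ ?c @ []) [] = Some t"
        using s'(1) cs by (simp add: e_def)
      ultimately have sp: "spanned t (?v @ ?c @ [])" by (rule spanned.curl)
      have "?v @ ?c @ [] \<leadsto> u @ [Cross 0 True]"
        using reduces_prefix[OF cup_curl[of 0 e d True], of u'] u' 3 by (simp add: block_def)
      from spanned_reduces[OF this spanned_run[OF sp]] sp show ?thesis using 3 by blast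
    next
      case 4
      have "block d n @ [Cross i False] = block d k @ [Cross i True, Cross i False]"
        using 4 by (simp add: block_def overpass_snoc del: overpass.simps)
      also have "\<dots> \<leadsto> block d k @ []"
        by (intro reduces_prefix red_reidemeister_2) simp
      finally have red: "u' @ block d n @ [Cross i False] \<leadsto> u' @ block d k"
        using reduces_prefix[of "block d n @ [Cross i False]" "block d k" u'] by simp
      then have "run (u' @ block d k) [] = Some t" using run by (rule reducesD)
      then have "spanned t (u' @ block d k)"
        using u'(2) by (intro spanned.basis basis.snoc)
      then show ?thesis using spanned_reduces[OF red run] u' by auto
    next
      case 5
      \<comment> \<open>The left ends of the last two arcs cross. One sign or the other lets the
        arcs change places, depending on how far they reach.\<close>
      from len 5 have "s' \<noteq> []" by auto
      from u'(2) obtain u'' d' p where u'': "u' = u'' @ block d' p" "basis u''"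
        by cases (use s'(1) \<open>s' \<noteq> []\<close> in auto)
      from s'(1) u''(1) obtain s'' where s'': "run u'' [] = Some s''" "run (block d' p) s'' = Some s'"
        by (metis run_append_SomeE)
      note len' = run_block_SomeD[OF s''(2)]
      show ?thesis
      proof (cases "p + 2 \<le> n")
        case True
        then have "block d' p @ block d (n - 2 + 2) @ [Cross 0 False] \<leadsto> block d (n - 2) @ block d' (Suc p)"
          by (intro block_block_cross) simp
        moreover have "n - 2 + 2 = n" using True by simp
        ultimately have "u'' @ block d' p @ block d n @ [Cross 0 False] \<leadsto> u'' @ block d (n - 2) @ block d' (Suc p)"
          by (metis reduces_prefix)
        then have red: "u' @ block d n @ [Cross i False] \<leadsto> (u'' @ block d (n - 2)) @ block d' (Suc p)"
          using u'' 5 by simp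
        then have "run ((u'' @ block d (n - 2)) @ block d' (Suc p)) [] = Some t" using run by (rule reducesD)
        then have "spanned t ((u'' @ block d (n - 2)) @ block d' (Suc p))"
          using u''(2) by (intro spanned.basis basis.snoc)
        then show ?thesis using spanned_reduces[OF red run] u' by auto
      next
        case False
        \<comment> \<open>\<open>?w\<close> has the arcs in the other order. Adding a cancelling
          pair of crossings at the left margin and letting \<open>block_block_cross\<close> consume
          the first of them turns it into \<open>u\<close> with a single crossing.\<close>
        let ?w = "u'' @ block d (n - 1) @ block d' (p + 2)"
        from False 5 len' have n: "n - 1 \<le> length s''" "n - 1 \<le> p" "Suc (n - 1) = n" by auto
        from run_block_ge[OF n(1), of d] obtain r1 where r1: "run (block d (n - 1)) s'' = Some r1" "length r1 = length s'' + 2" by blast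
        with len' have "p + 2 \<le> length r1" by simp
        from run_block_ge[OF this, of d'] obtain r2 where r2: "run (block d' (p + 2)) r1 = Some r2" "length r2 = length r1 + 2" by blast
        have w: "run ?w [] = Some r2" using s'' r1 r2 by simp
        have "run [Cross 0 False, Cross 0 True] r2 = Some r2"
          using r2(2) by (simp add: run_Cross_Cross del: run.simps)
        with w have W: "run (?w @ [Cross 0 False, Cross 0 True]) [] = Some r2" by (simp only: run_append_Some)
        have red1: "?w @ [Cross 0 False, Cross 0 True] \<leadsto> ?w @ []"
          by (intro reduces_prefix red_reidemeister_2) simp
        have "u'' @ (block d (n - 1) @ block d' (p + 2) @ [Cross 0 False]) @ [Cross 0 True] \<leadsto>
            u'' @ (block d' p @ block d (Suc (n - 1))) @ [Cross 0 True]"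
          using n by (intro reduces_context block_block_cross)
        then have red2: "?w @ [Cross 0 False, Cross 0 True] \<leadsto> u @ [Cross i True]"
          using n u' u'' 5 by simp
        have "spanned r2 (?w @ [])"
          using basis.snoc[OF basis.snoc[OF u''(2)], of d "n - 1" d' "p + 2"] w by (simp add: spanned.basis)
        then have sp: "spanned r2 (u @ [Cross i True])"
          using spanned_reduces[OF red1 W] spanned_reduces[OF red2 W] by simp
        then have "r2 = t" using spanned_run[OF sp] u(2) tb[of True] by simp
        with sp show ?thesis by blast
      qed
    next
      case 6
      then have "block d n @ [Cross i True] \<leadsto> Cross k True # block d n"
        using block_cross_under[of k n d True] by simp
      then show ?thesis by (rule step)
    qed
  qed
  then obtain b' where "spanned t (u @ [Cross i b'])" ..
  then show ?thesis by (rule spanned_basis_flip[OF u])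
qed

end

lemma spanned_event:
  assumes "spanned s u" "run [e] s = Some t" shows "spanned t (u @ [e])"
  using assms
proof (induction "length s" arbitrary: s u e t rule: less_induct)
  case less
  have shorter: "spanned t (u @ [e])" if "spanned s' u" "length s' < length s" "run [e] s' = Some t" for u s' e t
    using less.hyps that by blast
  show ?case
  proof (rule spanned_append[OF less.prems])
    fix g assume g: "basis g" "run g [] = Some s"
    show "spanned t (g @ [e])"
    proof (cases e)
      case (Cup i d)
      then show ?thesis using spanned_cup[OF spanned.basis[OF g]] less.prems by blast
    next
      case (Cap i)
      from g(1) obtain u' d n where u': "g = u' @ block d n" "basis u'"
        by cases (use g less.prems Cap in auto)
      from g(2) u'(1) obtain s' where "run u' [] = Some s'" "run (block d n) s' = Some s"
        by (metis run_append_SomeE)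
      from spanned_basis_cap[OF shorter u'(2) this refl] less.prems(2) Cap u'(1) show ?thesis by simp
    next
      case (Cross i b)
      from spanned_basis_cross[OF shorter g refl] less.prems(2) Cross show ?thesis by simp
    qed
  qed
qed

theorem spanned_all: "run u [] = Some t \<Longrightarrow> spanned t u"
proof (induction u arbitrary: t rule: rev_induct)
  case Nil
  then show ?case by (simp add: spanned.basis basis.Nil)
next
  case (snoc e u)
  from snoc.prems obtain r where "run u [] = Some r" "run [e] r = Some t"
    by (rule run_append_SomeE)
  then show ?case using snoc.IH spanned_event by blast
qed

section \<open>Multiplicativity of the Homflypt polynomial\<close>

definition closed :: "event list \<Rightarrow> bool" where
  "closed u \<longleftrightarrow> u \<noteq> [] \<and> run u [] = Some []"

lemma events_Abs [simp]: "closed u \<Longrightarrow> events (Abs_link_diagram u) = u"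
  by (simp add: Abs_link_diagram_inverse closed_def)

lemma closed_events [simp]: "closed (events D)"
  using events[of D] by (simp add: closed_def)

lemma Abs_events [simp]: "Abs_link_diagram (events D) = D"
  by (rule events_inverse)

lemma closed_append: "closed u \<Longrightarrow> closed v \<Longrightarrow> closed (u @ v)"
  by (simp add: closed_def)

text \<open>A move produces the empty word only by deleting a zigzag or a pair of crossings, and
  neither of these runs from the empty level.\<close>

lemma word_step_Nil:
  assumes "word_step [] u v" shows "u \<noteq> [] \<and> v \<noteq> []"
proof -
  obtain xs ys a b where m: "word_move a b" "u = xs @ a @ ys" "v = xs @ b @ ys" "run u [] \<noteq> None"
    using assms unfolding word_step_def by blast
  have a: "a \<noteq> []" using m(1) unfolding word_move_def
    by (elim disjE planar_move.cases reidemeister_2.cases reidemeister_3.cases) simp_all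
  have "b \<noteq> []" if "xs = []" "ys = []"
  proof
    assume "b = []"
    with m(1) have "run a [] = None" unfolding word_move_def
      by (elim disjE planar_move.cases reidemeister_2.cases reidemeister_3.cases) simp_all
    with that m show False by simp
  qed
  with a m show ?thesis by auto
qed

abbreviation isotopy_move :: "link_diagram \<Rightarrow> link_diagram \<Rightarrow> bool" where
  "isotopy_move \<equiv> local_move (\<lambda>u v. planar_move u v \<or> reidemeister_2 u v \<or> reidemeister_3 u v)"

lemma isotopy_move_iff:
  "isotopy_move D D' \<longleftrightarrow> word_step [] (events D) (events D')"
  using closed_events[of D] closed_events[of D']
  unfolding local_move_def word_step_def word_move_def closed_def by (metis option.distinct(1))

lemma word_isotopic_closed:
  assumes "word_isotopic [] u v" "closed u"
  shows "closed v \<and> regular_isotopic (Abs_link_diagram u) (Abs_link_diagram v)"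
  using assms(1) unfolding word_isotopic_def
proof (induction rule: equivclp_induct)
  case base
  with assms show ?case by (simp add: regular_isotopic_def)
next
  case (step v w)
  then have v: "closed v" and iso: "regular_isotopic (Abs_link_diagram u) (Abs_link_diagram v)" by auto
  from step(2) have "run v [] = run w []" "w \<noteq> []"
    using word_step_run[of "[]" v w] word_step_run[of "[]" w v] word_step_Nil[of v w] word_step_Nil[of w v] by auto
  with v have w: "closed w" by (simp add: closed_def)
  have "isotopy_move (Abs_link_diagram v) (Abs_link_diagram w) \<or> isotopy_move (Abs_link_diagram w) (Abs_link_diagram v)"
    unfolding isotopy_move_iff using step(2) v w by simp
  with iso w show ?case unfolding regular_isotopic_def
    by (auto intro: equivclp_into_equivclp)
qed

lemma run_smoothing:
  assumes "Suc i < length s"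
  shows "run (smoothing i (s ! i) (s ! Suc i)) s = run [Cross i b] s"
proof -
  from assms obtain a x y c where s: "s = a @ x # y # c" "length a = i" by (rule split2)
  show ?thesis
    by (cases "x = y") (use s in \<open>auto simp: smoothing_def nth_append opposite_eq_iff simp del: apply_event.simps\<close>)
qed

lemma opposite_inject [simp]: "opposite x = opposite y \<longleftrightarrow> x = y"
  by (metis opposite_opposite)

lemma curl_run:
  assumes "curl b c" "run c s = Some t"
  shows "t = s \<and> s \<noteq> []"
  using assms
proof cases
  case (loop_right i d)
  with assms(2) have "i < length s" by (auto split: if_splits)
  then obtain a x r where s: "s = a @ x # r" "length a = i" by (rule split1)
  have "apply_event (Cup (Suc i) d) ((a @ [x]) @ r) = Some ((a @ [x]) @ d # opposite d # r)"
    "apply_event (Cap (Suc i)) ((a @ [d]) @ x # opposite d # r) = (if x \<noteq> opposite d then Some ((a @ [d]) @ r) else None)"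
    using s by (intro apply_Cup_append apply_Cap_append; simp)+
  with assms(2) loop_right s show ?thesis
    by (auto simp del: apply_event.simps simp: opposite_eq_iff split: if_splits)
next
  case (loop_left i d)
  with assms(2) have "i < length s" by (auto split: if_splits)
  then obtain a x r where s: "s = a @ x # r" "length a = i" by (rule split1)
  have "apply_event (Cross (Suc i) b) ((a @ [d]) @ opposite d # x # r) = Some ((a @ [d]) @ x # opposite d # r)"
    using s by (intro apply_Cross_append; simp)+
  with assms(2) loop_left s show ?thesis
    by (auto simp del: apply_event.simps simp: opposite_eq_iff split: if_splits)
qed

lemma curl_closed:
  assumes "curl b c" "closed (u @ c @ q)"
  shows "closed (u @ q)"
proof -
  from assms(2) obtain s t where s: "run u [] = Some s" "run c s = Some t" "run q t = Some []"
    by (auto simp: closed_def run_append bind_eq_Some_conv)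
  with curl_run[OF assms(1) s(2)] show ?thesis by (auto simp: closed_def)
qed

text \<open>No value is prescribed on the circle: thus multiples of \<open>R\<close> qualify, and so
  does \<open>R\<close> of a word with a fixed diagram added.\<close>

definition skein_invariant :: "(event list \<Rightarrow> laurent_wa) \<Rightarrow> bool" where
  "skein_invariant f \<longleftrightarrow>
     (\<forall>u v. closed u \<longrightarrow> word_isotopic [] u v \<longrightarrow> f u = f v) \<and>
     (\<forall>u s i q. run u [] = Some s \<longrightarrow> Suc i < length s \<longrightarrow> closed (u @ [Cross i True] @ q) \<longrightarrow>
       f (u @ [Cross i (s ! i = s ! Suc i)] @ q) - f (u @ [Cross i (s ! i \<noteq> s ! Suc i)] @ q) =
       w_var * f (u @ smoothing i (s ! i) (s ! Suc i) @ q)) \<and>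
     (\<forall>u b c q. curl b c \<longrightarrow> closed (u @ c @ q) \<longrightarrow>
       f (u @ c @ q) = a_pow (if b then 1 else - 1) * f (u @ q))"

lemma skein_invariant_isotopic:
  "skein_invariant f \<Longrightarrow> closed u \<Longrightarrow> word_isotopic [] u v \<Longrightarrow> f u = f v"
  unfolding skein_invariant_def by blast

lemma skein_invariant_skein:
  "skein_invariant f \<Longrightarrow> run u [] = Some s \<Longrightarrow> Suc i < length s \<Longrightarrow> closed (u @ [Cross i True] @ q) \<Longrightarrow>
   f (u @ [Cross i (s ! i = s ! Suc i)] @ q) - f (u @ [Cross i (s ! i \<noteq> s ! Suc i)] @ q) =
   w_var * f (u @ smoothing i (s ! i) (s ! Suc i) @ q)"
  unfolding skein_invariant_def by blast

lemma skein_invariant_curl: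
  "skein_invariant f \<Longrightarrow> curl b c \<Longrightarrow> closed (u @ c @ q) \<Longrightarrow>
   f (u @ c @ q) = a_pow (if b then 1 else - 1) * f (u @ q)"
  unfolding skein_invariant_def by blast

text \<open>The two curls on a strand differ from the bare strand by factors \<open>a\<close> and \<open>a\<^sup>-\<^sup>1\<close>, and smoothing
  the crossing of a curl splits off a circle.\<close>

lemma skein_invariant_circle_beside:
  assumes f: "skein_invariant f" and q: "closed (u @ q)" "run u [] = Some (x # c)"
  shows "w_var * f (u @ [Cup 0 d, Cap 0] @ q) = (a_pow 1 - a_pow (- 1)) * f (u @ q)"
proof (cases "d = x")
  \<comment> \<open>The near leg of a circle on the left has direction \<open>opposite d\<close>,
    parallel to the strand just if \<open>d \<noteq> x\<close>. Otherwise the circle is taken on the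
    right, where its near leg has direction \<open>d\<close>, and moved to the left
    afterwards.\<close>
  case False
  then have d: "d = opposite x" using opposite_eq_iff by blast
  have cl: "closed ((u @ [Cup 0 d]) @ [Cross (Suc 0) b] @ [Cap 0] @ q)" for b
    using q by (auto simp: closed_def run_append d)
  have "run (u @ [Cup 0 d]) [] = Some (d # x # x # c)" using q by (simp add: d)
  from skein_invariant_skein[OF f this, of "Suc 0" "[Cap 0] @ q"] cl[of True]
  have "f (u @ [Cup 0 d, Cross (Suc 0) True, Cap 0] @ q) - f (u @ [Cup 0 d, Cross (Suc 0) False, Cap 0] @ q) =
     w_var * f (u @ [Cup 0 d, Cap 0] @ q)"
    by (simp add: smoothing_def)
  moreover have "f (u @ [Cup 0 d, Cross (Suc 0) b, Cap 0] @ q) = a_pow (if b then 1 else - 1) * f (u @ q)" for b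
    using skein_invariant_curl[OF f curl.loop_left] cl[of b] by simp
  ultimately show ?thesis by (simp add: algebra_simps)
next
  case True
  have cl: "closed ((u @ [Cup (Suc 0) d]) @ [Cross 0 b] @ [Cap (Suc 0)] @ q)" for b
    using q by (auto simp: closed_def run_append True)
  have "run (u @ [Cup (Suc 0) d]) [] = Some (x # d # opposite d # c)" using q by simp
  from skein_invariant_skein[OF f this, of 0 "[Cap (Suc 0)] @ q"] cl[of True] True
  have "f (u @ [Cup (Suc 0) d, Cross 0 True, Cap (Suc 0)] @ q) - f (u @ [Cup (Suc 0) d, Cross 0 False, Cap (Suc 0)] @ q) =
     w_var * f (u @ [Cup (Suc 0) d, Cap (Suc 0)] @ q)"
    by (simp add: smoothing_def)
  moreover have "f (u @ [Cup (Suc 0) d, Cross 0 b, Cap (Suc 0)] @ q) = a_pow (if b then 1 else - 1) * f (u @ q)" for b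
    using skein_invariant_curl[OF f curl.loop_right] cl[of b] by simp
  moreover have "f (u @ [Cup (Suc 0) d, Cap (Suc 0)] @ q) = f (u @ [Cup 0 d, Cap 0] @ q)"
  proof -
    \<comment> \<open>In \<open>?W\<close> the strand passes over the circle from one side to the
      other; undoing this at the minimum leaves the circle on the left, at the maximum on the
      right.\<close>
    let ?W = "u @ ([Cup (Suc (0 + 0)) d] @ overpass 0 (0 + 2) @ [Cap (0 + 0)]) @ q"
    have W: "closed ?W" using q by (auto simp: closed_def run_append True numeral_2_eq_2)
    have "Cup (Suc (0 + 0)) d # overpass 0 (0 + 2) \<leadsto> overpass 0 0 @ [Cup (0 + 0) d]"
      by (rule cup_overpass) simp
    from reduces_suffix[OF this, of "[Cap 0]"] 
    have "[Cup (Suc (0 + 0)) d] @ overpass 0 (0 + 2) @ [Cap (0 + 0)] \<leadsto> [Cup 0 d, Cap 0]"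
      by simp
    from reduces_context[OF this, of u q] W have 1: "f ?W = f (u @ [Cup 0 d, Cap 0] @ q)"
      using skein_invariant_isotopic[OF f W] reducesD(2) unfolding closed_def by blast
    have "overpass 0 (0 + 2) @ [Cap (0 + 0)] \<leadsto> Cap (Suc (0 + 0)) # overpass 0 0"
      by (rule overpass_cap) simp
    from reduces_prefix[OF this, of "[Cup (Suc 0) d]"] 
    have "[Cup (Suc (0 + 0)) d] @ overpass 0 (0 + 2) @ [Cap (0 + 0)] \<leadsto> [Cup (Suc 0) d, Cap (Suc 0)]"
      by simp
    from reduces_context[OF this, of u q] W have 2: "f ?W = f (u @ [Cup (Suc 0) d, Cap (Suc 0)] @ q)"
      using skein_invariant_isotopic[OF f W] reducesD(2) unfolding closed_def by blast
    from 1 2 show ?thesis by simp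
  qed
  ultimately show ?thesis by (simp add: algebra_simps)
qed

lemma skein_invariant_circle:
  assumes f: "skein_invariant f" and q: "closed (u @ q)" "run u [] = Some s" "s \<noteq> [] \<or> u = []"
  shows "w_var * f (u @ [Cup 0 d, Cap 0] @ q) = (a_pow 1 - a_pow (- 1)) * f (u @ q)"
proof (cases s)
  case (Cons x c)
  with skein_invariant_circle_beside[OF f q(1)] q(2) show ?thesis by simp
next
  case Nil
  with q have u: "u = []" "closed q" by auto
  \<comment> \<open>The circle lies at the very bottom with no strand beside it: it is lifted above
    the first minimum of \<open>q\<close>, whose strand then serves.\<close>
  from u(2) obtain e r where qe: "q = e # r" unfolding closed_def by (cases q) auto
  with u(2) obtain y where e: "e = Cup 0 y" by (cases e) (auto simp: closed_def split: if_splits)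
  have "[Cup 0 d, Cap 0, Cup 0 y] = [Cup 0 d] @ [Cap 0, shift (strands_out (Cap 0)) (Cup 0 y)]" by simp
  also have "\<dots> \<leadsto> [Cup 0 d] @ [shift (strands_in (Cap 0)) (Cup 0 y), Cap 0]"
    by (intro reduces_prefix red_exchange) simp
  also have "\<dots> = [Cup 0 d, shift (strands_out (Cup 0 d)) (Cup 0 y)] @ [Cap 0]" by simp
  also have "\<dots> \<leadsto> [shift (strands_in (Cup 0 d)) (Cup 0 y), Cup 0 d] @ [Cap 0]"
    by (intro reduces_suffix red_exchange) simp
  finally have "[Cup 0 d, Cap 0, Cup 0 y] \<leadsto> [Cup 0 y, Cup 0 d, Cap 0]" by simp
  then have "[Cup 0 d, Cap 0, Cup 0 y] @ r \<leadsto> [Cup 0 y, Cup 0 d, Cap 0] @ r"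
    by (rule reduces_suffix)
  then have red: "[Cup 0 d, Cap 0] @ q \<leadsto> [Cup 0 y] @ [Cup 0 d, Cap 0] @ r"
    using qe e by simp
  have cl: "closed ([Cup 0 d, Cap 0] @ q)" using u(2) by (intro closed_append) (simp_all add: closed_def)
  then have "word_isotopic [] ([Cup 0 d, Cap 0] @ q) ([Cup 0 y] @ [Cup 0 d, Cap 0] @ r)"
    using reducesD(2)[OF red] by (simp add: closed_def del: run.simps)
  then have "f ([Cup 0 d, Cap 0] @ q) = f ([Cup 0 y] @ [Cup 0 d, Cap 0] @ r)"
    by (rule skein_invariant_isotopic[OF f cl])
  moreover have "w_var * f ([Cup 0 y] @ [Cup 0 d, Cap 0] @ r) = (a_pow 1 - a_pow (- 1)) * f ([Cup 0 y] @ r)"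
    using u(2) qe e by (intro skein_invariant_circle_beside[OF f, where x = y and c = "[opposite y]"]) auto
  ultimately show ?thesis using u(1) qe e by simp
qed

definition w_inv :: laurent_wa where "w_inv = Poly_Mapping.single (- 1, 0) 1"

lemma w_inv_w [simp]: "w_inv * w_var = 1" "w_inv * (w_var * p) = p" "w_var * (w_inv * p) = p"
proof -
  show "w_inv * w_var = 1"
    by (simp add: w_inv_def w_var_def mult_single zero_prod_def flip: single_one)
  then show "w_inv * (w_var * p) = p" by (simp flip: mult.assoc)
  then show "w_var * (w_inv * p) = p" by (subst mult.left_commute)
qed

lemma w_cancel: "w_var * p = w_var * q \<Longrightarrow> p = q"
  by (metis w_inv_w(2))

text \<open>The only basis word ending at the empty level is the empty word, which is not a diagram.
  So the induction over \<open>spanned\<close> bottoms out where a circle is added to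
  nothing.\<close>

lemma skein_invariant_unique:
  assumes f: "skein_invariant f" and g: "skein_invariant g"
    and circle: "\<And>d. f [Cup 0 d, Cap 0] = g [Cup 0 d, Cap 0]" and "closed u"
  shows "f u = g u"
proof -
  have "f u = g u" if "spanned t u" "t = []" "u \<noteq> []" for t u
    using that
  proof (induction rule: spanned.induct)
    case (basis u t)
    then show ?case using basis_length[of u t] by auto
  next
    case (isotopic t u v)
    have v: "closed v"
      using spanned_run[OF isotopic(1)] word_isotopic_run[OF isotopic(2)] isotopic(4,5) by (simp add: closed_def)
    from isotopic(2) have "word_isotopic [] v u" by (rule word_isotopic_sym)
    with v have u: "closed u" using word_isotopic_closed by blast
    then have "f u = g u" using isotopic(3,4) by (simp add: closed_def)
    then show ?case
      using skein_invariant_isotopic[OF f u isotopic(2)] skein_invariant_isotopic[OF g u isotopic(2)] by simp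
  next
    case (curl t u q b c)
    then have cl: "closed (u @ c @ q)" by (simp add: closed_def)
    have "u @ q \<noteq> []" using curl_closed[OF curl(2) cl] by (simp add: closed_def)
    then have "f (u @ q) = g (u @ q)" using curl(4,5) by blast
    then show ?case using skein_invariant_curl[OF f curl(2) cl] skein_invariant_curl[OF g curl(2) cl] by simp
  next
    case (skein t u i b q s)
    have "run (u @ [Cross i b] @ q) [] = Some []" using spanned_run[OF skein(1)] skein.prems by simp
    then have i: "Suc i < length s" using skein(2) by (auto simp: run_append split: if_splits)
    have cl: "closed (u @ [Cross i True] @ q)"
      using \<open>run (u @ [Cross i b] @ q) [] = Some []\<close> skein(2) i by (simp add: closed_def run_append)
    have "u \<noteq> []" using skein(2) i by auto
    then have b: "f (u @ [Cross i b] @ q) = g (u @ [Cross i b] @ q)"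
      "f (u @ smoothing i (s ! i) (s ! Suc i) @ q) = g (u @ smoothing i (s ! i) (s ! Suc i) @ q)"
      using skein(4,5,6) by auto
    have *: "f (u @ [Cross i (s ! i = s ! Suc i)] @ q) - f (u @ [Cross i (s ! i \<noteq> s ! Suc i)] @ q) =
      g (u @ [Cross i (s ! i = s ! Suc i)] @ q) - g (u @ [Cross i (s ! i \<noteq> s ! Suc i)] @ q)"
      unfolding skein_invariant_skein[OF f skein(2) i cl] skein_invariant_skein[OF g skein(2) i cl] b(2) ..
    have alg: "x - y = x' - y' \<Longrightarrow> x = x' \<Longrightarrow> y = y'" "x - y = x' - y' \<Longrightarrow> y = y' \<Longrightarrow> x = x'" 
      for x y x' y' :: laurent_wa by simp_all
    show ?case
    proof (cases "b \<longleftrightarrow> s ! i = s ! Suc i")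
      case True
      then have eq: "(s ! i = s ! Suc i) = b" "(s ! i \<noteq> s ! Suc i) = (\<not> b)" by auto
      show ?thesis by (rule alg(1)[OF *[unfolded eq not_not] b(1)])
    next
      case False
      then have eq: "(s ! i = s ! Suc i) = (\<not> b)" "(s ! i \<noteq> s ! Suc i) = b" by auto
      show ?thesis by (rule alg(2)[OF *[unfolded eq not_not] b(1)])
    qed
  next
    case (circle t u q s d)
    show ?case
    proof (cases "u @ q = []")
      case True
      then show ?thesis using assms(3) by simp
    next
      case False
      with circle have fg: "f (u @ q) = g (u @ q)" by simp
      have cl: "closed (u @ q)" using spanned_run[OF circle(1)] circle.prems False by (simp add: closed_def)
      show ?thesis
        using skein_invariant_circle[OF f cl circle(2,3), of d] skein_invariant_circle[OF g cl circle(2,3), of d] fg 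
        by - (rule w_cancel, simp)
    qed
  qed
  from this[of "[]" u] show ?thesis
    using spanned_all[of u "[]"] assms(4) by (simp add: closed_def)
qed

definition eta :: laurent_wa where "eta = w_inv * (a_pow 1 - a_pow (- 1))"

abbreviation on_word :: "(link_diagram \<Rightarrow> 'a) \<Rightarrow> event list \<Rightarrow> 'a" where
  "on_word R u \<equiv> R (Abs_link_diagram u)"

lemma regular_homflypt_skein_invariant_append:
  assumes "regular_homflypt R" and v: "v = [] \<or> closed v"
  shows "skein_invariant (\<lambda>u. on_word R (u @ v))"
  unfolding skein_invariant_def
proof (intro conjI allI impI)
  have v': "run v [] = Some []" using v by (auto simp: closed_def)
  have cl: "closed (u @ v)" if "closed u" for u using that v' by (simp add: closed_def)
  note R = assms(1)[unfolded regular_homflypt_def]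
  fix u u' assume u: "closed u" "word_isotopic [] u u'"
  have "word_isotopic [] ([] @ u @ v) ([] @ u' @ v)"
    using u v' by (intro word_isotopic_context) (auto simp: closed_def)
  then have "regular_isotopic (Abs_link_diagram (u @ v)) (Abs_link_diagram (u' @ v))"
    using word_isotopic_closed cl[OF u(1)] by simp
  with R show "on_word R (u @ v) = on_word R (u' @ v)"
    unfolding regular_isotopy_invariant_def by blast
next
  fix u s i q assume u: "run u [] = Some s" "Suc i < length s" "closed (u @ [Cross i True] @ q)"
  have v': "run v [] = Some []" using v by (auto simp: closed_def)
  have cl: "closed (u @ [Cross i b] @ q @ v)" for b using u v' by (auto simp: closed_def run_append)
  have "run (u @ smoothing i (s ! i) (s ! Suc i) @ q @ v) [] = run (u @ [Cross i True] @ q @ v) []"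
    using u run_smoothing[OF u(2), of True] by (simp add: run_append)
  moreover have "u \<noteq> []" using u by auto
  ultimately have cl0: "closed (u @ smoothing i (s ! i) (s ! Suc i) @ q @ v)"
    using cl[of True] by (simp add: closed_def)
  have "conway_triple (length u) i (Abs_link_diagram (u @ [Cross i (s ! i = s ! Suc i)] @ q @ v)) 
     (Abs_link_diagram (u @ [Cross i (s ! i \<noteq> s ! Suc i)] @ q @ v))
     (Abs_link_diagram (u @ smoothing i (s ! i) (s ! Suc i) @ q @ v))"
    unfolding conway_triple_def using u cl cl0 by (intro exI[of _ u] exI[of _ "q @ v"] exI[of _ s]) simp
  with assms(1) show "on_word R ((u @ [Cross i (s ! i = s ! Suc i)] @ q) @ v) - on_word R ((u @ [Cross i (s ! i \<noteq> s ! Suc i)] @ q) @ v) =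
       w_var * on_word R ((u @ smoothing i (s ! i) (s ! Suc i) @ q) @ v)"
    unfolding regular_homflypt_def by simp
next
  fix u b c q assume c: "curl b c" "closed (u @ c @ q)"
  have v': "run v [] = Some []" using v by (auto simp: closed_def)
  have cl: "closed (u @ c @ q @ v)" using c v' by (auto simp: closed_def run_append bind_eq_Some_conv)
  have "removes_curl b (Abs_link_diagram (u @ c @ q @ v)) (Abs_link_diagram (u @ q @ v))"
    unfolding removes_curl_def local_move_def using c cl curl_closed[OF c(1) cl]
    by (intro exI[of _ u] exI[of _ "q @ v"] exI[of _ c] exI[of _ "[]"]) simp
  with assms(1) show "on_word R ((u @ c @ q) @ v) = a_pow (if b then 1 else - 1) * on_word R ((u @ q) @ v)"
    unfolding regular_homflypt_def by (cases b) simp_all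
qed

lemma regular_homflypt_skein_invariant: "regular_homflypt R \<Longrightarrow> skein_invariant (on_word R)"
  using regular_homflypt_skein_invariant_append[of R "[]"] by simp

lemma skein_invariant_times:
  assumes f: "skein_invariant f" shows "skein_invariant (\<lambda>u. p * f u)"
  unfolding skein_invariant_def
proof (intro conjI allI impI)
  fix u s i q assume "run u [] = Some s" "Suc i < length s" "closed (u @ [Cross i True] @ q)"
  from skein_invariant_skein[OF f this]
  show "p * f (u @ [Cross i (s ! i = s ! Suc i)] @ q) - p * f (u @ [Cross i (s ! i \<noteq> s ! Suc i)] @ q) =
       w_var * (p * f (u @ smoothing i (s ! i) (s ! Suc i) @ q))"
    by (metis mult.left_commute right_diff_distrib)
next
  fix u b c q assume "curl b c" "closed (u @ c @ q)"
  from skein_invariant_curl[OF f this]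
  show "p * f (u @ c @ q) = a_pow (if b then 1 else - 1) * (p * f (u @ q))"
    by (simp only: mult.left_commute)
next
  fix u v assume "closed u" "word_isotopic [] u v"
  from skein_invariant_isotopic[OF f this] show "p * f u = p * f v" by simp
qed

text \<open>Both sides, as functions of \<open>u\<close> with \<open>v\<close> fixed, are skein
  invariants, and they agree on the circle by \<open>skein_invariant_circle\<close>.\<close>

theorem regular_homflypt_append:
  assumes R: "regular_homflypt R" and u: "closed u" and v: "closed v"
  shows "on_word R (u @ v) = eta * on_word R u * on_word R v"
proof -
  have circ: "closed [Cup 0 d, Cap 0]" for d by (simp add: closed_def)
  have "on_word R [Cup 0 d, Cap 0] = 1" for d
    using R circ unfolding regular_homflypt_def standard_circle_def by auto
  moreover have "on_word R ([Cup 0 d, Cap 0] @ v) = eta * on_word R v" for d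
  proof (rule w_cancel)
    have "w_var * on_word R ([] @ [Cup 0 d, Cap 0] @ v) = (a_pow 1 - a_pow (- 1)) * on_word R ([] @ v)"
      using v by (intro skein_invariant_circle[OF regular_homflypt_skein_invariant[OF R], where s = "[]"]) simp_all
    then show "w_var * on_word R ([Cup 0 d, Cap 0] @ v) = w_var * (eta * on_word R v)"
      by (simp only: eta_def mult.assoc w_inv_w append_Nil)
  qed
  ultimately have "on_word R ([Cup 0 d, Cap 0] @ v) = eta * on_word R v * on_word R [Cup 0 d, Cap 0]" for d
    by simp
  then have "on_word R (u @ v) = (eta * on_word R v) * on_word R u"
    by (rule skein_invariant_unique[OF regular_homflypt_skein_invariant_append[OF R disjI2[OF v]]
          skein_invariant_times[OF regular_homflypt_skein_invariant[OF R]] _ u])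
  then show ?thesis by (simp only: mult.assoc mult.commute[of "on_word R v"])
qed

section \<open>Coloured words\<close>

text \<open>A coloured word attaches a colour to every strand, constant along the components.
  The colours are recorded at the minima, since they determine all others.\<close>

datatype 'c cevent = CCup nat direction 'c | CCap nat | CCross nat bool

type_synonym 'c clevel = "(direction \<times> 'c) list"

fun capply :: "'c cevent \<Rightarrow> 'c clevel \<Rightarrow> 'c clevel option" where
  "capply (CCup i d c) s =
     (if i \<le> length s then Some (take i s @ [(d, c), (opposite d, c)] @ drop i s) else None)"
| "capply (CCap i) s =
     (if Suc i < length s \<and> fst (s ! i) \<noteq> fst (s ! Suc i) \<and> snd (s ! i) = snd (s ! Suc i)
      then Some (take i s @ drop (i + 2) s) else None)"
| "capply (CCross i b) s =
     (if Suc i < length s then Some (take i s @ [s ! Suc i, s ! i] @ drop (i + 2) s) else None)"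

fun crun :: "'c cevent list \<Rightarrow> 'c clevel \<Rightarrow> 'c clevel option" where
  "crun [] s = Some s"
| "crun (e # es) s = (case capply e s of None \<Rightarrow> None | Some t \<Rightarrow> crun es t)"

fun erase :: "'c cevent \<Rightarrow> event" where
  "erase (CCup i d c) = Cup i d"
| "erase (CCap i) = Cap i"
| "erase (CCross i b) = Cross i b"

fun event_colours :: "'c cevent \<Rightarrow> 'c set" where
  "event_colours (CCup i d c) = {c}"
| "event_colours (CCap i) = {}"
| "event_colours (CCross i b) = {}"

definition colours :: "'c cevent list \<Rightarrow> 'c set" where
  "colours W = (\<Union>e \<in> set W. event_colours e)"

abbreviation recolour :: "('c \<Rightarrow> 'd) \<Rightarrow> 'c cevent list \<Rightarrow> 'd cevent list" where
  "recolour f \<equiv> map (map_cevent f)"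

abbreviation recolour_level :: "('c \<Rightarrow> 'd) \<Rightarrow> 'c clevel \<Rightarrow> 'd clevel" where
  "recolour_level f \<equiv> map (apsnd f)"

lemma colours_simps [simp]: 
  "colours [] = {}" "colours (e # W) = event_colours e \<union> colours W"
  "colours (W @ W') = colours W \<union> colours W'"
  by (auto simp: colours_def)

lemma event_colours_map [simp]: "event_colours (map_cevent f e) = f ` event_colours e"
  by (cases e) auto

lemma colours_recolour [simp]: "colours (recolour f W) = f ` colours W"
  by (induction W) (auto simp: image_Un)

lemma erase_map_cevent [simp]: "erase (map_cevent f e) = erase e"
  by (cases e) auto

lemma erase_comp_map_cevent [simp]: "erase \<circ> map_cevent f = erase"
  by auto

lemma finite_colours [simp]: "finite (colours W)"
proof (induction W)
  case (Cons e W)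
  then show ?case by (cases e) auto
qed simp

lemma crun_append: "crun (u @ v) s = Option.bind (crun u s) (crun v)"
  by (induction u arbitrary: s) (auto split: option.splits)

lemma crun_append_Some [simp]: "crun u s = Some t \<Longrightarrow> crun (u @ v) s = crun v t"
  by (simp add: crun_append)

lemma crun_append_SomeE:
  assumes "crun (u @ v) s = Some t"
  obtains r where "crun u s = Some r" "crun v r = Some t"
  using assms by (auto simp: crun_append bind_eq_Some_conv)

lemma crun_ConsE:
  assumes "crun (e # u) s = Some t"
  obtains r where "capply e s = Some r" "crun u r = Some t"
  using assms by (auto split: option.splits)

lemma capply_CCup_append [simp]:
  "length a = i \<Longrightarrow> capply (CCup i d c) (a @ b) = Some (a @ (d, c) # (opposite d, c) # b)"
  by auto

lemma capply_CCross_append [simp]: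
  "length a = i \<Longrightarrow> capply (CCross i b) (a @ x # y # c) = Some (a @ y # x # c)"
  by (auto simp: nth_append)

lemma capply_CCap_append [simp]:
  "length a = i \<Longrightarrow> capply (CCap i) (a @ x # y # c) = (if fst x \<noteq> fst y \<and> snd x = snd y then Some (a @ c) else None)"
  by (auto simp: nth_append)

lemma capply_CCup_E:
  assumes "capply (CCup i d c) s = Some t"
  obtains a b where "s = a @ b" "length a = i" "t = a @ (d, c) # (opposite d, c) # b"
  by (rule that[of "take i s" "drop i s"]) (use assms in \<open>auto split: if_splits\<close>)

lemma capply_CCross_E:
  assumes "capply (CCross i b) s = Some t"
  obtains a x y c where "s = a @ x # y # c" "length a = i" "t = a @ y # x # c"
proof -
  from assms have "Suc i < length s" by (auto split: if_splits)
  then obtain a x y c where "s = a @ x # y # c" "length a = i" by (rule split2)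
  with assms that show ?thesis by (auto simp del: capply.simps)
qed

lemma capply_CCap_E:
  assumes "capply (CCap i) s = Some t"
  obtains a d c b where "s = a @ (d, c) # (opposite d, c) # b" "length a = i" "t = a @ b"
proof -
  from assms have "Suc i < length s" by (auto split: if_splits)
  then obtain a x y b where s: "s = a @ x # y # b" "length a = i" by (rule split2)
  with assms have "fst x \<noteq> fst y \<and> snd x = snd y" "t = a @ b"
    by (auto simp del: capply.simps split: if_splits)
  moreover from this have "y = (opposite (fst x), snd x)" by (metis opposite_eq_iff prod.collapse)
  ultimately show ?thesis using that[of a "fst x" "snd x" b] s by simp
qed

lemma capply_erase:
  "capply e s = Some t \<Longrightarrow> apply_event (erase e) (map fst s) = Some (map fst t)"
  by (cases e) (auto elim!: capply_CCup_E capply_CCap_E capply_CCross_E simp del: capply.simps apply_event.simps simp: apply_Cup_append apply_Cap_append apply_Cross_append)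

lemma crun_erase:
  "crun W s = Some t \<Longrightarrow> run (map erase W) (map fst s) = Some (map fst t)"
proof (induction W arbitrary: s)
  case (Cons e W)
  then show ?case by (auto elim!: crun_ConsE dest!: capply_erase simp del: crun.simps capply.simps)
qed simp

lemma capply_map:
  "capply e s = Some t \<Longrightarrow> capply (map_cevent f e) (recolour_level f s) = Some (recolour_level f t)"
  by (cases e) (auto elim!: capply_CCup_E capply_CCap_E capply_CCross_E simp del: capply.simps simp: capply_CCup_append capply_CCap_append capply_CCross_append)

lemma crun_recolour:
  "crun W s = Some t \<Longrightarrow> crun (recolour f W) (recolour_level f s) = Some (recolour_level f t)"
proof (induction W arbitrary: s)
  case (Cons e W)
  then obtain r where r: "capply e s = Some r" "crun W r = Some t" by (rule_tac crun_ConsE)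
  then show ?case using Cons.IH[OF r(2)] capply_map[OF r(1), of f] by simp
qed simp

lemma capply_colours:
  "capply e s = Some t \<Longrightarrow> snd ` set t \<subseteq> event_colours e \<union> snd ` set s"
  by (cases e) (auto elim!: capply_CCup_E capply_CCap_E capply_CCross_E simp del: capply.simps)

lemma crun_colours:
  "crun W s = Some t \<Longrightarrow> snd ` set t \<subseteq> colours W \<union> snd ` set s"
proof (induction W arbitrary: s)
  case (Cons e W)
  then obtain r where r: "capply e s = Some r" "crun W r = Some t" by (rule_tac crun_ConsE)
  then show ?case using Cons.IH[OF r(2)] capply_colours[OF r(1)] by auto
qed simp

text \<open>\<open>sub T W s\<close> deletes from \<open>W\<close>, read from the level \<open>s\<close>, the strands whose colours violate \<open>T\<close>; the others are renumbered.\<close>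

abbreviation keep :: "('c \<Rightarrow> bool) \<Rightarrow> 'c clevel \<Rightarrow> 'c clevel" where
  "keep T \<equiv> filter (\<lambda>x. T (snd x))"

fun sub1 :: "('c \<Rightarrow> bool) \<Rightarrow> 'c cevent \<Rightarrow> 'c clevel \<Rightarrow> 'c cevent list" where
  "sub1 T (CCup i d c) s = (if T c then [CCup (length (keep T (take i s))) d c] else [])"
| "sub1 T (CCap i) s = (if T (snd (s ! i)) then [CCap (length (keep T (take i s)))] else [])"
| "sub1 T (CCross i b) s =
     (if T (snd (s ! i)) \<and> T (snd (s ! Suc i)) then [CCross (length (keep T (take i s))) b] else [])"

fun sub :: "('c \<Rightarrow> bool) \<Rightarrow> 'c cevent list \<Rightarrow> 'c clevel \<Rightarrow> 'c cevent list" where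
  "sub T [] s = []"
| "sub T (e # W) s = sub1 T e s @ sub T W (the (capply e s))"

lemma sub1_append [simp]:
  "length a = i \<Longrightarrow> sub1 T (CCup i d c) (a @ b) = (if T c then [CCup (length (keep T a)) d c] else [])"
  "length a = i \<Longrightarrow> sub1 T (CCap i) (a @ x # b) = (if T (snd x) then [CCap (length (keep T a))] else [])"
  "length a = i \<Longrightarrow> sub1 T (CCross i r) (a @ x # y # b) =
     (if T (snd x) \<and> T (snd y) then [CCross (length (keep T a)) r] else [])"
  by (simp_all add: nth_append)

lemma crun_sub1:
  assumes "capply e s = Some t"
  shows "crun (sub1 T e s) (keep T s) = Some (keep T t)"
  using assms
  by (cases e) (auto elim!: capply_CCup_E capply_CCap_E capply_CCross_E simp del: capply.simps sub1.simps)

lemma crun_sub: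
  "crun W s = Some t \<Longrightarrow> crun (sub T W s) (keep T s) = Some (keep T t)"
proof (induction W arbitrary: s)
  case (Cons e W)
  then obtain r where r: "capply e s = Some r" "crun W r = Some t" by (rule_tac crun_ConsE)
  then show ?case using Cons.IH[OF r(2)] crun_sub1[OF r(1), of T] by simp
qed simp

lemma sub_append: "crun u s = Some t \<Longrightarrow> sub T (u @ v) s = sub T u s @ sub T v t"
  by (induction u arbitrary: s) (auto split: option.splits)

lemma keep_recolour: "keep T (recolour_level f s) = recolour_level f (keep (\<lambda>c. T (f c)) s)"
  by (induction s) auto

lemma sub1_map:
  assumes "capply e s = Some t"
  shows "sub1 T (map_cevent f e) (recolour_level f s) = recolour f (sub1 (\<lambda>c. T (f c)) e s)"
  using assms
  by (cases e) (auto elim!: capply_CCup_E capply_CCap_E capply_CCross_E simp del: capply.simps sub1.simps simp: keep_recolour)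

lemma sub_recolour:
  "crun W s = Some t \<Longrightarrow> sub T (recolour f W) (recolour_level f s) = recolour f (sub (\<lambda>c. T (f c)) W s)"
proof (induction W arbitrary: s)
  case (Cons e W)
  then obtain r where r: "capply e s = Some r" "crun W r = Some t" by (rule_tac crun_ConsE)
  then show ?case using Cons.IH[OF r(2)] sub1_map[OF r(1), of T f] capply_map[OF r(1), of f] by simp
qed simp

lemma colours_sub1: "event_colours e \<inter> Collect T = colours (sub1 T e s)"
  by (cases e) auto

lemma colours_sub: "colours (sub T W s) = colours W \<inter> Collect T"
  by (induction W arbitrary: s) (auto simp flip: colours_sub1)

lemma sub_cong:
  assumes "crun W s = Some t" "\<And>c. c \<in> colours W \<union> snd ` set s \<Longrightarrow> T c = T' c"
  shows "sub T W s = sub T' W s"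
  using assms
proof (induction W arbitrary: s)
  case (Cons e W)
  then obtain r where r: "capply e s = Some r" "crun W r = Some t" by (rule_tac crun_ConsE)
  have k: "keep T (take i s) = keep T' (take i s)" for i
    using Cons.prems(2) set_take_subset[of i s] by (intro filter_cong) auto
  have "sub1 T e s = sub1 T' e s"
    using r(1) Cons.prems(2) by (cases e) (auto simp: k split: if_splits)
  moreover have "sub T W r = sub T' W r"
    by (rule Cons.IH[OF r(2)], rule Cons.prems(2)) (use capply_colours[OF r(1)] in auto)
  ultimately show ?case using r by simp
qed simp

lemma sub_nonempty: 
  assumes "colours W \<inter> Collect T \<noteq> {}" shows "sub T W s \<noteq> []"
  using assms colours_sub[of T W s] by auto

lemma closed_sub:
  assumes "crun W [] = Some []" "colours W \<inter> Collect T \<noteq> {}"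
  shows "closed (map erase (sub T W []))"
  using crun_erase[OF crun_sub[OF assms(1), of T]] sub_nonempty[OF assms(2)] by (simp add: closed_def)

subsection \<open>The colouring by components\<close>

definition is_lift :: "link_diagram \<Rightarrow> 'c cevent list \<Rightarrow> bool" where
  "is_lift D W \<longleftrightarrow> map erase W = events D \<and> crun W [] = Some []"

definition colour_at :: "'c cevent list \<Rightarrow> nat \<times> nat \<Rightarrow> 'c option" where
  "colour_at W = (\<lambda>(k, j). case crun (take k W) [] of None \<Rightarrow> None | Some s \<Rightarrow>
     if j < length s then Some (snd (s ! j)) else None)"

lemma crun_nth:
  assumes "crun W s = Some t" "k < length W"
  obtains r r' where "crun (take k W) s = Some r" "capply (W ! k) r = Some r'" "crun (take (Suc k) W) s = Some r'"
proof -
  have "W = take k W @ W ! k # drop (Suc k) W" using assms(2) by (rule id_take_nth_drop)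
  with assms(1) obtain r where r: "crun (take k W) s = Some r" "crun (W ! k # drop (Suc k) W) r = Some t"
    by (metis crun_append_SomeE)
  from r(2) obtain r' where "capply (W ! k) r = Some r'" by (rule crun_ConsE)
  moreover from this r(1) assms(2) have "crun (take (Suc k) W) s = Some r'"
    by (simp add: take_Suc_conv_app_nth)
  ultimately show ?thesis using that r by blast
qed

lemma colour_at_linked:
  assumes W: "is_lift D W" and "linked_in_slice (events D) p q"
  shows "colour_at W p = colour_at W q"
proof -
  have step: "\<exists>r r'. crun (take k W) [] = Some r \<and> capply (W ! k) r = Some r' \<and> crun (take (Suc k) W) [] = Some r' \<and>
      events D ! k = erase (W ! k)"
    if "k < length (events D)" for k
  proof -
    from W have len: "length (events D) = length W" and er: "map erase W = events D"
      by (auto simp: is_lift_def dest: arg_cong[of _ _ length])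
    from W that len crun_nth[of W "[]" "[]" k] show ?thesis unfolding is_lift_def by (metis nth_map)
  qed
  note E = capply_CCup_E capply_CCap_E capply_CCross_E
  show ?thesis using assms(2)
  proof cases
    case (left k j)
    with step[OF this(3)] show ?thesis
      by (cases "W ! k") (auto elim!: E simp: colour_at_def nth_append simp del: capply.simps)
  next
    case (right k j)
    with step[OF this(3)] show ?thesis
      by (cases "W ! k") (auto elim!: E simp: colour_at_def nth_append simp del: capply.simps)
  next
    case (cup k i d)
    with step[OF this(3)] show ?thesis
      by (cases "W ! k") (auto elim!: E simp: colour_at_def nth_append simp del: capply.simps)
  next
    case (cap k i)
    with step[OF this(3)] show ?thesis
      by (cases "W ! k") (auto elim!: E simp: colour_at_def nth_append simp del: capply.simps)
  next
    case (cross_rising k i b)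
    with step[OF this(3)] show ?thesis
      by (cases "W ! k") (auto elim!: E simp: colour_at_def nth_append simp del: capply.simps)
  next
    case (cross_falling k i b)
    with step[OF this(3)] show ?thesis
      by (cases "W ! k") (auto elim!: E simp: colour_at_def nth_append simp del: capply.simps)
  qed
qed

definition colour_level :: "(nat \<Rightarrow> 'c) \<Rightarrow> level \<Rightarrow> 'c clevel" where
  "colour_level f s = zip s (map f [0..<length s])"

text \<open>The strands of a minimum first appear on the line above it, hence the index
  \<open>Suc k\<close>.\<close>

definition colour_event :: "(nat \<times> nat \<Rightarrow> 'c) \<Rightarrow> nat \<Rightarrow> event \<Rightarrow> 'c cevent" where
  "colour_event \<kappa> k e = (case e of Cup i d \<Rightarrow> CCup i d (\<kappa> (Suc k, i)) | Cap i \<Rightarrow> CCap i | Cross i b \<Rightarrow> CCross i b)"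

definition colour_word :: "(nat \<times> nat \<Rightarrow> 'c) \<Rightarrow> event list \<Rightarrow> 'c cevent list" where
  "colour_word \<kappa> es = map (\<lambda>k. colour_event \<kappa> k (es ! k)) [0..<length es]"

lemma length_colour_level [simp]: "length (colour_level f s) = length s"
  by (simp add: colour_level_def)

lemma nth_colour_level: "j < length s \<Longrightarrow> colour_level f s ! j = (s ! j, f j)"
  by (simp add: colour_level_def)

lemma colour_level_append:
  "colour_level f (a @ b) = colour_level f a @ colour_level (\<lambda>j. f (length a + j)) b"
  by (rule nth_equalityI) (auto simp: nth_append nth_colour_level)

lemma colour_level_Cons:
  "colour_level f (x # b) = (x, f 0) # colour_level (\<lambda>j. f (Suc j)) b"
  using colour_level_append[of f "[x]" b] by (simp add: colour_level_def)

lemma colour_level_Nil [simp]: "colour_level f [] = []"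
  by (simp add: colour_level_def)

lemma colour_level_cong: "(\<And>j. j < length s \<Longrightarrow> f j = g j) \<Longrightarrow> colour_level f s = colour_level g s"
  by (auto simp: colour_level_def intro!: arg_cong2[of _ _ _ _ zip])

lemma apply_Cup_E:
  assumes "apply_event (Cup i d) s = Some t"
  obtains a b where "s = a @ b" "length a = i" "t = a @ d # opposite d # b"
  by (rule that[of "take i s" "drop i s"]) (use assms in \<open>auto split: if_splits\<close>)

lemma apply_Cross_E:
  assumes "apply_event (Cross i b) s = Some t"
  obtains a x y c where "s = a @ x # y # c" "length a = i" "t = a @ y # x # c"
proof -
  from assms have "Suc i < length s" by (auto split: if_splits)
  then obtain a x y c where "s = a @ x # y # c" "length a = i" by (rule split2)
  with assms that show ?thesis by (auto simp del: apply_event.simps simp: apply_Cross_append)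
qed

lemma apply_Cap_E:
  assumes "apply_event (Cap i) s = Some t"
  obtains a x b where "s = a @ x # opposite x # b" "length a = i" "t = a @ b"
proof -
  from assms have "Suc i < length s" by (auto split: if_splits)
  then obtain a x y b where s: "s = a @ x # y # b" "length a = i" by (rule split2)
  with assms have "x \<noteq> y" "t = a @ b"
    by (auto simp del: apply_event.simps simp: apply_Cap_append split: if_splits)
  with that[of a x b] s show ?thesis by (simp add: opposite_eq_iff)
qed

lemma capply_colour_event:
  assumes \<kappa>: "\<And>p q. linked_in_slice es p q \<Longrightarrow> \<kappa> p = \<kappa> q" and k: "k < length es"
    and t: "apply_event (es ! k) s = Some t"
  shows "capply (colour_event \<kappa> k (es ! k)) (colour_level (\<lambda>j. \<kappa> (k, j)) s) = Some (colour_level (\<lambda>j. \<kappa> (Suc k, j)) t)"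
proof -
  define i where "i = pos (es ! k)"
  have left: "\<kappa> (k, j) = \<kappa> (Suc k, j)" if "j < i" for j
    using \<kappa>[OF linked_in_slice.left[of k es j]] k that by (simp add: i_def)
  have right: "\<kappa> (k, i + strands_in (es ! k) + j) = \<kappa> (Suc k, i + strands_out (es ! k) + j)" for j
    using \<kappa>[OF linked_in_slice.right[of k es j]] k by (simp add: i_def)
  have L: "colour_level (\<lambda>j. \<kappa> (k, j)) a = colour_level (\<lambda>j. \<kappa> (Suc k, j)) a" if "length a = i" for a
    using left that by (intro colour_level_cong) simp
  show ?thesis
  proof (cases "es ! k")
    case (Cup i' d)
    then have "i' = i" by (simp add: i_def)
    with Cup t obtain a b where ab: "s = a @ b" "length a = i" "t = a @ d # opposite d # b"
      by (metis apply_Cup_E)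
    have "\<kappa> (Suc k, Suc i) = \<kappa> (Suc k, i)"
      using \<kappa>[OF linked_in_slice.cup[of k es i d]] k Cup \<open>i' = i\<close> by simp
    then show ?thesis using ab Cup \<open>i' = i\<close> L right
      by (simp add: colour_event_def colour_level_append colour_level_Cons del: capply.simps)
  next
    case (Cap i')
    then have "i' = i" by (simp add: i_def)
    with Cap t obtain a x b where ab: "s = a @ x # opposite x # b" "length a = i" "t = a @ b"
      by (metis apply_Cap_E)
    have "\<kappa> (k, Suc i) = \<kappa> (k, i)"
      using \<kappa>[OF linked_in_slice.cap[of k es i]] k Cap \<open>i' = i\<close> by simp
    then show ?thesis using ab Cap \<open>i' = i\<close> L right
      by (simp add: colour_event_def colour_level_append colour_level_Cons del: capply.simps)
  next
    case (Cross i' b')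
    then have "i' = i" by (simp add: i_def)
    with Cross t obtain a x y b where ab: "s = a @ x # y # b" "length a = i" "t = a @ y # x # b"
      by (metis apply_Cross_E)
    have "\<kappa> (k, i) = \<kappa> (Suc k, Suc i)" "\<kappa> (k, Suc i) = \<kappa> (Suc k, i)"
      using \<kappa>[OF linked_in_slice.cross_rising[of k es i b']] 
        \<kappa>[OF linked_in_slice.cross_falling[of k es i b']] k Cross \<open>i' = i\<close> by simp_all
    then show ?thesis using ab Cross \<open>i' = i\<close> L right
      by (simp add: colour_event_def colour_level_append colour_level_Cons del: capply.simps)
  qed
qed

lemma run_nth:
  assumes "run W s = Some t" "k < length W"
  obtains r r' where "run (take k W) s = Some r" "apply_event (W ! k) r = Some r'" "run (take (Suc k) W) s = Some r'"
proof -
  have "W = take k W @ W ! k # drop (Suc k) W" using assms(2) by (rule id_take_nth_drop)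
  with assms(1) obtain r where r: "run (take k W) s = Some r" "run (W ! k # drop (Suc k) W) r = Some t"
    by (metis run_append_SomeE)
  from r(2) obtain r' where "apply_event (W ! k) r = Some r'" by (rule run_ConsE)
  moreover from this r(1) assms(2) have "run (take (Suc k) W) s = Some r'"
    by (simp add: take_Suc_conv_app_nth)
  ultimately show ?thesis using that r by blast
qed

lemma crun_colour_word:
  assumes \<kappa>: "\<And>p q. linked_in_slice (events D) p q \<Longrightarrow> \<kappa> p = \<kappa> q"
    and "k \<le> length (events D)"
  shows "\<exists>s. run (take k (events D)) [] = Some s \<and>
    crun (take k (colour_word \<kappa> (events D))) [] = Some (colour_level (\<lambda>j. \<kappa> (k, j)) s)"
  using assms(2)
proof (induction k)
  case (Suc k)
  then obtain s where s: "run (take k (events D)) [] = Some s"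
    "crun (take k (colour_word \<kappa> (events D))) [] = Some (colour_level (\<lambda>j. \<kappa> (k, j)) s)" by auto
  from run_nth[of "events D" "[]" "[]" k] closed_events[of D] Suc.prems s(1)
  obtain t where t: "apply_event (events D ! k) s = Some t" "run (take (Suc k) (events D)) [] = Some t"
    unfolding closed_def by (metis Suc_le_eq option.inject)
  have "take (Suc k) (colour_word \<kappa> (events D)) = take k (colour_word \<kappa> (events D)) @ [colour_event \<kappa> k (events D ! k)]"
    using Suc.prems by (simp add: take_Suc_conv_app_nth colour_word_def)
  moreover have "capply (colour_event \<kappa> k (events D ! k)) (colour_level (\<lambda>j. \<kappa> (k, j)) s) = Some (colour_level (\<lambda>j. \<kappa> (Suc k, j)) t)"
    by (rule capply_colour_event[OF \<kappa> _ t(1)]) (use Suc.prems in simp_all)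
  ultimately show ?case using t s(2) by simp
qed simp

lemma is_lift_colour_word:
  assumes \<kappa>: "\<And>p q. linked_in_slice (events D) p q \<Longrightarrow> \<kappa> p = \<kappa> q"
  shows "is_lift D (colour_word \<kappa> (events D))"
proof -
  have "map erase (colour_word \<kappa> (events D)) = events D"
    by (rule nth_equalityI) (auto simp: colour_word_def colour_event_def split: event.splits)
  moreover have "crun (colour_word \<kappa> (events D)) [] = Some []"
    using crun_colour_word[where D = D and k = "length (events D)" and \<kappa> = \<kappa>, OF \<kappa> order_refl] closed_events[of D]
    by (simp add: colour_word_def closed_def)
  ultimately show ?thesis by (simp add: is_lift_def)
qed

lemma colour_at_colour_word:
  assumes \<kappa>: "\<And>p q. linked_in_slice (events D) p q \<Longrightarrow> \<kappa> p = \<kappa> q"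
  shows "colour_at (colour_word \<kappa> (events D)) p = (if p \<in> strand_points D then Some (\<kappa> p) else None)"
proof (cases p)
  case (Pair k j)
  have len: "length (colour_word \<kappa> (events D)) = length (events D)" by (simp add: colour_word_def)
  show ?thesis
  proof (cases "k \<le> length (events D)")
    case True
    from crun_colour_word[where \<kappa> = \<kappa>, OF \<kappa> this] show ?thesis
      by (auto simp: Pair colour_at_def strand_points_def nth_colour_level True)
  next
    case False
    with is_lift_colour_word[where D = D and \<kappa> = \<kappa>, OF \<kappa>] show ?thesis
      by (simp add: Pair colour_at_def strand_points_def is_lift_def len)
  qed
qed

text \<open>The rules of \<open>linked_in_slice\<close> do not mention the width of the level, so a
  strand must be shown to exist where it is linked to. The one-colour colouring does this: its
  \<open>colour_at\<close> is constant under linking and is \<open>None\<close> exactly off the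
  diagram.\<close>

lemma linked_strand_points:
  assumes "linked_in_slice (events D) p q" shows "p \<in> strand_points D \<longleftrightarrow> q \<in> strand_points D"
proof -
  let ?W = "colour_word (\<lambda>_. ()) (events D)"
  have "colour_at ?W p = colour_at ?W q"
    by (rule colour_at_linked[OF is_lift_colour_word assms]) simp
  then show ?thesis by (simp add: colour_at_colour_word split: if_splits)
qed

lemma equivclp_linked:
  assumes "equivclp (linked_in_slice (events D)) p q"
  shows "(p \<in> strand_points D \<longleftrightarrow> q \<in> strand_points D) \<and> (is_lift D W \<longrightarrow> colour_at W p = colour_at W q)"
  using assms
proof (induction rule: equivclp_induct)
  case (step y z)
  then show ?case
    using linked_strand_points[of D y z] linked_strand_points[of D z y]
      colour_at_linked[of D W y z] colour_at_linked[of D W z y] by auto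
qed simp

lemma equiv_same_component: "equiv (strand_points D) (same_component D)"
proof (rule equivI)
  show "refl_on (strand_points D) (same_component D)"
    by (auto simp: refl_on_def same_component_def)
  show "sym (same_component D)"
    by (rule symI) (auto simp: same_component_def intro: equivclp_sym)
  show "trans (same_component D)"
    by (rule transI) (auto simp: same_component_def elim: equivclp_trans)
qed (auto simp: same_component_def)

definition component_of :: "link_diagram \<Rightarrow> nat \<times> nat \<Rightarrow> (nat \<times> nat) set" where
  "component_of D p = same_component D `` {p}"

definition universal :: "link_diagram \<Rightarrow> (nat \<times> nat) set cevent list" where
  "universal D = colour_word (component_of D) (events D)"

lemma component_of_linked:
  assumes "linked_in_slice (events D) p q" shows "component_of D p = component_of D q"
proof (cases "p \<in> strand_points D")
  case True
  with assms have "(p, q) \<in> same_component D"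
    using linked_strand_points by (auto simp: same_component_def r_into_equivclp)
  then show ?thesis unfolding component_of_def by (rule equiv_class_eq[OF equiv_same_component])
next
  case False
  moreover from this assms have "q \<notin> strand_points D" using linked_strand_points by blast
  ultimately show ?thesis by (auto simp: component_of_def same_component_def)
qed

lemma is_lift_universal: "is_lift D (universal D)"
  unfolding universal_def by (rule is_lift_colour_word) (rule component_of_linked)

lemma colour_at_universal:
  "colour_at (universal D) p = (if p \<in> strand_points D then Some (component_of D p) else None)"
  unfolding universal_def by (rule colour_at_colour_word) (rule component_of_linked)

lemma same_component_colour:
  assumes "is_lift D W" "(p, q) \<in> same_component D" shows "colour_at W p = colour_at W q"
  using equivclp_linked[of D p q W] assms by (auto simp: same_component_def)

lemma colour_at_cup:
  assumes W: "is_lift D W" and "k < length W" "W ! k = CCup i d c"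
  shows "colour_at W (Suc k, i) = Some c" "(Suc k, i) \<in> strand_points D"
proof -
  from W assms(2) obtain r r' where r: "crun (take k W) [] = Some r" "capply (W ! k) r = Some r'" "crun (take (Suc k) W) [] = Some r'"
    using crun_nth[of W "[]" "[]" k] unfolding is_lift_def by metis
  from r(2) assms(3) obtain a b where ab: "r' = a @ (d, c) # (opposite d, c) # b" "length a = i"
    by (metis capply_CCup_E)
  show "colour_at W (Suc k, i) = Some c"
    using r(3) ab by (simp add: colour_at_def nth_append)
  have "run (take (Suc k) (events D)) [] = Some (map fst r')"
    using crun_erase[OF r(3)] W by (simp add: is_lift_def flip: take_map)
  moreover have "Suc k \<le> length (events D)"
    using W assms(2) by (auto simp: is_lift_def dest: arg_cong[of _ _ length])
  ultimately show "(Suc k, i) \<in> strand_points D"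
    using ab by (auto simp: strand_points_def)
qed

lemma colour_at_in_colours:
  assumes "is_lift D W" "colour_at W p = Some c" shows "c \<in> colours W"
proof -
  obtain k j where p: "p = (k, j)" by force
  with assms(2) obtain s where s: "crun (take k W) [] = Some s" "j < length s" "c = snd (s ! j)"
    by (auto simp: colour_at_def split: option.splits if_splits)
  from crun_colours[OF s(1)] s have "c \<in> colours (take k W)" by (auto dest!: nth_mem)
  then show ?thesis using set_take_subset[of k W] by (auto simp: colours_def)
qed

lemma in_colours_obtain:
  assumes "c \<in> colours W" obtains k i d where "k < length W" "W ! k = CCup i d c"
proof -
  from assms obtain e where e: "e \<in> set W" "c \<in> event_colours e" by (auto simp: colours_def)
  from e(2) obtain i d where "e = CCup i d c" by (cases e) auto
  with e(1) that show ?thesis by (metis in_set_conv_nth)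
qed

lemma colours_universal: "colours (universal D) = components D"
proof (intro set_eqI iffI)
  fix c assume "c \<in> colours (universal D)"
  then obtain k i d where k: "k < length (universal D)" "universal D ! k = CCup i d c" by (rule in_colours_obtain)
  from colour_at_cup[OF is_lift_universal this] have "(Suc k, i) \<in> strand_points D" "c = component_of D (Suc k, i)"
    by (auto simp: colour_at_universal)
  then show "c \<in> components D" by (simp add: components_def component_of_def quotientI)
next
  fix c assume "c \<in> components D"
  then obtain p where "p \<in> strand_points D" "c = component_of D p"
    unfolding components_def component_of_def by (rule quotientE)
  then have "colour_at (universal D) p = Some c" by (simp add: colour_at_universal)
  then show "c \<in> colours (universal D)" by (rule colour_at_in_colours[OF is_lift_universal])
qed

lemma finite_components [simp]: "finite (components D)"
  by (simp flip: colours_universal)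

text \<open>Points of one component have the same colour in \<open>V\<close>, so the colour of a
  chosen representative defines \<open>f\<close>. Since colours are stored at the minima only,
  agreement there is agreement of the words.\<close>

lemma lift_universal:
  assumes V: "is_lift D V"
  obtains f where "V = recolour f (universal D)"
proof -
  define f where "f C = the (colour_at V (SOME p. p \<in> C))" for C
  have er: "map erase V = map erase (universal D)"
    using V is_lift_universal[of D] by (simp add: is_lift_def)
  then have len: "length V = length (universal D)" by (rule map_eq_imp_length_eq)
  have "V = recolour f (universal D)"
  proof (rule nth_equalityI)
    fix k assume k: "k < length V"
    with er len have e: "erase (V ! k) = erase (universal D ! k)" by (metis nth_map)
    show "V ! k = recolour f (universal D) ! k"
    proof (cases "V ! k")
      case (CCup i d c)
      with e obtain C where C: "universal D ! k = CCup i d C" by (cases "universal D ! k") auto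
      from colour_at_cup[OF is_lift_universal _ C] k len
      have p: "(Suc k, i) \<in> strand_points D" "C = component_of D (Suc k, i)"
        by (auto simp: colour_at_universal)
      have "(Suc k, i) \<in> C" 
        using p equiv_class_self[OF equiv_same_component] by (simp add: component_of_def)
      then have "(SOME p. p \<in> C) \<in> C" by (rule someI)
      then have "((Suc k, i), SOME p. p \<in> C) \<in> same_component D" by (simp add: p(2) component_of_def)
      with colour_at_cup(1)[OF V k CCup] have "f C = c"
        unfolding f_def using same_component_colour[OF V] by (metis option.sel)
      then show ?thesis using CCup C k len by simp
    qed (use e k len in \<open>cases "universal D ! k"; simp\<close>)+
  qed (use len in simp)
  then show ?thesis by (rule that)
qed

text \<open>A lift has at most as many colours as there are components; equality of the
  cardinalities says that different components have different colours.\<close>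

definition full_lift :: "link_diagram \<Rightarrow> 'c cevent list \<Rightarrow> bool" where
  "full_lift D V \<longleftrightarrow> is_lift D V \<and> card (colours V) = card (components D)"

lemma lift_card_le: "is_lift D V \<Longrightarrow> card (colours V) \<le> card (components D)"
  by (metis lift_universal colours_recolour colours_universal card_image_le finite_components)

lemma full_liftE:
  assumes "full_lift D V"
  obtains f where "V = recolour f (universal D)" "inj_on f (components D)" "colours V = f ` components D"
proof -
  from assms obtain f where "V = recolour f (universal D)" unfolding full_lift_def by (metis lift_universal)
  moreover from this have "colours V = f ` components D" by (simp add: colours_universal)
  moreover from this assms have "inj_on f (components D)"
    by (intro eq_card_imp_inj_on) (auto simp: full_lift_def)
  ultimately show ?thesis using that by blast
qed

lemma is_lift_recolour: "is_lift D V \<Longrightarrow> is_lift D (recolour f V)"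
  using crun_recolour[of V "[]" "[]" f] by (simp add: is_lift_def)

lemma components_nonempty: "components D \<noteq> {}"
proof -
  obtain e es where e: "events D = e # es" using closed_events[of D] by (cases "events D") (auto simp: closed_def)
  then obtain i d where "e = Cup i d" using closed_events[of D] by (cases e) (auto simp: closed_def)
  with e is_lift_universal[of D] have "\<exists>c W. universal D = CCup i d c # W"
    by (auto simp: is_lift_def Cons_eq_map_conv map_eq_Cons_conv elim: erase.elims)
  then have "colours (universal D) \<noteq> {}" by auto
  then show ?thesis by (simp add: colours_universal)
qed

lemma mixed_crossing_universal:
  assumes "universal D = X @ CCross i b # Y" "crun X [] = Some s"
  shows "mixed_crossing D (length X) i \<longleftrightarrow> snd (s ! i) \<noteq> snd (s ! Suc i)"
proof -
  from is_lift_universal[of D] assms obtain t where t: "capply (CCross i b) s = Some t"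
    unfolding is_lift_def by (metis crun_append_SomeE crun_ConsE option.inject)
  then have "Suc i < length s" by (auto split: if_splits)
  then have c: "colour_at (universal D) (length X, j) = Some (snd (s ! j))" if "j = i \<or> j = Suc i" for j
    using that assms by (auto simp: colour_at_def)
  have *: "(length X, j) \<in> strand_points D" "component_of D (length X, j) = snd (s ! j)" if "j = i \<or> j = Suc i" for j
    using c[OF that] by (simp_all add: colour_at_universal split: if_splits)
  have "((length X, i), (length X, Suc i)) \<in> same_component D \<longleftrightarrow> component_of D (length X, i) = component_of D (length X, Suc i)"
    unfolding component_of_def using * by (intro eq_equiv_class_iff[OF equiv_same_component, symmetric]) auto
  with * show ?thesis by (simp add: mixed_crossing_def)
qed

section \<open>Weighted sums over set partitions\<close>

abbreviation partitions :: "'a set \<Rightarrow> 'a set set set" where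
  "partitions C \<equiv> {P. partition_on C P}"

lemma partition_block_unique:
  "partition_on C P \<Longrightarrow> A \<in> P \<Longrightarrow> B \<in> P \<Longrightarrow> x \<in> A \<Longrightarrow> x \<in> B \<Longrightarrow> A = B"
  by (auto simp: partition_on_def disjoint_def)

lemma partition_insert_block:
  assumes P: "partition_on C P" and x: "x \<notin> C" and B: "B \<in> insert {} P"
  shows "partition_on (insert x C) (insert (insert x B) (P - {B}))"
proof -
  have Q: "partition_on (C - B) (P - {B})"
  proof (cases "B = {}")
    case True
    then show ?thesis using P by (simp add: partition_on_def)
  next
    case False
    with B have "B \<in> P" by auto
    moreover have "disjnt B (\<Union>(P - {B}))"
      using P \<open>B \<in> P\<close> by (auto simp: partition_on_def disjoint_def disjnt_def)
    ultimately show ?thesis using P partition_on_insert[of B "P - {B}" C] by (simp add: insert_absorb)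
  qed
  have sub: "B \<subseteq> C" using B P by (auto simp: partition_on_def)
  then have eq: "insert x C - insert x B = C - B" using x by auto
  have "disjnt (insert x B) (\<Union>(P - {B}))"
    using partition_onD1[OF Q] x by (auto simp: disjnt_def)
  then show ?thesis using Q sub by (simp add: partition_on_insert eq subset_insertI2)
qed

text \<open>The new element joins an existing block or forms one of its own; admitting
  \<open>B = {}\<close> in the bijection treats both cases alike.\<close>

lemma sum_partitions_insert:
  assumes x: "x \<notin> C" and "finite C"
  shows "(\<Sum>P \<in> partitions (insert x C). F P) =
    (\<Sum>P \<in> partitions C. F (insert {x} P) + (\<Sum>B \<in> P. F (insert (insert x B) (P - {B}))))"
proof -
  define g where "g = (\<lambda>(P, B). insert (insert x B) (P - {B}))"
  define blk where "blk P = \<Union>{A \<in> P. x \<in> A}" for P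
  \<comment> \<open>Inverse of \<open>g\<close>: take \<open>x\<close> out of its block. If the
    block was \<open>{x}\<close>, this leaves the empty set, which must not stay in the
    partition.\<close>
  define h where "h P = (insert (blk P - {x}) (P - {blk P}) - {{}}, blk P - {x})" for P
  have blk: "blk P \<in> P" "x \<in> blk P" if "partition_on (insert x C) P" for P
  proof -
    from that obtain A where A: "A \<in> P" "x \<in> A" by (auto simp: partition_on_def)
    with that have "{A \<in> P. x \<in> A} = {A}" using partition_block_unique by fastforce
    with A show "blk P \<in> P" "x \<in> blk P" by (auto simp: blk_def)
  qed
  have "(\<Sum>P \<in> partitions (insert x C). F P) = (\<Sum>PB \<in> (SIGMA P : partitions C. insert {} P). F (g PB))"
  proof (rule sum.reindex_bij_witness[where i = g and j = h])
    fix P assume "P \<in> partitions (insert x C)"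
    then have P: "partition_on (insert x C) P" by simp
    note b = blk[OF P]
    have ne: "{} \<notin> P" using P by (auto simp: partition_on_def)
    have notin: "blk P - {x} \<notin> P"
    proof
      assume A: "blk P - {x} \<in> P"
      then obtain z where "z \<in> blk P - {x}" using ne by (metis ex_in_conv)
      then have "blk P = blk P - {x}" using partition_block_unique[OF P b(1) A, of z] by blast
      then show False using b(2) by blast
    qed
    then show "g (h P) = P"
      using b ne by (auto simp: g_def h_def insert_absorb)
    have Q: "partition_on (insert x C - blk P) (P - {blk P})"
    proof -
      have "disjnt (blk P) (\<Union>(P - {blk P}))"
        using partition_onD2[OF P] b(1) by (auto simp: pairwise_def)
      with P b(1) show ?thesis using partition_on_insert[of "blk P" "P - {blk P}" "insert x C"] by (simp add: insert_absorb)
    qed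
    have sub: "blk P \<subseteq> insert x C" using P b by (auto simp: partition_on_def)
    have "partition_on C (insert (blk P - {x}) (P - {blk P}) - {{}})"
    proof (cases "blk P - {x} = {}")
      case True
      then have "blk P = {x}" using b by auto
      with Q x ne show ?thesis by auto
    next
      case False
      then have "insert (blk P - {x}) (P - {blk P}) - {{}} = insert (blk P - {x}) (P - {blk P})"
        using ne by auto
      moreover have "disjnt (blk P - {x}) (\<Union>(P - {blk P}))"
        using partition_onD1[OF Q] by (auto simp: disjnt_def)
      moreover have "C - (blk P - {x}) = insert x C - blk P" using b x by auto
      moreover have "blk P - {x} \<subseteq> C" using sub by blast
      ultimately show ?thesis using Q False by (simp only: partition_on_insert) simp
    qed
    then show "h P \<in> (SIGMA P : partitions C. insert {} P)"
      by (auto simp: h_def)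
    show "F (g (h P)) = F P" using \<open>g (h P) = P\<close> by simp
  next
    fix PB assume "PB \<in> (SIGMA P : partitions C. insert {} P)"
    then obtain P B where PB: "PB = (P, B)" "partition_on C P" "B \<in> insert {} P" by auto
    then have g: "partition_on (insert x C) (g PB)"
      using partition_insert_block[OF PB(2) x PB(3)] by (simp add: g_def)
    then show "g PB \<in> partitions (insert x C)" by simp
    have xP: "x \<notin> A" if "A \<in> P" for A using that PB(2) x by (auto simp: partition_on_def)
    have "blk (g PB) = insert x B"
      using partition_block_unique[OF g blk(1)[OF g] _ blk(2)[OF g], of "insert x B"] by (simp add: PB g_def)
    moreover have "insert x B \<notin> P - {B}" using xP by auto
    moreover have "insert x B - {x} = B" using xP PB(3) by auto
    ultimately show "h (g PB) = PB"
      using PB by (auto simp: h_def g_def partition_on_def)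
  qed
  also have "\<dots> = (\<Sum>P \<in> partitions C. \<Sum>B \<in> insert {} P. F (insert (insert x B) (P - {B})))"
    using assms(2) by (subst sum.Sigma) (auto simp: g_def case_prod_unfold finitely_many_partition_on finite_elements)
  also have "\<dots> = (\<Sum>P \<in> partitions C. F (insert {x} P) + (\<Sum>B \<in> P. F (insert (insert x B) (P - {B}))))"
  proof (rule sum.cong)
    fix P assume "P \<in> partitions C"
    then have "{} \<notin> P" "finite P" using assms(2) finite_elements by (auto simp: partition_on_def)
    then show "(\<Sum>B \<in> insert {} P. F (insert (insert x B) (P - {B}))) = F (insert {x} P) + (\<Sum>B \<in> P. F (insert (insert x B) (P - {B})))"
      by simp
  qed simp
  finally show ?thesis .
qed

section \<open>The weights and the weighted sum\<close>

context
  fixes y e h :: "'r :: comm_ring_1"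
begin

text \<open>Building a partition element by element, \<open>n - k\<close> elements join a block,
  each with factor \<open>y\<close>, and a block opened when \<open>j\<close> blocks are present has
  factor \<open>e - j y\<close>. This factor is forced by the wish that the \<open>j\<close> ways of
  joining and the opening together give \<open>e\<close>.\<close>

definition weight :: "nat \<Rightarrow> nat \<Rightarrow> 'r" where
  "weight n k = y ^ (n - k) * (\<Prod>j = 1..<k. e - of_nat j * y)"

definition partition_sum :: "'a set \<Rightarrow> ('a set \<Rightarrow> 'r) \<Rightarrow> 'r" where
  "partition_sum C \<phi> = (\<Sum>P \<in> partitions C. weight (card C) (card P) * (h ^ (card P - 1) * (\<Prod>B \<in> P. \<phi> B)))"

lemma card_partition_le:
  assumes "finite C" "partition_on C P" shows "card P \<le> card C" "finite P"
proof -
  show "finite P" using assms finite_elements by blast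
  have "finite B" if "B \<in> P" for B
    using that assms by (metis Union_upper finite_subset partition_onD1)
  then have "card C = (\<Sum>B \<in> P. card B)" using product_partition[OF assms(2)] by simp
  moreover have "(\<Sum>B \<in> P. 1) \<le> (\<Sum>B \<in> P. card B)"
  proof (rule sum_mono)
    fix B assume B: "B \<in> P"
    with assms(2) have "B \<noteq> {}" by (auto simp: partition_on_def)
    with \<open>B \<in> P \<Longrightarrow> finite B\<close> B show "1 \<le> card B" by (simp add: Suc_leI card_gt_0_iff)
  qed
  ultimately show "card P \<le> card C" by simp
qed

lemma card_insert_block:
  assumes "finite C" "x \<notin> C" "partition_on C P"
  shows "card (insert {x} P) = Suc (card P)" "B \<in> P \<Longrightarrow> card (insert (insert x B) (P - {B})) = card P"
proof -
  have fin: "finite P" by (rule card_partition_le[OF assms(1,3)])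
  have x: "x \<notin> A" if "A \<in> P" for A using that assms(2,3) by (auto simp: partition_on_def)
  then have "{x} \<notin> P" by auto
  with fin show "card (insert {x} P) = Suc (card P)" by simp
  assume "B \<in> P"
  moreover have "insert x B \<notin> P - {B}" using x by auto
  ultimately show "card (insert (insert x B) (P - {B})) = card P"
    using fin by (simp add: card.insert_remove card_Suc_Diff1 del: card_Diff_insert)
qed

lemma weight_Suc: "k \<le> n \<Longrightarrow> weight (Suc n) k = y * weight n k"
  by (simp add: weight_def Suc_diff_le mult.assoc)

lemma weight_Suc_Suc: "1 \<le> k \<Longrightarrow> weight (Suc n) (Suc k) = weight n k * (e - of_nat k * y)"
  by (simp add: weight_def mult.assoc prod.atLeastLessThan_Suc)

text \<open>Each further element multiplies the sum by \<open>k y + (e - k y) = e\<close>, whatever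
  the number \<open>k\<close> of blocks; the first element contributes 1, hence the
  exponent.\<close>

lemma sum_weight:
  assumes "finite C" "C \<noteq> {}"
  shows "(\<Sum>P \<in> partitions C. weight (card C) (card P)) = e ^ (card C - 1)"
  using assms
proof (induction rule: finite_ne_induct)
  case (singleton x)
  have "P = {{x}}" if P: "partition_on {x} P" for P
  proof -
    have "A = {x}" if "A \<in> P" for A
    proof -
      have "A \<subseteq> {x}" "A \<noteq> {}" using that P by (auto simp: partition_on_def)
      then show ?thesis by blast
    qed
    moreover have "P \<noteq> {}" using P by (auto simp: partition_on_def)
    ultimately show ?thesis by blast
  qed
  then have "partitions {x} = {{{x}}}"
    using partition_on_space[of "{x}"] by blast
  then show ?case by (simp add: weight_def)
next
  case (insert x C)
  have "card (insert x C) = Suc (card C)" using insert.hyps by simp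
  then have "(\<Sum>P \<in> partitions (insert x C). weight (card (insert x C)) (card P)) =
    (\<Sum>P \<in> partitions C. weight (Suc (card C)) (card (insert {x} P)) + (\<Sum>B \<in> P. weight (Suc (card C)) (card (insert (insert x B) (P - {B})))))"
    by (simp only: sum_partitions_insert[OF insert.hyps(3,1), of "\<lambda>P. weight (Suc (card C)) (card P)"])
  also have "\<dots> = (\<Sum>P \<in> partitions C. e * weight (card C) (card P))"
  proof (rule sum.cong)
    fix P assume "P \<in> partitions C"
    then have P: "partition_on C P" by simp
    note c = card_partition_le[OF insert.hyps(1) P] card_insert_block[OF insert.hyps(1) insert.hyps(3) P]
    have "P \<noteq> {}" using P insert.hyps(2) by (auto simp: partition_on_def)
    with c(2) have k: "1 \<le> card P" by (simp add: Suc_leI card_gt_0_iff)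
    have "(\<Sum>B \<in> P. weight (Suc (card C)) (card (insert (insert x B) (P - {B})))) = (\<Sum>B \<in> P. y * weight (card C) (card P))"
      by (rule sum.cong) (simp_all add: c(4) weight_Suc[OF c(1)])
    then show "weight (Suc (card C)) (card (insert {x} P)) + (\<Sum>B \<in> P. weight (Suc (card C)) (card (insert (insert x B) (P - {B})))) = e * weight (card C) (card P)"
      by (simp add: c(3) weight_Suc_Suc[OF k] algebra_simps)
  qed simp
  also have "\<dots> = e * e ^ (card C - 1)"
    unfolding insert.IH[symmetric] by (rule sum_distrib_left[symmetric])
  also have "\<dots> = e ^ (card (insert x C) - 1)"
  proof -
    obtain m where "card C = Suc m" using insert.hyps(1,2) by (metis card_eq_0_iff not0_implies_Suc)
    then show ?thesis using insert.hyps by simp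
  qed
  finally show ?case .
qed

lemma partition_sum_cong:
  assumes "\<And>A. A \<subseteq> C \<Longrightarrow> A \<noteq> {} \<Longrightarrow> \<phi> A = \<psi> A"
  shows "partition_sum C \<phi> = partition_sum C \<psi>"
  unfolding partition_sum_def
proof (intro sum.cong refl arg_cong2[where f = "(*)"] prod.cong)
  fix P A assume "P \<in> partitions C" "A \<in> P"
  then show "\<phi> A = \<psi> A" by (intro assms) (auto simp: partition_on_def)
qed

lemma partition_sum_image:
  assumes f: "inj_on f C"
  shows "partition_sum (f ` C) \<phi> = partition_sum C (\<lambda>A. \<phi> (f ` A))"
proof -
  define g where "g = inv_into C f"
  have gf: "g ` f ` A = A" if "A \<subseteq> C" for A
    using f that by (force simp: g_def image_image inv_into_f_f)
  have fg: "f ` g ` A = A" if "A \<subseteq> f ` C" for A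
    using that by (force simp: g_def image_image f_inv_into_f)
  have g: "inj_on g (f ` C)" by (simp add: g_def inj_on_inv_into)
  have P: "partition_on (k ` C) ((`) k ` P)" if "partition_on C P" "inj_on k C" for k :: "'x \<Rightarrow> 'y" and C P
  proof -
    have "{} \<notin> (`) k ` P" using that(1) by (auto simp: partition_on_def)
    then show ?thesis using partition_on_inj_image[OF that] by simp
  qed
  show ?thesis unfolding partition_sum_def
  proof (rule sum.reindex_bij_witness[where i = "(`) ((`) f)" and j = "(`) ((`) g)"])
    fix P assume "P \<in> partitions C"
    then have p: "partition_on C P" by simp
    then have sub: "A \<subseteq> C" if "A \<in> P" for A using that by (auto simp: partition_on_def)
    show "(`) f ` P \<in> partitions (f ` C)" using P[OF p f] by simp
    show "(`) g ` (`) f ` P = P" using sub gf by (force simp: image_image)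
  next
    fix P assume "P \<in> partitions (f ` C)"
    then have p: "partition_on (f ` C) P" by simp
    then have sub: "A \<subseteq> f ` C" if "A \<in> P" for A using that by (auto simp: partition_on_def)
    show "(`) f ` (`) g ` P = P" using sub fg by (force simp: image_image)
    show "(`) g ` P \<in> partitions C" using P[OF p g] gf[of C] by simp
    have inj: "inj_on ((`) g) P" using sub fg by (metis inj_onI)
    show "weight (card C) (card ((`) g ` P)) * (h ^ (card ((`) g ` P) - 1) * (\<Prod>B \<in> (`) g ` P. \<phi> (f ` B))) =
      weight (card (f ` C)) (card P) * (h ^ (card P - 1) * (\<Prod>B \<in> P. \<phi> B))"
      using sub fg by (simp add: card_image[OF inj] card_image[OF f] prod.reindex[OF inj])
  qed
qed

text \<open>Exactly one block contains \<open>c\<close>, so every product picks up the factor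
  \<open>a\<close> once.\<close>

lemma partition_sum_curl:
  assumes "finite C" "c \<in> C" and \<psi>: "\<And>A. A \<subseteq> C \<Longrightarrow> A \<noteq> {} \<Longrightarrow> \<psi> A = (if c \<in> A then a * \<phi> A else \<phi> A)"
  shows "partition_sum C \<psi> = a * partition_sum C \<phi>"
proof -
  have "(\<Prod>B \<in> P. \<psi> B) = a * (\<Prod>B \<in> P. \<phi> B)" if P: "partition_on C P" for P
  proof -
    from assms(2) P obtain A where A: "A \<in> P" "c \<in> A" by (auto simp: partition_on_def)
    have fin: "finite P" using P assms(1) finite_elements by blast
    have sub: "B \<subseteq> C \<and> B \<noteq> {}" if "B \<in> P" for B using that P by (auto simp: partition_on_def)
    have "(\<Prod>B \<in> P - {A}. \<psi> B) = (\<Prod>B \<in> P - {A}. \<phi> B)"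
      using sub partition_block_unique[OF P A(1) _ A(2)] by (intro prod.cong refl) (auto simp: \<psi>)
    moreover have "\<psi> A = a * \<phi> A" using A sub \<psi> by simp
    ultimately show ?thesis using fin A by (simp add: prod.remove[OF fin A(1)] mult.assoc)
  qed
  then show ?thesis by (simp add: partition_sum_def sum_distrib_left mult.left_commute[of _ a])
qed

text \<open>Here \<open>b\<close> and \<open>c\<close> are the two components at the crossing, and
  smoothing merges \<open>c\<close> into \<open>b\<close>. Partitions separating them cancel. The
  others are the partitions of \<open>C\<close> with \<open>c\<close> put into the block of
  \<open>b\<close>: as many blocks, one element more, which gives the factor
  \<open>y\<close>.\<close>

lemma partition_sum_skein:
  assumes C: "finite C" "c \<notin> C" "b \<in> C"
    and eq: "\<And>A. A \<subseteq> insert c C \<Longrightarrow> A \<noteq> {} \<Longrightarrow> \<not> (b \<in> A \<and> c \<in> A) \<Longrightarrow> \<phi> A = \<psi> A"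
    and zero: "\<And>A. A \<subseteq> C \<Longrightarrow> A \<noteq> {} \<Longrightarrow> b \<notin> A \<Longrightarrow> \<chi> A = \<phi> A"
    and skein: "\<And>A. A \<subseteq> C \<Longrightarrow> b \<in> A \<Longrightarrow> \<phi> (insert c A) - \<psi> (insert c A) = w * \<chi> A"
  shows "partition_sum (insert c C) \<phi> - partition_sum (insert c C) \<psi> = y * w * partition_sum C \<chi>"
proof -
  let ?F = "\<lambda>\<phi> P. weight (card (insert c C)) (card P) * (h ^ (card P - 1) * (\<Prod>B \<in> P. \<phi> B))"
  have "partition_sum (insert c C) \<phi> - partition_sum (insert c C) \<psi> =
     (\<Sum>P \<in> partitions C. (?F \<phi> (insert {c} P) - ?F \<psi> (insert {c} P)) +
       (\<Sum>B \<in> P. ?F \<phi> (insert (insert c B) (P - {B})) - ?F \<psi> (insert (insert c B) (P - {B}))))"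
    unfolding partition_sum_def sum_partitions_insert[OF C(2,1)]
    by (simp only: sum.distrib sum_subtractf) (simp only: algebra_simps)
  also have "\<dots> = (\<Sum>P \<in> partitions C. y * w * (weight (card C) (card P) * (h ^ (card P - 1) * (\<Prod>B \<in> P. \<chi> B))))"
  proof (rule sum.cong)
    fix P assume "P \<in> partitions C"
    then have P: "partition_on C P" by simp
    have sub: "B \<subseteq> C" "B \<noteq> {}" "c \<notin> B" if "B \<in> P" for B using that P C(2) by (auto simp: partition_on_def)
    note card = card_partition_le[OF C(1) P] card_insert_block[OF C(1,2) P]
    from C(3) P obtain A where A: "A \<in> P" "b \<in> A" by (auto simp: partition_on_def)
    have bA: "b \<notin> B" if "B \<in> P" "B \<noteq> A" for B using that partition_block_unique[OF P A(1) _ A(2)] by blast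
    have 1: "?F \<phi> (insert {c} P) = ?F \<psi> (insert {c} P)"
    proof -
      have "(\<Prod>B \<in> insert {c} P. \<phi> B) = (\<Prod>B \<in> insert {c} P. \<psi> B)"
        using sub C by (intro prod.cong refl eq) auto
      then show ?thesis by simp
    qed
    have 2: "?F \<phi> (insert (insert c B) (P - {B})) = ?F \<psi> (insert (insert c B) (P - {B}))" if "B \<in> P - {A}" for B
    proof -
      have "(\<Prod>B \<in> insert (insert c B) (P - {B}). \<phi> B) = (\<Prod>B \<in> insert (insert c B) (P - {B}). \<psi> B)"
      proof (intro prod.cong refl eq)
        fix D assume D: "D \<in> insert (insert c B) (P - {B})"
        show "D \<subseteq> insert c C" "D \<noteq> {}" using D that sub by blast+
        show "\<not> (b \<in> D \<and> c \<in> D)" using D that sub(3) bA C by auto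
      qed
      then show ?thesis by simp
    qed
    have "(\<Sum>B \<in> P. ?F \<phi> (insert (insert c B) (P - {B})) - ?F \<psi> (insert (insert c B) (P - {B}))) =
       ?F \<phi> (insert (insert c A) (P - {A})) - ?F \<psi> (insert (insert c A) (P - {A}))"
      unfolding sum.remove[OF card(2) A(1)] using 2 by simp
    also have "\<dots> = y * w * (weight (card C) (card P) * (h ^ (card P - 1) * (\<Prod>B \<in> P. \<chi> B)))"
    proof -
      have notin: "insert c A \<notin> P - {A}" using sub(3) by auto
      have "(\<Prod>B \<in> P - {A}. \<phi> B) = (\<Prod>B \<in> P - {A}. \<chi> B)" "(\<Prod>B \<in> P - {A}. \<psi> B) = (\<Prod>B \<in> P - {A}. \<chi> B)"
        using sub bA zero eq by (intro prod.cong refl; simp add: subset_insertI2)+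
      then have prods: "(\<Prod>B \<in> insert (insert c A) (P - {A}). \<phi> B) = \<phi> (insert c A) * (\<Prod>B \<in> P - {A}. \<chi> B)"
        "(\<Prod>B \<in> insert (insert c A) (P - {A}). \<psi> B) = \<psi> (insert c A) * (\<Prod>B \<in> P - {A}. \<chi> B)"
        using notin card(2) by simp_all
      have w: "weight (card (insert c C)) (card P) = y * weight (card C) (card P)"
        using C by (simp add: weight_Suc[OF card(1)])
      have *: "\<phi> (insert c A) - \<psi> (insert c A) = w * \<chi> A"
        using skein A sub by blast
      have "?F \<phi> (insert (insert c A) (P - {A})) - ?F \<psi> (insert (insert c A) (P - {A})) =
         y * weight (card C) (card P) * (h ^ (card P - 1) * ((\<phi> (insert c A) - \<psi> (insert c A)) * (\<Prod>B \<in> P - {A}. \<chi> B)))"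
        unfolding w prods card(4)[OF A(1)] by (simp add: algebra_simps)
      also have "\<dots> = y * w * (weight (card C) (card P) * (h ^ (card P - 1) * (\<Prod>B \<in> P. \<chi> B)))"
        unfolding * prod.remove[OF card(2) A(1)] by (simp add: algebra_simps)
      finally show ?thesis .
    qed
    finally show "(?F \<phi> (insert {c} P) - ?F \<psi> (insert {c} P)) +
       (\<Sum>B \<in> P. ?F \<phi> (insert (insert c B) (P - {B})) - ?F \<psi> (insert (insert c B) (P - {B}))) =
       y * w * (weight (card C) (card P) * (h ^ (card P - 1) * (\<Prod>B \<in> P. \<chi> B)))"
      using 1 by simp
  qed simp
  also have "\<dots> = y * w * partition_sum C \<chi>"
    by (simp add: partition_sum_def sum_distrib_left)
  finally show ?thesis .
qed

text \<open>The powers of \<open>h\<close> add up to \<open>(k - 1) + (n - k) = n - 1\<close> for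
  every partition of \<open>n\<close> elements into \<open>k\<close> blocks. So all summands carry
  the same product, and only the weights are summed.\<close>

lemma partition_sum_multiplicative:
  assumes "finite C" "C \<noteq> {}" and \<phi>: "\<And>A. A \<subseteq> C \<Longrightarrow> A \<noteq> {} \<Longrightarrow> \<phi> A = h ^ (card A - 1) * (\<Prod>c \<in> A. \<rho> c)"
  shows "partition_sum C \<phi> = e ^ (card C - 1) * \<phi> C"
proof -
  have "h ^ (card P - 1) * (\<Prod>B \<in> P. \<phi> B) = \<phi> C" if P: "partition_on C P" for P
  proof -
    have fin: "finite P" using P assms(1) finite_elements by blast
    have sub: "B \<subseteq> C \<and> B \<noteq> {} \<and> finite B" if "B \<in> P" for B
      using that P assms(1) by (metis Union_upper finite_subset partition_onD1 partition_onD3)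
    have "(\<Prod>B \<in> P. \<phi> B) = (\<Prod>B \<in> P. h ^ (card B - 1)) * (\<Prod>B \<in> P. \<Prod>c \<in> B. \<rho> c)"
      using sub by (simp add: \<phi> prod.distrib)
    also have "(\<Prod>B \<in> P. \<Prod>c \<in> B. \<rho> c) = (\<Prod>c \<in> C. \<rho> c)"
      unfolding partition_onD1[OF P] using sub P by (subst prod.Union_disjoint) (auto simp: partition_on_def disjoint_def)
    also have "(\<Prod>B \<in> P. h ^ (card B - 1)) = h ^ (\<Sum>B \<in> P. card B - 1)"
      by (simp add: power_sum)
    finally have *: "h ^ (card P - 1) * (\<Prod>B \<in> P. \<phi> B) = h ^ (card P - 1 + (\<Sum>B \<in> P. card B - 1)) * (\<Prod>c \<in> C. \<rho> c)"
      by (simp add: power_add mult.assoc)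
    have "(\<Sum>B \<in> P. card B) = (\<Sum>B \<in> P. card B - 1) + (\<Sum>B \<in> P. 1)"
      unfolding sum.distrib[symmetric] using sub by (intro sum.cong) (auto simp: card_gt_0_iff Suc_leI)
    then have "card C = (\<Sum>B \<in> P. card B - 1) + card P"
      using product_partition[OF P] sub by simp
    moreover have "P \<noteq> {}" using P assms(2) by (auto simp: partition_on_def)
    then have "card P > 0" using fin by (simp add: card_gt_0_iff)
    ultimately have "card P - 1 + (\<Sum>B \<in> P. card B - 1) = card C - 1" by linarith
    with * show ?thesis using \<phi>[of C] assms(2) by simp
  qed
  then have "partition_sum C \<phi> = (\<Sum>P \<in> partitions C. weight (card C) (card P) * \<phi> C)"
    by (simp add: partition_sum_def)
  also have "\<dots> = e ^ (card C - 1) * \<phi> C"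
    using sum_weight[OF assms(1,2)] by (simp flip: sum_distrib_right)
  finally show ?thesis .
qed

end

section \<open>Moves of coloured words\<close>

lemma apply_event_length:
  "apply_event e s = Some t \<Longrightarrow> pos e + strands_in e \<le> length s \<and> length t + strands_in e = length s + strands_out e"
  by (cases e) (auto split: if_splits)

lemma exchange_event:
  assumes "apply_event e x = Some x'"
  shows "[e, shift (length x') w] \<leadsto> [shift (length x) w, e]" "[shift (length x) w, e] \<leadsto> [e, shift (length x') w]"
proof -
  define f where "f = shift (length x - strands_in e) w"
  have "pos e \<le> pos f" "shift (strands_out e) f = shift (length x') w" "shift (strands_in e) f = shift (length x) w"
    using apply_event_length[OF assms] by (auto simp: f_def intro!: arg_cong2[of _ _ _ _ shift])
  with red_exchange[of e f]
  show "[e, shift (length x') w] \<leadsto> [shift (length x) w, e]" "[shift (length x) w, e] \<leadsto> [e, shift (length x') w]"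
    by simp_all
qed

definition cshift :: "nat \<Rightarrow> 'c cevent \<Rightarrow> 'c cevent" where
  "cshift n e = (case e of CCup i d c \<Rightarrow> CCup (i + n) d c | CCap i \<Rightarrow> CCap (i + n) | CCross i b \<Rightarrow> CCross (i + n) b)"

lemma cshift_simps [simp]:
  "cshift n (CCup i d c) = CCup (i + n) d c" "cshift n (CCap i) = CCap (i + n)"
  "cshift n (CCross i b) = CCross (i + n) b"
  by (simp_all add: cshift_def)

lemma erase_cshift [simp]: "erase (cshift n e) = shift n (erase e)"
  by (cases e) auto

lemma event_colours_cshift [simp]: "event_colours (cshift n e) = event_colours e"
  by (cases e) auto

lemma erase_shift_E:
  assumes "erase f = shift n g" obtains f' where "f = cshift n f'" "erase f' = g"
proof (cases g)
  case (Cup i d)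
  with assms obtain c where "f = CCup (i + n) d c" by (cases f) auto
  with Cup that[of "CCup i d c"] show ?thesis by simp
next
  case (Cap i)
  with assms have "f = CCap (i + n)" by (cases f) auto
  with Cap that[of "CCap i"] show ?thesis by simp
next
  case (Cross i b)
  with assms have "f = CCross (i + n) b" by (cases f) auto
  with Cross that[of "CCross i b"] show ?thesis by simp
qed

lemma capply_cshift:
  "length c = n \<Longrightarrow> capply (cshift n e) (c @ s) = map_option ((@) c) (capply e s)"
  by (cases e) (auto simp: nth_append)

lemma sub1_cshift:
  "length c = n \<Longrightarrow> sub1 T (cshift n e) (c @ s) = map (cshift (length (keep T c))) (sub1 T e s)"
  by (cases e) (auto simp: nth_append add.commute)

lemma capply_prefix:
  "pos (erase e) + strands_in (erase e) \<le> length c \<Longrightarrow> capply e (c @ b) = map_option (\<lambda>x. x @ b) (capply e c)"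
  by (cases e) (auto simp: nth_append)

lemma sub1_prefix:
  "pos (erase e) + strands_in (erase e) \<le> length c \<Longrightarrow> sub1 T e (c @ b) = sub1 T e c"
  by (cases e) (auto simp: nth_append)

lemma capply_Suc [simp]:
  assumes "length a = i"
  shows "capply (CCup (Suc i) d c) (a @ x # b) = Some (a @ x # (d, c) # (opposite d, c) # b)"
    "capply (CCross (Suc i) r) (a @ x # y # z # b) = Some (a @ x # z # y # b)"
    "capply (CCap (Suc i)) (a @ x # y # z # b) = (if fst y \<noteq> fst z \<and> snd y = snd z then Some (a @ x # b) else None)"
  using assms capply_CCup_append[of "a @ [x]" "Suc i" d c b] capply_CCross_append[of "a @ [x]" "Suc i" r y z b]
    capply_CCap_append[of "a @ [x]" "Suc i" y z b] by (simp_all del: capply.simps)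

lemma sub1_Suc [simp]:
  assumes "length a = i"
  shows "sub1 T (CCup (Suc i) d c) (a @ x # b) = (if T c then [CCup (length (keep T (a @ [x]))) d c] else [])"
    "sub1 T (CCross (Suc i) r) (a @ x # y # z # b) = (if T (snd y) \<and> T (snd z) then [CCross (length (keep T (a @ [x]))) r] else [])"
    "sub1 T (CCap (Suc i)) (a @ x # y # b) = (if T (snd y) then [CCap (length (keep T (a @ [x])))] else [])"
  using assms sub1_append(1)[of "a @ [x]" "Suc i" T d c b] sub1_append(3)[of "a @ [x]" "Suc i" T r y z b]
    sub1_append(2)[of "a @ [x]" "Suc i" T y b] by (simp_all del: sub1.simps)

text \<open>Colours are compared together with those of \<open>s\<close> because a removed zigzag
  takes a minimum with it, whose colour survives on the strand entering from \<open>s\<close>.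
  Asking for isotopy under every choice \<open>T\<close> of colours covers all sublinks at
  once.\<close>

definition same_sublinks :: "'c clevel \<Rightarrow> 'c cevent list \<Rightarrow> 'c cevent list \<Rightarrow> bool" where
  "same_sublinks s W V \<longleftrightarrow> (\<exists>t. crun W s = Some t \<and> crun V s = Some t) \<and>
     colours V \<union> snd ` set s = colours W \<union> snd ` set s \<and>
     (\<forall>T. word_isotopic (map fst (keep T s)) (map erase (sub T W s)) (map erase (sub T V s)))"

lemma same_sublinks_sym: "same_sublinks s W V \<Longrightarrow> same_sublinks s V W"
  unfolding same_sublinks_def by (metis word_isotopic_sym)

lemma same_sublinksI:
  assumes "crun W s = Some t" "crun V s = Some t" "colours V \<union> snd ` set s = colours W \<union> snd ` set s"
    "\<And>T. map erase (sub T W s) \<leadsto> map erase (sub T V s)"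
  shows "same_sublinks s W V"
proof -
  have "word_isotopic (map fst (keep T s)) (map erase (sub T W s)) (map erase (sub T V s))" for T
    using crun_erase[OF crun_sub[OF assms(1), of T]] reducesD(2)[OF assms(4)] by blast
  then show ?thesis unfolding same_sublinks_def using assms(1-3) by blast
qed

lemma erase_eq_simps:
  "erase e = Cup i d \<longleftrightarrow> (\<exists>c. e = CCup i d c)" "erase e = Cap i \<longleftrightarrow> e = CCap i" "erase e = Cross i b \<longleftrightarrow> e = CCross i b"
  by (cases e; auto)+

text \<open>Deleting strands leaves at most one event on each side, so the move becomes an exchange
  at new positions or no move at all.\<close>

lemma same_sublinks_exchange:
  assumes "capply e c = Some c'" "capply f b = Some b'"
  shows "same_sublinks (c @ b) [e, cshift (length c') f] [cshift (length c) f, e]"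
proof (rule same_sublinksI)
  have len: "pos (erase e) + strands_in (erase e) \<le> length c"
    using apply_event_length[OF capply_erase[OF assms(1)]] by simp
  show r1: "crun [e, cshift (length c') f] (c @ b) = Some (c' @ b')"
    using assms capply_prefix[OF len] by (simp add: capply_cshift)
  show r2: "crun [cshift (length c) f, e] (c @ b) = Some (c' @ b')"
    using assms capply_prefix[OF len] by (simp add: capply_cshift)
  show "colours [cshift (length c) f, e] \<union> snd ` set (c @ b) = colours [e, cshift (length c') f] \<union> snd ` set (c @ b)"
    by auto
  fix T
  let ?u = "sub1 T e c" and ?w = "sub1 T f b"
  have s1: "sub T [e, cshift (length c') f] (c @ b) = ?u @ map (cshift (length (keep T c'))) ?w"
    using assms capply_prefix[OF len] by (simp add: sub1_prefix[OF len] sub1_cshift)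
  have s2: "sub T [cshift (length c) f, e] (c @ b) = map (cshift (length (keep T c))) ?w @ ?u"
    using assms by (simp add: sub1_prefix[OF len] sub1_cshift capply_cshift)
  have u: "crun ?u (keep T c) = Some (keep T c')" using assms(1) by (rule crun_sub1)
  have "?u = [] \<or> (\<exists>e'. ?u = [e'])" by (cases e) auto
  moreover have "?w = [] \<or> (\<exists>f'. ?w = [f'])" by (cases f) auto
  ultimately show "map erase (sub T [e, cshift (length c') f] (c @ b)) \<leadsto> map erase (sub T [cshift (length c) f, e] (c @ b))"
  proof (elim disjE exE)
    fix e' f' assume e': "?u = [e']" and f': "?w = [f']"
    have "capply e' (keep T c) = Some (keep T c')"
      using u e' by (simp split: option.splits)
    from exchange_event(1)[OF capply_erase[OF this], of "erase f'"] show ?thesis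
      unfolding s1 s2 e' f' by simp
  qed (use u in \<open>auto simp: s1 s2 simp del: sub.simps\<close>)
qed

lemma same_sublinks_zigzag_right:
  "same_sublinks (a @ (opposite d, c) # b) [CCup (Suc (length a)) d c, CCap (length a)] []"
  by (rule same_sublinksI[where t = "a @ (opposite d, c) # b"])
    (auto simp: red_zigzag_right simp del: capply.simps sub1.simps)

lemma same_sublinks_zigzag_left:
  "same_sublinks (a @ (d, c) # b) [CCup (length a) d c, CCap (Suc (length a))] []"
  by (rule same_sublinksI[where t = "a @ (d, c) # b"])
    (auto simp: red_zigzag_left simp del: capply.simps sub1.simps)

lemma same_sublinks_through_cup:
  "same_sublinks (a @ p # b) [CCup (length a) d c, CCross (Suc (length a)) r] [CCup (Suc (length a)) d c, CCross (length a) (\<not> r)]"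
  by (rule same_sublinksI[where t = "a @ (d, c) # p # (opposite d, c) # b"])
    (auto simp: red_through_cup simp del: capply.simps sub1.simps)

lemma same_sublinks_through_cap:
  assumes "fst p \<noteq> fst q" "snd p = snd q"
  shows "same_sublinks (a @ p # x # q # b) [CCross (length a) r, CCap (Suc (length a))] [CCross (Suc (length a)) (\<not> r), CCap (length a)]"
  by (rule same_sublinksI[where t = "a @ x # b"])
    (use assms in \<open>auto simp: red_through_cap simp del: capply.simps sub1.simps\<close>)

lemma same_sublinks_reidemeister_2:
  "same_sublinks (a @ p # q # b) [CCross (length a) r, CCross (length a) (\<not> r)] []"
  by (rule same_sublinksI[where t = "a @ p # q # b"])
    (auto intro: red_reidemeister_2 simp del: capply.simps sub1.simps)

lemma same_sublinks_reidemeister_3: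
  assumes "b2 = b1 \<or> b2 = b3"
  shows "same_sublinks (a @ p # q # r # b) [CCross (length a) b1, CCross (Suc (length a)) b2, CCross (length a) b3]
     [CCross (Suc (length a)) b3, CCross (length a) b2, CCross (Suc (length a)) b1]"
proof (rule same_sublinksI[where t = "a @ r # q # p # b"])
  fix T
  show "map erase (sub T [CCross (length a) b1, CCross (Suc (length a)) b2, CCross (length a) b3] (a @ p # q # r # b)) \<leadsto>
    map erase (sub T [CCross (Suc (length a)) b3, CCross (length a) b2, CCross (Suc (length a)) b1] (a @ p # q # r # b))"
    using red_reidemeister_3(1)[OF assms]
    by (cases "T (snd p)"; cases "T (snd q)"; cases "T (snd r)") (simp_all del: capply.simps sub1.simps)
qed (simp_all del: capply.simps)

lemma map_erase_Cons:
  "map erase W = e # es \<longleftrightarrow> (\<exists>f V. W = f # V \<and> erase f = e \<and> map erase V = es)"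
  by (cases W) auto

lemma coloured_move:
  assumes m: "word_move a b" and W: "map erase W = a" "crun W s = Some t"
  shows "\<exists>V. map erase V = b \<and> same_sublinks s W V"
  using m unfolding word_move_def
proof (elim disjE)
  assume "planar_move a b"
  then show ?thesis
  proof cases
    case (exchange e f f')
    from exchange_cases[OF exchange(3,4)] obtain g where g: "pos e \<le> pos g" "f = shift (strands_out e) g" "f' = shift (strands_in e) g" .
    from W(1) exchange(1) obtain e1 f1 where ef: "W = [e1, f1]" "erase e1 = e" "erase f1 = f"
      by (auto simp: map_erase_Cons)
    obtain g' where g': "g = shift (pos e) g'" using g(1) by (metis shift_pos_obtain)
    from ef(3) obtain f0 where f0: "f1 = cshift (pos e + strands_out e) f0" "erase f0 = g'"
      unfolding g(2) g' by (auto elim: erase_shift_E)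
    from W(2) ef(1) obtain r where r: "capply e1 s = Some r" "capply f1 r = Some t"
      by (auto split: option.splits)
    note l = apply_event_length[OF capply_erase[OF r(1)], unfolded ef(2) length_map]
    define c where "c = take (pos e + strands_in e) s"
    define d where "d = drop (pos e + strands_in e) s"
    have s: "s = c @ d" "length c = pos e + strands_in e" using l by (auto simp: c_def d_def)
    from r(1) capply_prefix[of e1 c d] s ef(2) obtain c' where c': "capply e1 c = Some c'" "r = c' @ d" by auto
    have lc': "length c' = pos e + strands_out e"
      using apply_event_length[OF capply_erase[OF c'(1)]] s(2) ef(2) by simp
    from r(2) obtain d' where "capply f0 d = Some d'"
      unfolding f0 c'(2) using capply_cshift[OF lc'] by auto
    from same_sublinks_exchange[OF c'(1) this] have "same_sublinks s W [cshift (length c) f0, e1]"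
      using ef f0 lc' s by simp
    moreover have "map erase [cshift (length c) f0, e1] = b"
      using exchange(2) g(3) g' f0(2) s(2) ef(2) by simp
    ultimately show ?thesis by blast
  next
    case (zigzag_right i d)
    with W(1) obtain c where "W = [CCup (Suc i) d c, CCap i]" by (auto simp: map_erase_Cons erase_eq_simps)
    moreover from this W(2) have "i < length s" by (auto split: if_splits)
    then obtain x p y where s: "s = x @ p # y" "length x = i" by (rule split1)
    ultimately have "p = (opposite d, c)" using W(2)
      by (cases p) (auto simp: opposite_eq_iff simp del: capply.simps split: if_splits)
    with same_sublinks_zigzag_right[of x d c y] s \<open>W = _\<close> zigzag_right show ?thesis by auto
  next
    case (zigzag_left i d)
    with W(1) obtain c where "W = [CCup i d c, CCap (Suc i)]" by (auto simp: map_erase_Cons erase_eq_simps)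
    moreover from this W(2) have "i < length s" by (auto split: if_splits)
    then obtain x p y where s: "s = x @ p # y" "length x = i" by (rule split1)
    ultimately have "p = (d, c)" using W(2)
      by (cases p) (auto simp: opposite_eq_iff simp del: capply.simps split: if_splits)
    with same_sublinks_zigzag_left[of x d c y] s \<open>W = _\<close> zigzag_left show ?thesis by auto
  next
    case (through_cup i d r)
    with W(1) obtain c where "W = [CCup i d c, CCross (Suc i) r]" by (auto simp: map_erase_Cons erase_eq_simps)
    moreover from this W(2) have "i < length s" by (auto split: if_splits)
    then obtain x p y where s: "s = x @ p # y" "length x = i" by (rule split1)
    ultimately show ?thesis using same_sublinks_through_cup[of x p y d c r] through_cup
      by (intro exI[of _ "[CCup (Suc i) d c, CCross i (\<not> r)]"]) auto
  next
    case (through_cap i r)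
    with W(1) have w: "W = [CCross i r, CCap (Suc i)]" by (auto simp: map_erase_Cons erase_eq_simps)
    moreover from this W(2) have "Suc (Suc i) < length s" by (auto split: if_splits)
    then obtain x p z q y where s: "s = x @ p # z # q # y" "length x = i" by (rule split3)
    moreover from W(2) have "fst p \<noteq> fst q" "snd p = snd q"
      unfolding w using s by (auto simp del: capply.simps split: if_splits)
    ultimately show ?thesis using same_sublinks_through_cap[of p q x z y r] through_cap
      by (intro exI[of _ "[CCross (Suc i) (\<not> r), CCap i]"]) auto
  qed
next
  assume "reidemeister_2 a b"
  then show ?thesis
  proof cases
    case (1 i r)
    with W(1) have w: "W = [CCross i r, CCross i (\<not> r)]" by (auto simp: map_erase_Cons erase_eq_simps)
    moreover from this W(2) have "Suc i < length s" by (auto split: if_splits)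
    then obtain x p q y where s: "s = x @ p # q # y" "length x = i" by (rule split2)
    ultimately show ?thesis using same_sublinks_reidemeister_2[of x p q y r] 1 by auto
  qed
next
  assume "reidemeister_3 a b"
  then show ?thesis
  proof cases
    case (1 b2 b1 b3 i)
    with W(1) have w: "W = [CCross i b1, CCross (Suc i) b2, CCross i b3]" by (auto simp: map_erase_Cons erase_eq_simps)
    moreover from this W(2) have "Suc (Suc i) < length s" by (auto split: if_splits)
    then obtain x p q z y where s: "s = x @ p # q # z # y" "length x = i" by (rule split3)
    ultimately show ?thesis using same_sublinks_reidemeister_3[OF 1(3), of x p q z y] 1
      by (intro exI[of _ "[CCross (Suc i) b3, CCross i b2, CCross (Suc i) b1]"]) auto
  qed
qed

text \<open>Read backwards, a zigzag move creates a minimum whose colour has to be supplied: it is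
  that of the strand on which the zigzag is formed. That \<open>b\<close> runs fixes the direction
  of this strand.\<close>

lemma coloured_move_reverse:
  assumes m: "word_move b a" and W: "map erase W = a" "crun W s = Some t" and b: "run b (map fst s) \<noteq> None"
  shows "\<exists>V. map erase V = b \<and> same_sublinks s V W"
  using m unfolding word_move_def
proof (elim disjE)
  assume "planar_move b a"
  then show ?thesis
  proof cases
    case (exchange e f f')
    from exchange_cases[OF exchange(3,4)] obtain g where g: "pos e \<le> pos g" "f = shift (strands_out e) g" "f' = shift (strands_in e) g" .
    from W(1) exchange(2) obtain e1 f1 where ef: "W = [f1, e1]" "erase e1 = e" "erase f1 = f'"
      by (auto simp: map_erase_Cons)
    obtain g' where g': "g = shift (pos e) g'" using g(1) by (metis shift_pos_obtain)
    from ef(3) obtain f0 where f0: "f1 = cshift (pos e + strands_in e) f0" "erase f0 = g'"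
      unfolding g(3) g' by (auto elim: erase_shift_E)
    from W(2) ef(1) obtain r where r: "capply f1 s = Some r" "capply e1 r = Some t"
      by (auto split: option.splits)
    have l: "pos e + strands_in e \<le> length s"
      using apply_event_length[OF capply_erase[OF r(1)]] ef(3) g(1,3) by simp
    define c where "c = take (pos e + strands_in e) s"
    define d where "d = drop (pos e + strands_in e) s"
    have s: "s = c @ d" "length c = pos e + strands_in e" using l by (auto simp: c_def d_def)
    from r(1) obtain d' where d': "capply f0 d = Some d'" "r = c @ d'"
      unfolding f0 s(1) using capply_cshift[OF s(2)] by auto
    from r(2) capply_prefix[of e1 c d'] s ef(2) d'(2) obtain c' where c': "capply e1 c = Some c'" by auto
    have lc': "length c' = pos e + strands_out e"
      using apply_event_length[OF capply_erase[OF c']] s(2) ef(2) by simp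
    from same_sublinks_exchange[OF c' d'(1)] have "same_sublinks s [e1, cshift (length c') f0] W"
      using ef f0 lc' s by simp
    moreover have "map erase [e1, cshift (length c') f0] = b"
      using exchange(1) g(2) g' f0(2) lc' ef(2) by simp
    ultimately show ?thesis by blast
  next
    case (zigzag_right i d)
    with W(1) have "W = []" by simp
    moreover obtain t' where "run [Cup (Suc i) d, Cap i] (map fst s) = Some t'"
      using b zigzag_right by blast
    then have "i < length s" "map fst s ! i = opposite d"
      unfolding run_zigzag_right by simp_all
    moreover obtain x p y where s: "s = x @ p # y" "length x = i" using split1[OF \<open>i < length s\<close>] .
    ultimately show ?thesis using same_sublinks_zigzag_right[of x d "snd p" y] zigzag_right
      by (intro exI[of _ "[CCup (Suc i) d (snd p), CCap i]"]) (cases p, auto simp: nth_append)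
  next
    case (zigzag_left i d)
    with W(1) have "W = []" by simp
    moreover obtain t' where "run [Cup i d, Cap (Suc i)] (map fst s) = Some t'"
      using b zigzag_left by blast
    then have "i < length s" "map fst s ! i = d"
      unfolding run_zigzag_left by simp_all
    moreover obtain x p y where s: "s = x @ p # y" "length x = i" using split1[OF \<open>i < length s\<close>] .
    ultimately show ?thesis using same_sublinks_zigzag_left[of x d "snd p" y] zigzag_left
      by (intro exI[of _ "[CCup i d (snd p), CCap (Suc i)]"]) (cases p, auto simp: nth_append)
  next
    case (through_cup i d r)
    with W(1) obtain c where "W = [CCup (Suc i) d c, CCross i (\<not> r)]" by (auto simp: map_erase_Cons erase_eq_simps)
    moreover from this W(2) have "i < length s" by (auto split: if_splits)
    then obtain x p y where s: "s = x @ p # y" "length x = i" by (rule split1)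
    ultimately show ?thesis using same_sublinks_through_cup[of x p y d c r] through_cup
      by (intro exI[of _ "[CCup i d c, CCross (Suc i) r]"]) auto
  next
    case (through_cap i r)
    with W(1) have w: "W = [CCross (Suc i) (\<not> r), CCap i]" by (auto simp: map_erase_Cons erase_eq_simps)
    moreover from this W(2) have "Suc (Suc i) < length s" by (auto split: if_splits)
    then obtain x p z q y where s: "s = x @ p # z # q # y" "length x = i" by (rule split3)
    moreover from W(2) have "fst p \<noteq> fst q" "snd p = snd q"
      unfolding w using s by (auto simp del: capply.simps split: if_splits)
    ultimately show ?thesis using same_sublinks_through_cap[of p q x z y r] through_cap
      by (intro exI[of _ "[CCross i r, CCap (Suc i)]"]) auto
  qed
next
  assume "reidemeister_2 b a"
  then show ?thesis
  proof cases
    case (1 i r)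
    with W(1) have "W = []" by simp
    moreover have "Suc i < length s" using b 1(1) by (auto split: if_splits)
    then obtain x p q y where s: "s = x @ p # q # y" "length x = i" by (rule split2)
    ultimately show ?thesis using same_sublinks_reidemeister_2[of x p q y r] 1 
      by (intro exI[of _ "[CCross i r, CCross i (\<not> r)]"]) auto
  qed
next
  assume "reidemeister_3 b a"
  then show ?thesis
  proof cases
    case (1 b2 b1 b3 i)
    with W(1) have w: "W = [CCross (Suc i) b3, CCross i b2, CCross (Suc i) b1]" by (auto simp: map_erase_Cons erase_eq_simps)
    moreover from this W(2) have "Suc (Suc i) < length s" by (auto split: if_splits)
    then obtain x p q z y where s: "s = x @ p # q # z # y" "length x = i" by (rule split3)
    ultimately show ?thesis using same_sublinks_reidemeister_3[OF 1(3), of x p q z y] 1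
      by (intro exI[of _ "[CCross i b1, CCross (Suc i) b2, CCross i b3]"]) auto
  qed
qed

lemma same_sublinks_context:
  assumes "same_sublinks s W V" "crun X [] = Some s" "crun W s = Some t" "crun Y t = Some []"
  shows "same_sublinks [] (X @ W @ Y) (X @ V @ Y)"
proof -
  have V: "crun V s = Some t" using assms(1,3) by (auto simp: same_sublinks_def)
  have "word_isotopic [] (map erase (sub T (X @ W @ Y) [])) (map erase (sub T (X @ V @ Y) []))" for T
  proof -
    have "word_isotopic (map fst (keep T s)) (map erase (sub T W s)) (map erase (sub T V s))"
      using assms(1) by (simp add: same_sublinks_def)
    moreover have "run (map erase (sub T X [])) [] = Some (map fst (keep T s))"
      using crun_erase[OF crun_sub[OF assms(2), of T]] by simp
    moreover have "run (map erase (sub T W s)) (map fst (keep T s)) = Some (map fst (keep T t))"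
      by (rule crun_erase[OF crun_sub[OF assms(3)]])
    moreover have "run (map erase (sub T Y t)) (map fst (keep T t)) = Some []"
      using crun_erase[OF crun_sub[OF assms(4), of T]] by simp
    ultimately show ?thesis
      using word_isotopic_context by (simp add: sub_append[OF assms(2)] sub_append[OF assms(3)] sub_append[OF V])
  qed
  moreover have "colours (X @ V @ Y) = colours (X @ W @ Y)"
  proof -
    have "snd ` set s \<subseteq> colours X" using crun_colours[OF assms(2)] by simp
    moreover have "colours V \<union> snd ` set s = colours W \<union> snd ` set s"
      using assms(1) by (simp add: same_sublinks_def)
    ultimately show ?thesis unfolding colours_simps by blast
  qed
  ultimately show ?thesis using assms V by (auto simp: same_sublinks_def)
qed

lemma map_erase_append3:
  assumes "map erase W = xs @ a @ ys"
  obtains X A Y where "W = X @ A @ Y" "map erase X = xs" "map erase A = a" "map erase Y = ys"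
proof -
  from assms[unfolded map_eq_append_conv] obtain X Z where X: "W = X @ Z" "xs = map erase X" "a @ ys = map erase Z"
    by blast
  from X(3)[symmetric, unfolded map_eq_append_conv] obtain A Y where "Z = A @ Y" "a = map erase A" "ys = map erase Y"
    by blast
  with X(1,2) show ?thesis by (intro that[of X A Y]) simp_all
qed

lemma lift_isotopy_step:
  assumes W: "is_lift D W" and "word_step [] (events D) (events D') \<or> word_step [] (events D') (events D)"
  shows "\<exists>V. is_lift D' V \<and> same_sublinks [] W V"
proof -
  from assms(2) obtain xs ys a b where m: "word_move a b \<or> word_move b a" "events D = xs @ a @ ys" "events D' = xs @ b @ ys"
    unfolding word_step_def by blast
  from W m(2) obtain X A Y where X: "W = X @ A @ Y" "map erase X = xs" "map erase A = a" "map erase Y = ys"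
    unfolding is_lift_def by (metis map_erase_append3)
  from W X(1) obtain s t where s: "crun X [] = Some s" "crun A s = Some t" "crun Y t = Some []"
    unfolding is_lift_def by (metis crun_append_SomeE)
  have "run xs [] = Some (map fst s)" using crun_erase[OF s(1)] X(2) by simp
  with m(3) closed_events[of D'] have "run b (map fst s) \<noteq> None"
    by (auto simp: closed_def run_append bind_eq_Some_conv)
  with m(1) X(3) s(2) obtain B where B: "map erase B = b" "same_sublinks s A B"
    using coloured_move[of a b A s t] coloured_move_reverse[of b a A s t] same_sublinks_sym by metis
  from same_sublinks_context[OF B(2) s] have "same_sublinks [] W (X @ B @ Y)" using X(1) by simp
  moreover from this have "crun (X @ B @ Y) [] = Some []"
    using W by (auto simp: same_sublinks_def is_lift_def)
  then have "is_lift D' (X @ B @ Y)" using X B m by (simp add: is_lift_def)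
  ultimately show ?thesis by blast
qed

text \<open>The loop has the colour of its strand, so deleting colours keeps the curl or deletes it
  altogether.\<close>

lemma coloured_curl:
  assumes "curl b u" "map erase W = u" "crun W s = Some t"
  shows "t = s \<and> (\<exists>c \<in> snd ` set s. colours W = {c} \<and>
     (\<forall>T. (T c \<longrightarrow> curl b (map erase (sub T W s))) \<and> (\<not> T c \<longrightarrow> sub T W s = [])))"
  using assms(1)
proof cases
  case (loop_right i d)
  with assms(2) obtain c where w: "W = [CCup (Suc i) d c, CCross i b, CCap (Suc i)]"
    by (auto simp: map_erase_Cons erase_eq_simps)
  with assms(3) have "i < length s" by (auto split: if_splits)
  then obtain x p y where s: "s = x @ p # y" "length x = i" by (rule split1)
  have p: "p = (d, c)" "t = s"
    using assms(3) unfolding w s(1) using s(2) by (cases p, auto simp: opposite_eq_iff simp del: capply.simps split: if_splits)+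
  then show ?thesis unfolding w
    using s by (auto simp del: capply.simps sub1.simps intro: curl.loop_right)
next
  case (loop_left i d)
  with assms(2) obtain c where w: "W = [CCup i d c, CCross (Suc i) b, CCap i]"
    by (auto simp: map_erase_Cons erase_eq_simps)
  with assms(3) have "i < length s" by (auto split: if_splits)
  then obtain x p y where s: "s = x @ p # y" "length x = i" by (rule split1)
  have p: "p = (opposite d, c)" "t = s"
    using assms(3) unfolding w s(1) using s(2) by (cases p, auto simp: opposite_eq_iff simp del: capply.simps split: if_splits)+
  then show ?thesis unfolding w
    using s by (auto simp del: capply.simps sub1.simps intro: curl.loop_left)
qed

lemma coloured_curl_exists:
  assumes "curl b u" "run u (map fst s) \<noteq> None"
  shows "\<exists>W. map erase W = u \<and> crun W s = Some s"
  using assms(1)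
proof cases
  case (loop_right i d)
  with assms(2) have "i < length s" by (auto split: if_splits)
  then obtain x p y where s: "s = x @ p # y" "length x = i" by (rule split1)
  have "apply_event (Cup (Suc i) d) ((map fst x @ [fst p]) @ map fst y) = Some ((map fst x @ [fst p]) @ d # opposite d # map fst y)"
    "apply_event (Cap (Suc i)) ((map fst x @ [d]) @ fst p # opposite d # map fst y) = 
      (if fst p \<noteq> opposite d then Some ((map fst x @ [d]) @ map fst y) else None)"
    using s by (intro apply_Cup_append apply_Cap_append; simp)+
  with assms(2) loop_right s have "fst p = d"
    by (auto simp: opposite_eq_iff simp del: apply_event.simps split: if_splits)
  with s loop_right show ?thesis
    by (intro exI[of _ "[CCup (Suc i) d (snd p), CCross i b, CCap (Suc i)]"]) (cases p, auto simp del: capply.simps)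
next
  case (loop_left i d)
  with assms(2) have "i < length s" by (auto split: if_splits)
  then obtain x p y where s: "s = x @ p # y" "length x = i" by (rule split1)
  have "apply_event (Cross (Suc i) b) ((map fst x @ [d]) @ opposite d # fst p # map fst y) = 
      Some ((map fst x @ [d]) @ fst p # opposite d # map fst y)"
    using s by (intro apply_Cross_append; simp)+
  with assms(2) loop_left s have "fst p = opposite d"
    by (auto simp: opposite_eq_iff simp del: apply_event.simps split: if_splits)
  with s loop_left show ?thesis
    by (intro exI[of _ "[CCup i d (snd p), CCross (Suc i) b, CCap i]"]) (cases p, auto simp del: capply.simps)
qed

section \<open>Existence\<close>

lemma include_wa_superset:
  assumes "finite S" "Poly_Mapping.keys p \<subseteq> S"
  shows "include_wa p = (\<Sum>k \<in> S. Poly_Mapping.single (0, fst k, snd k, 0) (Poly_Mapping.lookup p k))"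
proof -
  have "include_wa p = (\<Sum>k \<in> Poly_Mapping.keys p. Poly_Mapping.single (0, fst k, snd k, 0) (Poly_Mapping.lookup p k))"
    by (simp add: include_wa_def case_prod_unfold)
  also have "\<dots> = (\<Sum>k \<in> S. Poly_Mapping.single (0, fst k, snd k, 0) (Poly_Mapping.lookup p k))"
    using assms by (intro sum.mono_neutral_left) (auto simp: in_keys_iff)
  finally show ?thesis .
qed

lemma include_wa_add: "include_wa (p + q) = include_wa p + include_wa q"
proof -
  let ?S = "Poly_Mapping.keys p \<union> Poly_Mapping.keys q"
  have "Poly_Mapping.keys (p + q) \<subseteq> ?S" by (rule keys_add)
  then show ?thesis
    by (simp add: include_wa_superset[of ?S] lookup_add single_add sum.distrib)
qed

lemma include_wa_single: "include_wa (Poly_Mapping.single k v) = Poly_Mapping.single (0, fst k, snd k, 0) v"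
  using include_wa_superset[of "{k}" "Poly_Mapping.single k v"] by simp

lemma include_wa_0 [simp]: "include_wa 0 = 0"
  by (simp add: include_wa_def)

lemma include_wa_1 [simp]: "include_wa 1 = 1"
  using include_wa_single[of 0 1] by (simp add: single_one[symmetric] zero_prod_def del: single_one)

lemma poly_mapping_add_induct [case_names zero single_add]:
  assumes "P 0" "\<And>k v p. P p \<Longrightarrow> P (Poly_Mapping.single k v + p)"
  shows "P p"
proof (induction p rule: update_induct)
  case const
  then show ?case by (rule assms(1))
next
  case (update f a b)
  have "Poly_Mapping.update a b f = Poly_Mapping.single a b + f"
  proof (rule poly_mapping_eqI)
    fix k show "Poly_Mapping.lookup (Poly_Mapping.update a b f) k = Poly_Mapping.lookup (Poly_Mapping.single a b + f) k"
      using update by (auto simp: lookup_update lookup_add lookup_single in_keys_iff when_def)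
  qed
  with assms(2)[of f a b] update show ?case by simp
qed

lemma include_wa_mult: "include_wa (p * q) = include_wa p * include_wa q"
proof (induction p rule: poly_mapping_add_induct)
  case (single_add k v p)
  have "include_wa (Poly_Mapping.single k v * q) = include_wa (Poly_Mapping.single k v) * include_wa q"
  proof (induction q rule: poly_mapping_add_induct)
    case (single_add k' v' q)
    have "include_wa (Poly_Mapping.single k v * Poly_Mapping.single k' v') =
        include_wa (Poly_Mapping.single k v) * include_wa (Poly_Mapping.single k' v')"
      by (simp add: mult_single include_wa_single)
    with single_add show ?case by (simp only: distrib_left include_wa_add)
  qed simp
  with single_add show ?case by (simp only: distrib_right include_wa_add)
qed simp

lemma include_wa_diff: "include_wa (p - q) = include_wa p - include_wa q"
  using include_wa_add[of "p - q" q] by (simp add: algebra_simps)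

lemma include_wa_power: "include_wa (p ^ n) = include_wa p ^ n"
  by (induction n) (simp_all add: include_wa_mult)

lemma include_wa_prod: "include_wa (\<Prod>x \<in> A. f x) = (\<Prod>x \<in> A. include_wa (f x))"
  by (induction A rule: infinite_finite_induct) (simp_all add: include_wa_mult)

lemma a_pow_inverse [simp]: "a_pow (if b then 1 else - 1) * a_pow (if b then - 1 else 1) = 1"
  by (simp add: a_pow_def mult_single flip: single_one zero_prod_def)

lemma E_pow_power: "E_pow (- 1) ^ n = E_pow (- int n)"
  by (induction n) (simp_all add: E_pow_def mult_single flip: single_one zero_prod_def)

text \<open>This is \<open>z / w\<close>, which turns the factor \<open>y * w\<close> of
  \<open>partition_sum_skein\<close> into \<open>z\<close>.\<close>

definition y_par :: laurent_zwaE where "y_par = z_var * include_wa w_inv"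

lemma y_par_w: "y_par * include_wa w_var = z_var"
  by (simp add: y_par_def mult.assoc flip: include_wa_mult)

definition sublink :: "'c cevent list \<Rightarrow> 'c set \<Rightarrow> event list" where
  "sublink V A = map erase (sub (\<lambda>c. c \<in> A) V [])"

definition lift_sum :: "(link_diagram \<Rightarrow> laurent_wa) \<Rightarrow> 'c cevent list \<Rightarrow> laurent_zwaE" where
  "lift_sum R V = partition_sum y_par (E_pow (- 1)) (include_wa eta) (colours V) (\<lambda>A. include_wa (on_word R (sublink V A)))"

text \<open>Lickorish's closed formula: a sum over the partitions of the set of components into blocks, in which
  the sublinks formed by the blocks contribute the product of their Homflypt polynomials. With
  \<open>y = z / w\<close>, \<open>e = 1 / E\<close>, \<open>n\<close> components and \<open>k\<close> blocks, the coefficient is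
  \<open>y\<^sup>n\<^sup>-\<^sup>k (e - y) (e - 2 y) \<dots> (e - (k - 1) y) \<eta>\<^sup>k\<^sup>-\<^sup>1\<close>.\<close>

definition extended_homflypt :: "(link_diagram \<Rightarrow> laurent_wa) \<Rightarrow> link_diagram \<Rightarrow> laurent_zwaE" where
  "extended_homflypt R D = lift_sum R (universal D)"

lemma closed_sublink:
  assumes "is_lift D V" "A \<subseteq> colours V" "A \<noteq> {}" shows "closed (sublink V A)"
  unfolding sublink_def using assms by (intro closed_sub) (auto simp: is_lift_def)

text \<open>Only the grouping of the strands by colour enters the formula, not the names of the
  colours; so it may be evaluated with any colouring that separates the components.\<close>

lemma lift_sum_full:
  assumes "full_lift D V" shows "lift_sum R V = extended_homflypt R D"
proof -
  from assms obtain f where f: "V = recolour f (universal D)" "inj_on f (components D)" "colours V = f ` components D"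
    by (rule full_liftE)
  have run: "crun (universal D) [] = Some []" using is_lift_universal[of D] by (simp add: is_lift_def)
  have "sublink V (f ` A) = sublink (universal D) A" if "A \<subseteq> components D" for A
  proof -
    have "sub (\<lambda>c. c \<in> f ` A) V [] = recolour f (sub (\<lambda>c. f c \<in> f ` A) (universal D) [])"
      using sub_recolour[OF run, of "\<lambda>c. c \<in> f ` A" f] f(1) by simp
    also have "sub (\<lambda>c. f c \<in> f ` A) (universal D) [] = sub (\<lambda>c. c \<in> A) (universal D) []"
      using f(2) that by (intro sub_cong[OF run]) (auto simp: colours_universal inj_on_image_mem_iff)
    finally show ?thesis by (simp add: sublink_def)
  qed
  then show ?thesis unfolding lift_sum_def extended_homflypt_def f(3) colours_universal
    by (simp add: partition_sum_image[OF f(2)] cong: partition_sum_cong)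
qed

lemma lift_sum_cong:
  assumes "colours V = colours W" 
    and "\<And>A. A \<subseteq> colours V \<Longrightarrow> A \<noteq> {} \<Longrightarrow> on_word R (sublink V A) = on_word R (sublink W A)"
  shows "lift_sum R V = lift_sum R W"
  unfolding lift_sum_def assms(1)[symmetric] using assms(2) by (intro partition_sum_cong) simp

lemma same_sublinks_lift_sum:
  assumes R: "regular_homflypt R" and W: "is_lift D W" and s: "same_sublinks [] W V"
  shows "colours V = colours W" "lift_sum R V = lift_sum R W"
proof -
  show c: "colours V = colours W" using s by (simp add: same_sublinks_def)
  show "lift_sum R V = lift_sum R W"
  proof (rule lift_sum_cong[OF c])
    fix A assume A: "A \<subseteq> colours V" "A \<noteq> {}"
    have "word_isotopic [] (sublink W A) (sublink V A)"
      using s by (simp add: same_sublinks_def sublink_def)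
    then show "on_word R (sublink V A) = on_word R (sublink W A)"
      using skein_invariant_isotopic[OF regular_homflypt_skein_invariant[OF R] closed_sublink[OF W]] A c by simp
  qed
qed

text \<open>The colouring by the components of one diagram is carried to the other with all its
  colours, so the other has at least as many components; the hypothesis is symmetric.\<close>

lemma card_components_step:
  assumes "word_step [] (events D) (events D') \<or> word_step [] (events D') (events D)"
  shows "card (components D) = card (components D')"
proof (rule antisym)
  have le: "card (components D) \<le> card (components D')" 
    if "word_step [] (events D) (events D') \<or> word_step [] (events D') (events D)" for D D'
  proof -
    from lift_isotopy_step[OF is_lift_universal that] obtain V where "is_lift D' V" "same_sublinks [] (universal D) V" by blast
    then have "is_lift D' V" "colours V = components D" by (auto simp: same_sublinks_def colours_universal)
    with lift_card_le[of D' V] show ?thesis by simp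
  qed
  from assms show "card (components D) \<le> card (components D')" by (rule le)
  from assms show "card (components D') \<le> card (components D)" by (intro le) blast
qed

lemma regular_isotopic_induct:
  assumes "regular_isotopic D D'"
    and "\<And>D D'. word_step [] (events D) (events D') \<or> word_step [] (events D') (events D) \<Longrightarrow> f D = f D'"
  shows "f D = f D'"
  using assms(1) unfolding regular_isotopic_def
proof (induction rule: equivclp_induct)
  case (step y z)
  then show ?case using assms(2)[of y z] unfolding isotopy_move_iff by metis
qed simp

lemma card_components_isotopic:
  "regular_isotopic D D' \<Longrightarrow> card (components D) = card (components D')"
  by (erule regular_isotopic_induct[where f = "\<lambda>D. card (components D)"]) (rule card_components_step)

lemma extended_homflypt_isotopic:
  assumes R: "regular_homflypt R" and "regular_isotopic D D'"
  shows "extended_homflypt R D = extended_homflypt R D'"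
  using assms(2)
proof (rule regular_isotopic_induct)
  fix D D' assume st: "word_step [] (events D) (events D') \<or> word_step [] (events D') (events D)"
  from lift_isotopy_step[OF is_lift_universal st] obtain V where V: "is_lift D' V" "same_sublinks [] (universal D) V" by blast
  note c = same_sublinks_lift_sum[OF R is_lift_universal V(2)]
  have "full_lift D' V"
    using V(1) c(1) card_components_step[OF st] by (simp add: full_lift_def colours_universal)
  then show "extended_homflypt R D = extended_homflypt R D'"
    using lift_sum_full[of D' V R] c(2) by (simp add: extended_homflypt_def)
qed

lemma sub_three:
  "crun X [] = Some s \<Longrightarrow> crun Z s = Some t \<Longrightarrow> sub T (X @ Z @ Y) [] = sub T X [] @ sub T Z s @ sub T Y t"
  by (simp add: sub_append)

lemma lift_split:
  assumes "is_lift D W" "events D = xs @ a @ ys"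
  obtains X A Y s t where "W = X @ A @ Y" "map erase X = xs" "map erase A = a" "map erase Y = ys"
    "crun X [] = Some s" "crun A s = Some t" "crun Y t = Some []" "run xs [] = Some (map fst s)"
proof -
  from assms have "map erase W = xs @ a @ ys" by (simp add: is_lift_def)
  then obtain X A Y where X: "W = X @ A @ Y" "map erase X = xs" "map erase A = a" "map erase Y = ys"
    by (rule map_erase_append3)
  from assms(1) X(1) obtain s t where s: "crun X [] = Some s" "crun A s = Some t" "crun Y t = Some []"
    unfolding is_lift_def by (metis crun_append_SomeE)
  from crun_erase[OF s(1)] X(2) have "run xs [] = Some (map fst s)" by simp
  with that X s show ?thesis by blast
qed

lemma extended_homflypt_curl:
  assumes R: "regular_homflypt R" and D: "curl b u" "events D = xs @ u @ ys" "events D' = xs @ ys"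
  shows "extended_homflypt R D = include_wa (a_pow (if b then 1 else - 1)) * extended_homflypt R D'"
proof -
  have "events D' = xs @ [] @ ys" using D(3) by simp
  from is_lift_universal this obtain X A Y s t where W: "universal D' = X @ A @ Y" "map erase X = xs" "map erase A = []" "map erase Y = ys"
    "crun X [] = Some s" "crun A s = Some t" "crun Y t = Some []" "run xs [] = Some (map fst s)" by (rule lift_split)
  have A: "A = []" "t = s" using W by auto
  have "run u (map fst s) \<noteq> None"
    using closed_events[of D] W(8) D(2) by (auto simp: closed_def run_append bind_eq_Some_conv)
  from coloured_curl_exists[OF D(1) this] obtain C where C: "map erase C = u" "crun C s = Some s" by blast
  from coloured_curl[OF D(1) C] obtain c where c: "c \<in> snd ` set s" "colours C = {c}"
    "\<And>T. T c \<Longrightarrow> curl b (map erase (sub T C s))" "\<And>T. \<not> T c \<Longrightarrow> sub T C s = []" by auto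
  let ?V = "X @ C @ Y"
  have V: "is_lift D ?V" using W C A D(2) by (simp add: is_lift_def)
  have cX: "c \<in> colours X" using c(1) crun_colours[OF W(5)] by auto
  have col: "colours ?V = components D'"
    unfolding colours_universal[of D', symmetric] W(1) A(1) using c(2) cX by auto
  \<comment> \<open>Removing the curl from the universal colouring of \<open>D\<close> loses no
    colour, since that of the curl occurs on the strand entering it.\<close>
  have "card (components D) \<le> card (components D')"
  proof -
    from is_lift_universal D(2) obtain X' A' Y' s' t' where W': "universal D = X' @ A' @ Y'" "map erase X' = xs" "map erase A' = u" "map erase Y' = ys"
      "crun X' [] = Some s'" "crun A' s' = Some t'" "crun Y' t' = Some []" "run xs [] = Some (map fst s')" by (rule lift_split)
    from coloured_curl[OF D(1) W'(3,6)] obtain c' where c': "t' = s'" "c' \<in> snd ` set s'" "colours A' = {c'}" by auto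
    have "c' \<in> colours X'" using c'(2) crun_colours[OF W'(5)] by auto
    then have "colours (X' @ Y') = components D"
      unfolding colours_universal[of D, symmetric] W'(1) using c'(3) by auto
    moreover have "is_lift D' (X' @ Y')" using W' c'(1) D(3) by (simp add: is_lift_def)
    ultimately show ?thesis using lift_card_le by metis
  qed
  moreover have "card (components D') \<le> card (components D)"
    using lift_card_le[OF V] col by simp
  ultimately have "full_lift D ?V" using V col by (simp add: full_lift_def)
  then have "extended_homflypt R D = lift_sum R ?V" by (simp add: lift_sum_full)
  also have "\<dots> = include_wa (a_pow (if b then 1 else - 1)) * lift_sum R (universal D')"
    unfolding lift_sum_def col colours_universal
  proof (rule partition_sum_curl)
    show "c \<in> components D'" using cX unfolding colours_universal[of D', symmetric] W(1) by simp
    fix S assume S: "S \<subseteq> components D'" "S \<noteq> {}"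
    let ?T = "\<lambda>c. c \<in> S"
    let ?u = "map erase (sub ?T X [])" and ?q = "map erase (sub ?T Y s)"
    have 1: "sublink ?V S = ?u @ map erase (sub ?T C s) @ ?q"
      unfolding sublink_def sub_three[OF W(5) C(2)] by simp
    have 2: "sublink (universal D') S = ?u @ ?q"
      unfolding sublink_def W(1) A by (simp add: sub_append[OF W(5)])
    show "include_wa (on_word R (sublink ?V S)) = (if c \<in> S then include_wa (a_pow (if b then 1 else - 1)) * include_wa (on_word R (sublink (universal D') S))
        else include_wa (on_word R (sublink (universal D') S)))"
    proof (cases "c \<in> S")
      case True
      have "closed (sublink ?V S)" using closed_sublink[OF V] S col by simp
      then have "on_word R (sublink ?V S) = a_pow (if b then 1 else - 1) * on_word R (sublink (universal D') S)"
        unfolding 1 2 using skein_invariant_curl[OF regular_homflypt_skein_invariant[OF R] c(3)[of ?T]] True by blast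
      then show ?thesis using True by (simp add: include_wa_mult)
    next
      case False
      with c(4)[of ?T] 1 2 show ?thesis by simp
    qed
  qed simp
  finally show ?thesis by (simp add: extended_homflypt_def)
qed

subsection \<open>Conway triples\<close>

text \<open>Signed number of strands of colour \<open>c\<close>. The two strands of a minimum or
  maximum have equal colours and opposite directions, so no event changes it.\<close>

definition flow :: "'c \<Rightarrow> 'c clevel \<Rightarrow> int" where
  "flow c s = (\<Sum>x \<leftarrow> s. if snd x = c then (if fst x = Up then 1 else - 1) else 0)"

lemma flow_simps [simp]: "flow c [] = 0" 
  "flow c (x # s) = (if snd x = c then (if fst x = Up then 1 else - 1) else 0) + flow c s"
  "flow c (s @ t) = flow c s + flow c t"
  by (simp_all add: flow_def)

lemma opposite_eq_Up: "opposite d = Up \<longleftrightarrow> d \<noteq> Up"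
  by (cases d) auto

lemma capply_flow: "capply e s = Some t \<Longrightarrow> flow c t = flow c s"
  by (cases e) (auto elim!: capply_CCup_E capply_CCap_E capply_CCross_E simp: opposite_eq_Up simp del: capply.simps)

text \<open>Superposition of two colourings of the same word. It is again a colouring, so the flow
  of every pair of colours is conserved.\<close>

definition zip_colours :: "'c clevel \<Rightarrow> 'd clevel \<Rightarrow> ('c \<times> 'd) clevel" where
  "zip_colours s s' = map2 (\<lambda>x x'. (fst x, (snd x, snd x'))) s s'"

lemma zip_colours_simps [simp]: "zip_colours [] [] = []"
  "zip_colours (x # s) (x' # s') = (fst x, (snd x, snd x')) # zip_colours s s'"
  "length s = length s' \<Longrightarrow> zip_colours (s @ t) (s' @ t') = zip_colours s s' @ zip_colours t t'"
  by (simp_all add: zip_colours_def)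

lemma length_zip_colours [simp]: "length (zip_colours s s') = min (length s) (length s')"
  by (simp add: zip_colours_def)

lemma capply_zip_colours:
  assumes "capply e s = Some t" "capply e' s' = Some t'" "erase e = erase e'" "map fst s = map fst s'"
  shows "\<exists>f. capply f (zip_colours s s') = Some (zip_colours t t') \<and> map fst t = map fst t'"
proof (cases e)
  case (CCup i d c)
  with assms(3) obtain c' where e': "e' = CCup i d c'" by (cases e') auto
  from assms(1) CCup obtain a b where a: "s = a @ b" "length a = i" "t = a @ (d, c) # (opposite d, c) # b"
    by (metis capply_CCup_E)
  from assms(2) e' obtain a' b' where a': "s' = a' @ b'" "length a' = i" "t' = a' @ (d, c') # (opposite d, c') # b'"
    by (metis capply_CCup_E)
  from assms(4) a a' have "map fst a = map fst a'" "map fst b = map fst b'"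
    by (simp_all add: append_eq_append_conv)
  then show ?thesis using a a'
    by (intro exI[of _ "CCup i d (c, c')"]) (simp del: capply.simps)
next
  case (CCap i)
  with assms(3) have e': "e' = CCap i" by (cases e') auto
  from assms(1) CCap obtain a d c b where a: "s = a @ (d, c) # (opposite d, c) # b" "length a = i" "t = a @ b"
    by (metis capply_CCap_E)
  from assms(2) e' obtain a' d' c' b' where a': "s' = a' @ (d', c') # (opposite d', c') # b'" "length a' = i" "t' = a' @ b'"
    by (metis capply_CCap_E)
  from assms(4) a a' have "map fst a = map fst a'" "map fst b = map fst b'"
    by (simp_all add: append_eq_append_conv)
  then show ?thesis using a a'
    by (intro exI[of _ "CCap i"]) (simp del: capply.simps)
next
  case (CCross i r)
  with assms(3) have e': "e' = CCross i r" by (cases e') auto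
  from assms(1) CCross obtain a x y b where a: "s = a @ x # y # b" "length a = i" "t = a @ y # x # b"
    by (metis capply_CCross_E)
  from assms(2) e' obtain a' x' y' b' where a': "s' = a' @ x' # y' # b'" "length a' = i" "t' = a' @ y' # x' # b'"
    by (metis capply_CCross_E)
  from assms(4) a a' have "map fst a = map fst a'" "map fst b = map fst b'" "fst x = fst x'" "fst y = fst y'"
    by (simp_all add: append_eq_append_conv)
  then show ?thesis using a a'
    by (intro exI[of _ "CCross i r"]) (simp del: capply.simps)
qed

lemma crun_flow:
  "crun W s = Some t \<Longrightarrow> crun W' s' = Some t' \<Longrightarrow> map erase W = map erase W' \<Longrightarrow> map fst s = map fst s' \<Longrightarrow>
   flow c (zip_colours t t') = flow c (zip_colours s s')"
proof (induction W arbitrary: s s' W')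
  case (Cons e W)
  then obtain e' V where W': "W' = e' # V" "erase e = erase e'" "map erase W = map erase V" by (cases W') auto
  from Cons.prems(1) obtain r where r: "capply e s = Some r" "crun W r = Some t" by (rule crun_ConsE)
  from Cons.prems(2) obtain r' where r': "capply e' s' = Some r'" "crun V r' = Some t'" unfolding W'(1) by (rule crun_ConsE)
  from capply_zip_colours[OF r(1) r'(1) W'(2) Cons.prems(4)] obtain f
    where f: "capply f (zip_colours s s') = Some (zip_colours r r')" "map fst r = map fst r'" by blast
  from Cons.IH[OF r(2) r'(2) W'(3) f(2)] capply_flow[OF f(1)] show ?case by simp
qed simp

definition csmoothing :: "nat \<Rightarrow> direction \<Rightarrow> direction \<Rightarrow> 'c \<Rightarrow> 'c cevent list" where
  "csmoothing i p q c = (if p = q then [] else [CCap i, CCup i q c])"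

lemma erase_csmoothing [simp]: "map erase (csmoothing i p q c) = smoothing i p q"
  by (simp add: csmoothing_def smoothing_def)

lemma crun_csmoothing:
  "length a = i \<Longrightarrow> crun (csmoothing i p q c) (a @ (p, c) # (q, c) # b) = Some (a @ (q, c) # (p, c) # b)"
  by (auto simp: csmoothing_def opposite_eq_iff simp del: capply.simps)

lemma sub_csmoothing:
  "length a = i \<Longrightarrow> sub T (csmoothing i p q c) (a @ (p, c) # (q, c) # b) = (if T c then csmoothing (length (keep T a)) p q c else [])"
  by (auto simp: csmoothing_def opposite_eq_iff simp del: capply.simps sub1.simps)

text \<open>Superimposing a colouring of the smoothed diagram on one that separates the two strands of the crossing:
  by conservation of the flow of every pair of colours, the smoothing joins the two strands.\<close>

lemma smoothing_colours:
  assumes X: "crun X [] = Some (a @ (p, c1) # (q, c2) # b)" "crun Y (a @ (q, c2) # (p, c1) # b) = Some []" "c1 \<noteq> c2"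
    and X': "crun X' [] = Some s" "crun Z s = Some t" "crun Y' t = Some []"
    and er: "map erase X' = map erase X" "map erase Y' = map erase Y" "map erase Z = smoothing (length a) p q"
  shows "\<exists>a' b' c. length a' = length a \<and> s = a' @ (p, c) # (q, c) # b' \<and> t = a' @ (q, c) # (p, c) # b' \<and>
    Z = csmoothing (length a) p q c"
proof -
  have fs: "map fst s = map fst (a @ (p, c1) # (q, c2) # b)"
    using crun_erase[OF X(1)] crun_erase[OF X'(1)] er(1) by simp
  have "length s = length (a @ (p, c1) # (q, c2) # b)" using fs by (rule map_eq_imp_length_eq)
  then have "Suc (length a) < length s" by simp
  then obtain a' x y b' where s': "s = a' @ x # y # b'" "length a' = length a" by (rule split2)
  with fs have fs': "map fst a' = map fst a" "fst x = p" "fst y = q" "map fst b' = map fst b"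
    by (simp_all add: append_eq_append_conv)
  define d1 d2 where "d1 = snd x" "d2 = snd y"
  have s: "s = a' @ (p, d1) # (q, d2) # b'" "map fst a' = map fst a" "map fst b' = map fst b"
    using s'(1) fs' by (auto simp: d1_d2_def)
  have len: "length a' = length a" "length b' = length b"
    using s'(2) map_eq_imp_length_eq[OF fs'(4)] by simp_all
  have 0: "flow c (zip_colours (a @ (p, c1) # (q, c2) # b) s) = 0" for c
    using crun_flow[OF X(1) X'(1), of c] er(1) by simp
  have t0: "flow c (zip_colours (a @ (q, c2) # (p, c1) # b) t) = 0" if "map fst t = map fst (a @ (q, c2) # (p, c1) # b)" for c
    using crun_flow[OF X(2) X'(3), of c] er(2) that by simp
  show ?thesis
  proof (cases "p = q")
    case True
    then have Z: "Z = []" using er(3) by (simp add: smoothing_def)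
    then have t: "t = s" using X'(2) by simp
    \<comment> \<open>Parallel strands: across the crossing \<open>c1\<close> and \<open>c2\<close>
      change places, while in the smoothing \<open>d1\<close> and \<open>d2\<close> do not. The flow
      of \<open>(c1, d1)\<close> survives only if \<open>d2 = d1\<close>.\<close>
    have "flow (c1, d1) (zip_colours (a @ (q, c2) # (p, c1) # b) s) = flow (c1, d1) (zip_colours (a @ (p, c1) # (q, c2) # b) s)"
      using 0 t0 fs True by (simp add: t)
    then have "d2 = d1" using X(3) len True by (auto simp: s split: if_splits)
    then show ?thesis using s t Z len True by (auto simp: csmoothing_def)
  next
    case False
    with er(3) obtain f where Z: "Z = [CCap (length a), CCup (length a) q f]"
      by (auto simp: smoothing_def map_erase_Cons erase_eq_simps)
    from X'(2) False len have d: "d2 = d1" and t: "t = a' @ (q, f) # (p, f) # b'"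
      unfolding Z s(1) by (auto simp: opposite_eq_iff simp del: capply.simps split: if_splits)
    \<comment> \<open>Opposite strands: the maximum already makes the two lower ends agree, and the
      flow of \<open>(c1, d1)\<close> forces the same colour on the minimum above.\<close>
    have "flow (c1, d1) (zip_colours (a @ (q, c2) # (p, c1) # b) t) = flow (c1, d1) (zip_colours (a @ (p, c1) # (q, c2) # b) s)"
      using 0 t0 s(2,3) by (simp add: t)
    then have "f = d1" using X(3) len by (auto simp: s t split: if_splits)
    then show ?thesis using s t Z len d False by (auto simp: csmoothing_def)
  qed
qed

lemma lift_flip:
  assumes "is_lift D (X @ [CCross i r] @ Y)" "events D' = map erase X @ [Cross i r'] @ map erase Y"
  shows "is_lift D' (X @ [CCross i r'] @ Y)"
proof -
  from assms(1) obtain s where "crun X [] = Some s" "crun ([CCross i r] @ Y) s = Some []"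
    unfolding is_lift_def by (metis crun_append_SomeE)
  then have "crun (X @ [CCross i r'] @ Y) [] = Some []" by simp
  then show ?thesis using assms(2) by (simp add: is_lift_def)
qed

lemma card_components_flip:
  assumes "events D = xs @ [Cross i r] @ ys" "events D' = xs @ [Cross i r'] @ ys"
  shows "card (components D) = card (components D')"
proof (rule antisym)
  have le: "card (components D) \<le> card (components D')"
    if D: "events D = xs @ [Cross i r] @ ys" "events D' = xs @ [Cross i r'] @ ys" for D D' r r'
  proof -
    from is_lift_universal[of D] have "map erase (universal D) = xs @ [Cross i r] @ ys" using D(1) by (simp add: is_lift_def)
    then obtain X A Y where X: "universal D = X @ A @ Y" "map erase X = xs" "map erase A = [Cross i r]" "map erase Y = ys"
      by (rule map_erase_append3)
    from X(3) have A: "A = [CCross i r]" by (auto simp: map_erase_Cons erase_eq_simps)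
    have "is_lift D' (X @ [CCross i r'] @ Y)"
      using lift_flip[of D X i r Y D' r'] is_lift_universal[of D] X A D(2) by simp
    from lift_card_le[OF this] show ?thesis
      unfolding colours_universal[of D, symmetric] X(1) A by simp
  qed
  from assms show "card (components D) \<le> card (components D')" by (rule le)
  from assms(2,1) show "card (components D') \<le> card (components D)" by (rule le)
qed

lemma extended_homflypt_skein:
  assumes R: "regular_homflypt R" and con: "conway_triple k i Lpos Lneg Lzero" and mix: "mixed_crossing Lpos k i"
  shows "extended_homflypt R Lpos - extended_homflypt R Lneg = z_var * extended_homflypt R Lzero"
proof -
  from con obtain xs ys s0 where con: "length xs = k" "run xs [] = Some s0" "Suc i < length s0"
     "events Lpos = xs @ [Cross i (s0 ! i = s0 ! Suc i)] @ ys"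
     "events Lneg = xs @ [Cross i (s0 ! i \<noteq> s0 ! Suc i)] @ ys"
     "events Lzero = xs @ smoothing i (s0 ! i) (s0 ! Suc i) @ ys"
    unfolding conway_triple_def by blast
  define r where "r = (s0 ! i = s0 ! Suc i)"
  from is_lift_universal con(4) obtain X A Y s t where U: "universal Lpos = X @ A @ Y" "map erase X = xs" "map erase A = [Cross i r]" "map erase Y = ys"
    "crun X [] = Some s" "crun A s = Some t" "crun Y t = Some []" "run xs [] = Some (map fst s)" unfolding r_def by (rule lift_split)
  have A: "A = [CCross i r]" using U(3) by (auto simp: map_erase_Cons erase_eq_simps)
  have s0: "s0 = map fst s" using U(8) con(2) by simp
  have "Suc i < length s" using con(3) s0 by simp
  then obtain a x x' b where s: "s = a @ x # x' # b" "length a = i" by (rule split2)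
  obtain p c1 q c2 where x: "x = (p, c1)" "x' = (q, c2)" by (cases x; cases x')
  have pq: "s0 ! i = p" "s0 ! Suc i = q" using s x by (simp_all add: s0 nth_append)
  have t: "t = a @ (q, c2) # (p, c1) # b" using U(6) s x by (simp add: A del: capply.simps)
  have len: "length X = k" using U(2) con(1) by auto
  have c12: "c1 \<noteq> c2"
    using mixed_crossing_universal[of Lpos X i r Y s] mix U(1,5) A s x len by (simp add: nth_append)
  let ?C = "components Lpos - {c2}"
  have cX: "c1 \<in> colours X" "c2 \<in> colours X" using crun_colours[OF U(5)] s x by auto
  then have cC: "c1 \<in> components Lpos" "c2 \<in> components Lpos"
    unfolding colours_universal[of Lpos, symmetric] U(1) by auto
  then have C: "insert c2 ?C = components Lpos" by auto
  let ?N = "X @ CCross i (\<not> r) # Y"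
  have negev: "events Lneg = xs @ [Cross i (\<not> r)] @ ys" using con(5) by (simp add: r_def)
  have N: "is_lift Lneg ?N"
    using lift_flip[of Lpos X i r Y Lneg "\<not> r"] is_lift_universal[of Lpos] U A negev by simp
  have colN: "colours ?N = components Lpos" unfolding colours_universal[of Lpos, symmetric] U(1) A by simp
  have "full_lift Lneg ?N"
    using N colN card_components_flip[OF con(4)[folded r_def] negev] by (simp add: full_lift_def)
  then have HN: "extended_homflypt R Lneg = lift_sum R ?N" by (simp add: lift_sum_full)
  \<comment> \<open>\<open>m\<close> merges \<open>c2\<close> into \<open>c1\<close>, as the
    smoothing makes one component of the two.\<close>
  define m where "m c = (if c = c2 then c1 else c)" for c
  let ?s = "recolour_level m s" and ?t = "recolour_level m t"
  let ?Z = "csmoothing i p q c1"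
  let ?V = "recolour m X @ ?Z @ recolour m Y"
  have m: "m c1 = c1" "m c2 = c1" by (simp_all add: m_def)
  have sm: "?s = recolour_level m a @ (p, c1) # (q, c1) # recolour_level m b"
    "?t = recolour_level m a @ (q, c1) # (p, c1) # recolour_level m b"
    by (simp_all add: s x t m)
  have runV: "crun (recolour m X) [] = Some ?s" "crun ?Z ?s = Some ?t" "crun (recolour m Y) ?t = Some []"
    using crun_recolour[OF U(5), of m] crun_recolour[OF U(7), of m] crun_csmoothing[of "recolour_level m a" i] s(2) by (simp_all add: sm)
  have V: "is_lift Lzero ?V"
    using runV con(6) U(2,4) by (simp add: is_lift_def pq)
  have colV: "colours ?V = ?C"
  proof -
    have "colours ?Z \<subseteq> {c1}" by (simp add: csmoothing_def)
    moreover have "c1 \<in> m ` colours X" using cX m by (metis imageI)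
    ultimately have "colours ?V = m ` (colours X \<union> colours Y)" by auto
    also have "colours X \<union> colours Y = components Lpos" unfolding colours_universal[of Lpos, symmetric] U(1) A by simp
    also have "m ` components Lpos = ?C" using cC c12 by (auto simp: m_def)
    finally show ?thesis .
  qed
  \<comment> \<open>The smoothed diagram has no further components: by
    \<open>smoothing_colours\<close> the strands at the smoothing share a colour, so its universal
    colouring also colours \<open>Lpos\<close>, and it does not distinguish \<open>c1\<close> from
    \<open>c2\<close>.\<close>
  have "card (components Lzero) \<le> card ?C"
  proof -
    from is_lift_universal con(6) obtain X0 Z0 Y0 s' t' where U0: "universal Lzero = X0 @ Z0 @ Y0" "map erase X0 = xs"
      "map erase Z0 = smoothing i (s0 ! i) (s0 ! Suc i)" "map erase Y0 = ys"
      "crun X0 [] = Some s'" "crun Z0 s' = Some t'" "crun Y0 t' = Some []" by (rule lift_split)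
    have "\<exists>a' b' c. length a' = length a \<and> s' = a' @ (p, c) # (q, c) # b' \<and> t' = a' @ (q, c) # (p, c) # b' \<and> Z0 = csmoothing (length a) p q c"
      using U0 U(2,4,5,7) s x t pq c12 by (intro smoothing_colours[of X a p c1 q c2 b Y X0 s' Z0 t' Y0]) simp_all
    then obtain a' b' c where c: "length a' = i" "s' = a' @ (p, c) # (q, c) # b'" "t' = a' @ (q, c) # (p, c) # b'" "Z0 = csmoothing i p q c"
      using s(2) by auto
    let ?P = "X0 @ [CCross i r] @ Y0"
    have P: "is_lift Lpos ?P"
      using U0 c con(4) by (simp add: is_lift_def r_def del: capply.simps)
    have "c \<in> colours X0" using crun_colours[OF U0(5)] c(2) by auto
    then have colP: "colours ?P = components Lzero"
      unfolding colours_universal[of Lzero, symmetric] U0(1) c(4) by (auto simp: csmoothing_def)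
    from P obtain f where f: "?P = recolour f (universal Lpos)" by (rule lift_universal)
    have "length X0 = length (recolour f X)" using U0(2) U(2) by (metis length_map)
    then have "X0 = recolour f X" using f by (simp add: U(1) A)
    then have "s' = recolour_level f s" using U0(5) crun_recolour[OF U(5), of f] by simp
    then have "f c1 = c" "f c2 = c"
      using c(1,2) s x by (auto simp: append_eq_append_conv)
    then have "f ` components Lpos = f ` ?C" using cC c12 by (auto simp: image_iff)
    moreover have "colours ?P = f ` components Lpos"
      unfolding f by (simp add: colours_universal)
    ultimately have "components Lzero = f ` ?C" using colP by simp
    then show ?thesis by (simp add: card_image_le)
  qed
  with lift_card_le[OF V] colV have "full_lift Lzero ?V" using V by (simp add: full_lift_def)
  then have HZ: "extended_homflypt R Lzero = lift_sum R ?V" by (simp add: lift_sum_full)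
  have subU: "sublink (universal Lpos) S = map erase (sub (\<lambda>c. c \<in> S) X []) @ map erase (sub (\<lambda>c. c \<in> S) [CCross i r] s) @ map erase (sub (\<lambda>c. c \<in> S) Y t)" for S
    unfolding sublink_def U(1) sub_three[OF U(5,6)] by (simp add: A del: sub.simps)
  have runN: "crun [CCross i (\<not> r)] s = Some t" using U(6) A by simp
  have subN: "sublink ?N S = map erase (sub (\<lambda>c. c \<in> S) X []) @ map erase (sub (\<lambda>c. c \<in> S) [CCross i (\<not> r)] s) @ map erase (sub (\<lambda>c. c \<in> S) Y t)" for S
    using sub_three[OF U(5) runN, of "\<lambda>c. c \<in> S" Y] by (simp add: sublink_def del: sub.simps)
  have subV: "sublink ?V S = map erase (sub (\<lambda>c. m c \<in> S) X []) @ (if c1 \<in> S then smoothing (length (keep (\<lambda>c. m c \<in> S) a)) p q else []) @ map erase (sub (\<lambda>c. m c \<in> S) Y t)" for S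
  proof -
    have "sub (\<lambda>c. c \<in> S) ?Z ?s = (if c1 \<in> S then csmoothing (length (keep (\<lambda>c. c \<in> S) (recolour_level m a))) p q c1 else [])"
      unfolding sm by (rule sub_csmoothing) (simp add: s(2))
    moreover have "sub (\<lambda>c. c \<in> S) (recolour m X) [] = recolour m (sub (\<lambda>c. m c \<in> S) X [])"
      using sub_recolour[OF U(5), of "\<lambda>c. c \<in> S" m] by simp
    moreover have "sub (\<lambda>c. c \<in> S) (recolour m Y) ?t = recolour m (sub (\<lambda>c. m c \<in> S) Y t)"
      by (rule sub_recolour[OF U(7)])
    ultimately show ?thesis
      unfolding sublink_def sub_three[OF runV(1,2)] by (simp add: comp_def)
  qed
  have cross: "sub T [CCross i r'] s = (if T c1 \<and> T c2 then [CCross (length (keep T a)) r'] else [])" for T r'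
    using s x by (simp del: capply.simps sub1.simps)
  let ?ps = "partition_sum y_par (E_pow (- 1)) (include_wa eta)"
  have sk: "?ps (insert c2 ?C) (\<lambda>S. include_wa (on_word R (sublink (universal Lpos) S))) -
      ?ps (insert c2 ?C) (\<lambda>S. include_wa (on_word R (sublink ?N S))) =
      y_par * include_wa w_var * ?ps ?C (\<lambda>S. include_wa (on_word R (sublink ?V S)))"
  proof (rule partition_sum_skein[where b = c1])
    fix S assume S: "S \<subseteq> insert c2 ?C" "S \<noteq> {}" "\<not> (c1 \<in> S \<and> c2 \<in> S)"
    then show "include_wa (on_word R (sublink (universal Lpos) S)) = include_wa (on_word R (sublink ?N S))"
      by (auto simp: subU subN cross simp del: sub.simps)
  next
    fix S assume S: "S \<subseteq> ?C" "S \<noteq> {}" "c1 \<notin> S"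
    then have "(\<lambda>c. m c \<in> S) = (\<lambda>c. c \<in> S)" by (auto simp: m_def fun_eq_iff)
    with S show "include_wa (on_word R (sublink ?V S)) = include_wa (on_word R (sublink (universal Lpos) S))"
      by (simp add: subU subV cross del: sub.simps)
  next
    fix S assume S: "S \<subseteq> ?C" "c1 \<in> S"
    let ?S = "insert c2 S"
    \<comment> \<open>A block with the merged component corresponds to one containing both
      \<open>c1\<close> and \<open>c2\<close>, whose sublink still has the crossing: here the skein
      relation of \<open>R\<close> applies.\<close>
    have T: "m c \<in> S \<longleftrightarrow> c \<in> ?S" for c using S(2) by (auto simp: m_def)
    have r: "r = (p = q)" by (simp add: r_def pq)
    let ?T = "\<lambda>c. c \<in> ?S" 
    let ?u = "map erase (sub ?T X [])" and ?q = "map erase (sub ?T Y t)" and ?j = "length (keep ?T a)"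
    let ?l = "map fst (keep ?T s)"
    have l: "run ?u [] = Some ?l" using crun_erase[OF crun_sub[OF U(5), of ?T]] by simp
    have nth: "?l ! ?j = p" "?l ! Suc ?j = q" "Suc ?j < length ?l"
      using s x S(2) by (simp_all add: nth_append)
    have eqs: "sublink (universal Lpos) ?S = ?u @ [Cross ?j r] @ ?q"
      "sublink ?N ?S = ?u @ [Cross ?j (\<not> r)] @ ?q" "sublink ?V S = ?u @ smoothing ?j p q @ ?q"
      using S(2) by (simp_all add: subU subN subV T cross del: sub.simps)
    have "closed (sublink (universal Lpos) ?S)"
      using S cC by (intro closed_sublink[OF is_lift_universal]) (auto simp: colours_universal)
    then have cl: "closed (?u @ [Cross ?j True] @ ?q)"
      unfolding eqs using l nth(3) by (auto simp: closed_def run_append)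
    have "on_word R (sublink (universal Lpos) ?S) - on_word R (sublink ?N ?S) = w_var * on_word R (sublink ?V S)"
      using skein_invariant_skein[OF regular_homflypt_skein_invariant[OF R] l nth(3) cl] unfolding nth eqs unfolding r .
    then show "include_wa (on_word R (sublink (universal Lpos) ?S)) - include_wa (on_word R (sublink ?N ?S)) = include_wa w_var * include_wa (on_word R (sublink ?V S))"
      by (simp flip: include_wa_diff include_wa_mult)
  qed (use cC c12 in auto)
  show ?thesis
    unfolding HN HZ unfolding extended_homflypt_def lift_sum_def colN colV colours_universal
    using sk[unfolded C y_par_w] .
qed

subsection \<open>Split unions\<close>

lemma sub_True: 
  "crun W s = Some t \<Longrightarrow> sub (\<lambda>_. True) W s = W"
proof (induction W arbitrary: s)
  case (Cons e W)
  then obtain r where r: "capply e s = Some r" "crun W r = Some t" by (rule_tac crun_ConsE)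
  have "sub1 (\<lambda>_. True) e s = [e]" using r(1) by (cases e) (auto split: if_splits)
  then show ?case using Cons.IH[OF r(2)] r(1) by simp
qed simp

lemma sub_False: "sub (\<lambda>_. False) W s = []"
proof (induction W arbitrary: s)
  case (Cons e W)
  have "sub1 (\<lambda>_. False) e s = []" by (cases e) auto
  then show ?case using Cons by simp
qed simp

definition constant_lift :: "'c \<Rightarrow> link_diagram \<Rightarrow> 'c cevent list" where
  "constant_lift c K = recolour (\<lambda>_. c) (universal K)"

lemma constant_lift: "is_lift K (constant_lift c K)" "colours (constant_lift c K) = {c}"
  using is_lift_recolour[OF is_lift_universal] components_nonempty[of K]
  by (auto simp: constant_lift_def colours_universal)

lemma sub_constant_lift:
  "map erase (sub T (constant_lift c K) []) = (if T c then events K else [])"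
proof -
  have run: "crun (constant_lift c K) [] = Some []" using constant_lift(1)[of K c] by (simp add: is_lift_def)
  have "sub T (constant_lift c K) [] = sub (\<lambda>_. T c) (constant_lift c K) []"
    by (rule sub_cong[OF run]) (simp add: constant_lift(2))
  then show ?thesis
    using constant_lift(1)[of K c] sub_True[OF run] by (cases "T c") (auto simp: sub_False is_lift_def)
qed

definition split_lift :: "('c \<times> link_diagram) list \<Rightarrow> 'c cevent list" where
  "split_lift Ls = concat (map (\<lambda>(c, K). constant_lift c K) Ls)"

lemma split_lift:
  "crun (split_lift Ls) [] = Some []" "map erase (split_lift Ls) = concat (map (events \<circ> snd) Ls)"
  "colours (split_lift Ls) = fst ` set Ls"
  "map erase (sub T (split_lift Ls) []) = concat (map (events \<circ> snd) (filter (T \<circ> fst) Ls))"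
proof (induction Ls)
  case (Cons L Ls)
  obtain c K where L: "L = (c, K)" by force
  have K: "crun (constant_lift c K) [] = Some []" "map erase (constant_lift c K) = events K"
    using constant_lift(1)[of K c] by (auto simp: is_lift_def)
  have s: "split_lift ((c, K) # Ls) = constant_lift c K @ split_lift Ls" by (simp add: split_lift_def)
  case 1 show ?case using Cons.IH(1) K by (simp add: s L)
  case 2 show ?case using Cons.IH(2) K by (simp add: s L)
  case 3 show ?case using Cons.IH(3) by (simp add: s L constant_lift)
  case 4 show ?case using Cons.IH(4) by (simp add: s L sub_append[OF K(1)] sub_constant_lift)
qed (simp_all add: split_lift_def)

text \<open>The level between two stacked diagrams is empty, so a colouring of the stack restricts
  to colourings of its parts.\<close>

lemma card_components_concat_le:
  assumes "crun W [] = Some []" "map erase W = concat (map events Ks)"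
  shows "card (colours W) \<le> sum_list (map (\<lambda>K. card (components K)) Ks)"
  using assms
proof (induction Ks arbitrary: W)
  case (Cons K Ks)
  then have "map erase W = events K @ concat (map events Ks)" by simp
  from this[unfolded map_eq_append_conv] obtain X Y where X: "W = X @ Y" "events K = map erase X" "concat (map events Ks) = map erase Y"
    by blast
  from Cons.prems(1) X(1) obtain s where s: "crun X [] = Some s" "crun Y s = Some []"
    by (metis crun_append_SomeE)
  have "s = []" using crun_erase[OF s(1)] closed_events[of K] X(2) by (simp add: closed_def)
  then have "is_lift K X" "card (colours Y) \<le> sum_list (map (\<lambda>K. card (components K)) Ks)"
    using s X Cons.IH[of Y] by (simp_all add: is_lift_def)
  moreover from this(1) have "card (colours X) \<le> card (components K)" by (rule lift_card_le)
  ultimately show ?case using card_Un_le[of "colours X" "colours Y"] X(1) by simp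
qed simp

lemma card_components_concat:
  assumes "events D = concat (map events Ks)"
  shows "card (components D) = sum_list (map (\<lambda>K. card (components K)) Ks)"
proof (rule antisym)
  show "card (components D) \<le> sum_list (map (\<lambda>K. card (components K)) Ks)"
    using card_components_concat_le[of "universal D" Ks] is_lift_universal[of D] assms
    by (simp add: is_lift_def colours_universal)
  \<comment> \<open>Tagging the components with the index of their diagram keeps the colours of
    different diagrams apart, so that none is lost in the count.\<close>
  define W where "W = concat (map (\<lambda>j. recolour (Pair j) (universal (Ks ! j))) [0..<length Ks])"
  have U: "crun (recolour (Pair j) (universal K)) [] = Some []" "map erase (recolour (Pair j) (universal K)) = events K" for j :: nat and K
    using is_lift_recolour[OF is_lift_universal, of K "Pair j"] by (simp_all add: is_lift_def)
  have "crun (concat (map (\<lambda>j. recolour (Pair j) (universal (Ks ! j))) js)) [] = Some []" for js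
    by (induction js) (simp_all add: U(1))
  moreover have "map erase (concat (map (\<lambda>j. recolour (Pair j) (universal (Ks ! j))) js)) = concat (map (\<lambda>j. events (Ks ! j)) js)" for js
    by (induction js) (simp_all add: U(2) del: map_map)
  then have "map erase W = concat (map (\<lambda>j. events (Ks ! j)) [0..<length Ks])"
    by (simp only: W_def)
  moreover have "map (\<lambda>j. events (Ks ! j)) [0..<length Ks] = map events Ks"
    by (rule nth_equalityI) auto
  ultimately have W: "is_lift D W" using assms by (simp add: is_lift_def W_def)
  have "colours W = (\<Union>j < length Ks. Pair j ` components (Ks ! j))"
  proof -
    have "colours (concat (map (\<lambda>j. recolour (Pair j) (universal (Ks ! j))) js)) = (\<Union>j \<in> set js. Pair j ` components (Ks ! j))" for js
      by (induction js) (simp_all add: colours_universal)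
    from this[of "[0..<length Ks]"] show ?thesis by (simp add: W_def atLeast0LessThan)
  qed
  also have "card \<dots> = (\<Sum>j < length Ks. card (Pair j ` components (Ks ! j)))"
    by (rule card_UN_disjoint) auto
  also have "\<dots> = (\<Sum>j < length Ks. card (components (Ks ! j)))"
    by (simp add: card_image inj_on_def)
  also have "\<dots> = sum_list (map (\<lambda>K. card (components K)) Ks)"
    by (simp add: sum_list_sum_nth atLeast0LessThan)
  finally show "sum_list (map (\<lambda>K. card (components K)) Ks) \<le> card (components D)"
    using lift_card_le[OF W] by simp
qed

lemma closed_concat: "Ks \<noteq> [] \<Longrightarrow> closed (concat (map events Ks))"
proof (induction Ks rule: list_nonempty_induct)
  case (cons K Ks)
  then show ?case by (simp add: closed_append)
qed simp

lemma regular_homflypt_concat: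
  assumes R: "regular_homflypt R" and "Ks \<noteq> []"
  shows "on_word R (concat (map events Ks)) = eta ^ (length Ks - 1) * prod_list (map R Ks)"
  using assms(2)
proof (induction Ks rule: list_nonempty_induct)
  case (cons K Ks)
  then obtain n where n: "length Ks = Suc n" by (cases Ks) auto
  have "on_word R (concat (map events (K # Ks))) = eta * R K * on_word R (concat (map events Ks))"
    using regular_homflypt_append[OF R closed_events closed_concat[OF cons.hyps], of K] by simp
  with cons.IH n show ?case by (simp add: mult_ac)
qed simp

text \<open>Every sublink is again a stack of knots, on which \<open>R\<close> is a product with a
  power of \<open>eta\<close>: the hypothesis of \<open>partition_sum_multiplicative\<close>. Its
  parameter \<open>e = E^(-1)\<close> yields the power of \<open>E\<close>.\<close>

lemma extended_homflypt_concat_knots: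
  assumes R: "regular_homflypt R" and K: "\<forall>K \<in> set Ks. knot_diagram K" and D: "events D = concat (map events Ks)"
  shows "extended_homflypt R D = E_pow (1 - int (length Ks)) * include_wa (R D)"
proof -
  let ?n = "length Ks"
  \<comment> \<open>Knots are coloured by their places in the list, as the same diagram may occur
    repeatedly.\<close>
  define Ls where "Ls = map (\<lambda>j. (j, Ks ! j)) [0..<?n]"
  have mapL: "map (events \<circ> snd) Ls = map events Ks" unfolding Ls_def by (rule nth_equalityI) auto
  have "?n \<noteq> 0" using D closed_events[of D] by (auto simp: closed_def)
  then have ne: "Ks \<noteq> []" by auto
  have lift: "is_lift D (split_lift Ls)"
    using split_lift(1,2)[of Ls] mapL D by (simp add: is_lift_def)
  have "card (components D) = sum_list (map (\<lambda>_. 1) Ks)"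
    unfolding card_components_concat[OF D] using K by (intro arg_cong[of _ _ sum_list]) (simp add: knot_diagram_def)
  then have "card (components D) = ?n" by (simp add: sum_list_triv)
  moreover have col: "colours (split_lift Ls) = {..<?n}"
    unfolding split_lift(3) Ls_def by (auto simp: image_image)
  ultimately have "full_lift D (split_lift Ls)" using lift by (simp add: full_lift_def)
  then have "extended_homflypt R D = lift_sum R (split_lift Ls)" by (simp add: lift_sum_full)
  also have "\<dots> = E_pow (- 1) ^ (card {..<?n} - 1) * include_wa (on_word R (sublink (split_lift Ls) {..<?n}))"
    unfolding lift_sum_def col
  proof (rule partition_sum_multiplicative[where \<rho> = "\<lambda>j. include_wa (R (Ks ! j))"])
    show "{..<?n} \<noteq> {}" using ne by (cases Ks) auto
    fix S assume S: "S \<subseteq> {..<?n}" "S \<noteq> {}"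
    define js where "js = filter (\<lambda>j. j \<in> S) [0..<?n]"
    have js: "set js = S" "distinct js" using S(1) by (auto simp: js_def)
    then have len: "length js = card S" by (metis distinct_card)
    have "filter ((\<lambda>j. j \<in> S) \<circ> fst) Ls = map (\<lambda>j. (j, Ks ! j)) js"
      by (simp add: Ls_def js_def filter_map comp_def)
    then have "sublink (split_lift Ls) S = concat (map events (map (\<lambda>j. Ks ! j) js))"
      by (simp add: sublink_def split_lift(4) comp_def)
    moreover have "map (\<lambda>j. Ks ! j) js \<noteq> []" using js S(2) by auto
    ultimately have "on_word R (sublink (split_lift Ls) S) = eta ^ (length js - 1) * prod_list (map (\<lambda>j. R (Ks ! j)) js)"
      using regular_homflypt_concat[OF R, of "map (\<lambda>j. Ks ! j) js"] by (simp add: comp_def)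
    also have "prod_list (map (\<lambda>j. R (Ks ! j)) js) = (\<Prod>j \<in> S. R (Ks ! j))"
      using js prod.distinct_set_conv_list[of js "\<lambda>j. R (Ks ! j)"] by simp
    finally show "include_wa (on_word R (sublink (split_lift Ls) S)) = include_wa eta ^ (card S - 1) * (\<Prod>j \<in> S. include_wa (R (Ks ! j)))"
      by (simp add: include_wa_mult include_wa_power include_wa_prod len)
  qed simp
  also have "sublink (split_lift Ls) {..<?n} = events D"
  proof -
    have "filter ((\<lambda>j. j \<in> {..<?n}) \<circ> fst) Ls = Ls" by (simp add: Ls_def filter_map comp_def)
    then show ?thesis by (simp add: sublink_def split_lift(4) mapL D)
  qed
  also have "E_pow (- 1) ^ (card {..<?n} - 1) = E_pow (1 - int ?n)"
    using \<open>?n \<noteq> 0\<close> by (simp add: E_pow_power of_nat_diff Suc_leI)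
  finally show ?thesis by simp
qed

text \<open>The stack of knots is reached by an ambient isotopy only. A curl multiplies both sides
  of the equation by the same power of \<open>a\<close>, which is invertible, so the equation is
  carried along Reidemeister I in either direction.\<close>

lemma extended_homflypt_unlinked_knots:
  assumes R: "regular_homflypt R" and "unlinked_knots r K"
  shows "extended_homflypt R K = E_pow (1 - int r) * include_wa (R K)"
proof -
  from assms(2) obtain Ks D where D: "length Ks = r" "\<forall>K \<in> set Ks. knot_diagram K"
    "events D = concat (map events Ks)" "ambient_isotopic K D"
    unfolding unlinked_knots_def by blast
  let ?P = "\<lambda>D. extended_homflypt R D = E_pow (1 - int r) * include_wa (R D)"
  have inv: "include_wa (a_pow (if b then - 1 else 1)) * (include_wa (a_pow (if b then 1 else - 1)) * p) = p" for b p
    unfolding mult.assoc[symmetric] include_wa_mult[symmetric]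
    by (simp only: mult.commute[of "a_pow (if b then - 1 else 1)"] a_pow_inverse include_wa_1 mult_1)
  have unit: "include_wa (a_pow (if b then 1 else - 1)) * p = include_wa (a_pow (if b then 1 else - 1)) * q \<longleftrightarrow> p = q" for b p q
    by (metis inv)
  have move: "?P D \<longleftrightarrow> ?P D'"
    if m: "local_move (\<lambda>u v. planar_move u v \<or> reidemeister_1 u v \<or> reidemeister_2 u v \<or> reidemeister_3 u v) D D'" for D D'
  proof -
    from m obtain xs ys u v where u: "word_move u v \<or> reidemeister_1 u v" "events D = xs @ u @ ys" "events D' = xs @ v @ ys"
      unfolding local_move_def word_move_def by blast
    from u(1) show ?thesis
    proof
      assume "word_move u v"
      then have "isotopy_move D D'" unfolding local_move_def word_move_def using u(2,3) by blast
      then have iso: "regular_isotopic D D'" unfolding regular_isotopic_def by (rule r_into_equivclp)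
      then have "R D = R D'" using R unfolding regular_homflypt_def regular_isotopy_invariant_def by blast
      with extended_homflypt_isotopic[OF R iso] show ?thesis by simp
    next
      assume "reidemeister_1 u v"
      then obtain b where b: "curl b u" "v = []" unfolding reidemeister_1_def by blast
      with u have D: "events D = xs @ u @ ys" "events D' = xs @ ys" by simp_all
      have "closed (xs @ u @ ys)" using closed_events[of D] D(1) by simp
      from skein_invariant_curl[OF regular_homflypt_skein_invariant[OF R] b(1) this]
      have RD: "R D = a_pow (if b then 1 else - 1) * R D'" by (simp only: D[symmetric] Abs_events)
      show ?thesis
        unfolding extended_homflypt_curl[OF R b(1) D] RD include_wa_mult mult.left_commute[of "E_pow _"] unit ..
    qed
  qed
  have "?P K \<longleftrightarrow> ?P D"
    using D(4) unfolding ambient_isotopic_def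
  proof (induction rule: equivclp_induct)
    case (step y z)
    then show ?case using move[of y z] move[of z y] by blast
  qed simp
  moreover have "?P D" using extended_homflypt_concat_knots[OF R D(2,3)] D(1) by simp
  ultimately show ?thesis by blast
qed

section \<open>Pulling the components apart\<close>

definition iso :: "level \<Rightarrow> level \<Rightarrow> event list \<Rightarrow> event list \<Rightarrow> bool" where
  "iso s t u v \<longleftrightarrow> run u s = Some t \<and> word_isotopic s u v"

lemma iso_run: "iso s t u v \<Longrightarrow> run u s = Some t \<and> run v s = Some t"
  unfolding iso_def using word_isotopic_run by metis

lemma iso_refl: "run u s = Some t \<Longrightarrow> iso s t u u"
  by (simp add: iso_def)

lemma iso_sym: "iso s t u v \<Longrightarrow> iso s t v u"
  using iso_run word_isotopic_sym unfolding iso_def by metis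

lemma iso_trans [trans]: "iso s t u v \<Longrightarrow> iso s t v w \<Longrightarrow> iso s t u w"
  using word_isotopic_trans unfolding iso_def by metis

lemma iso_append:
  assumes "iso s t u v" "iso t r u' v'" shows "iso s r (u @ u') (v @ v')"
proof -
  note r = iso_run[OF assms(1)] iso_run[OF assms(2)]
  have "word_isotopic s ([] @ u @ u') ([] @ v @ u')"
    using assms r by (intro word_isotopic_context) (auto simp: iso_def)
  moreover have "word_isotopic s (v @ u' @ []) (v @ v' @ [])"
    using assms r by (intro word_isotopic_context) (auto simp: iso_def)
  ultimately show ?thesis using r word_isotopic_trans by (auto simp: iso_def)
qed

lemma reduces_iso: "u \<leadsto> v \<Longrightarrow> run u s = Some t \<Longrightarrow> iso s t u v"
  by (simp add: iso_def reduces_def)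

lemma word_step_append_right: "word_step s u v \<Longrightarrow> word_step (s @ d) u v"
  using run_append_right[of u s _ d] run_append_right[of v s _ d] unfolding word_step_def by blast

lemma word_isotopic_append_right: "word_isotopic s u v \<Longrightarrow> word_isotopic (s @ d) u v"
  unfolding word_isotopic_def
proof (induction rule: equivclp_induct)
  case (step v w)
  then have "word_step (s @ d) v w \<or> word_step (s @ d) w v" using word_step_append_right by blast
  with step(3) show ?case by (rule equivclp_into_equivclp)
qed simp

lemma iso_append_right: "iso s t u v \<Longrightarrow> iso (s @ d) (t @ d) u v"
  by (simp add: iso_def run_append_right word_isotopic_append_right)

lemma exchange_event_word:
  assumes "apply_event e x = Some x'"
  shows "e # map (shift (length x')) w \<leadsto> map (shift (length x)) w @ [e]"
proof (induction w)
  case (Cons f w)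
  have "e # map (shift (length x')) (f # w) = [e, shift (length x') f] @ map (shift (length x')) w" by simp
  also have "\<dots> \<leadsto> [shift (length x) f, e] @ map (shift (length x')) w"
    by (intro reduces_suffix exchange_event assms)
  also have "\<dots> = shift (length x) f # (e # map (shift (length x')) w)" by simp
  also have "\<dots> \<leadsto> shift (length x) f # (map (shift (length x)) w @ [e])"
    by (intro reduces_Cons Cons.IH)
  finally show ?case by simp
qed simp

lemma exchange_word_event:
  "run u x = Some x' \<Longrightarrow> u @ [shift (length x') w] \<leadsto> shift (length x) w # u"
proof (induction u arbitrary: x)
  case (Cons e u)
  then obtain r where r: "apply_event e x = Some r" "run u r = Some x'" by (rule_tac run_ConsE)
  have "(e # u) @ [shift (length x') w] = e # (u @ [shift (length x') w])" by simp
  also have "\<dots> \<leadsto> e # (shift (length r) w # u)"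
    by (intro reduces_Cons Cons.IH r)
  also have "\<dots> = [e, shift (length r) w] @ u" by simp
  also have "\<dots> \<leadsto> [shift (length x) w, e] @ u"
    by (intro reduces_suffix exchange_event r)
  finally show ?case by simp
qed simp

text \<open>The strands at \<open>m\<close> and \<open>m + 1\<close> both travel over the next
  \<open>n\<close> strands, the right one first.\<close>

definition double_overpass :: "nat \<Rightarrow> nat \<Rightarrow> event list" where
  "double_overpass m n = overpass (Suc m) n @ overpass m n"

text \<open>The two strands take turns instead, passing over one strand at a time; this form suits
  induction on \<open>n\<close>.\<close>

lemma double_overpass_Suc:
  "double_overpass m (Suc n) \<leadsto> [Cross (Suc m) True, Cross m True] @ double_overpass (Suc m) n"
  "[Cross (Suc m) True, Cross m True] @ double_overpass (Suc m) n \<leadsto> double_overpass m (Suc n)"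
proof -
  have eq: "double_overpass m (Suc n) = [Cross (Suc m) True] @ (overpass (m + strands_in (Cross m True)) n @ [Cross m True]) @ overpass (Suc m) n"
    by (simp add: double_overpass_def)
  have eq': "[Cross (Suc m) True, Cross m True] @ double_overpass (Suc m) n =
     [Cross (Suc m) True] @ (Cross m True # overpass (m + strands_out (Cross m True)) n) @ overpass (Suc m) n"
    by (simp add: double_overpass_def)
  show "double_overpass m (Suc n) \<leadsto> [Cross (Suc m) True, Cross m True] @ double_overpass (Suc m) n"
    unfolding eq eq' by (intro reduces_context overpass_exchange_left) simp
  show "[Cross (Suc m) True, Cross m True] @ double_overpass (Suc m) n \<leadsto> double_overpass m (Suc n)"
    unfolding eq eq' by (intro reduces_context overpass_exchange_left) simp
qed

lemma double_overpass_cup: "Cup m d # double_overpass m n \<leadsto> [Cup (m + n) d]"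
proof (induction n arbitrary: m)
  case (Suc n)
  have "Cup m d # double_overpass m (Suc n) \<leadsto> Cup m d # ([Cross (Suc m) True, Cross m True] @ double_overpass (Suc m) n)"
    by (intro reduces_Cons double_overpass_Suc)
  also have "\<dots> = [Cup m d, Cross (Suc m) True] @ ([Cross m True] @ double_overpass (Suc m) n)" by simp
  also have "\<dots> \<leadsto> [Cup (Suc m) d, Cross m (\<not> True)] @ ([Cross m True] @ double_overpass (Suc m) n)"
    by (intro reduces_suffix red_through_cup)
  also have "\<dots> = [Cup (Suc m) d] @ [Cross m (\<not> True), Cross m True] @ double_overpass (Suc m) n" by simp
  also have "\<dots> \<leadsto> [Cup (Suc m) d] @ [] @ double_overpass (Suc m) n"
    by (intro reduces_context red_reidemeister_2) simp
  also have "\<dots> = Cup (Suc m) d # double_overpass (Suc m) n" by simp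
  also have "\<dots> \<leadsto> [Cup (Suc m + n) d]" by (rule Suc.IH)
  finally show ?case by simp
qed (simp add: double_overpass_def)

lemma double_overpass_cap: "double_overpass m n @ [Cap (m + n)] \<leadsto> [Cap m]"
proof (induction n arbitrary: m)
  case (Suc n)
  have "double_overpass m (Suc n) @ [Cap (Suc m + n)] \<leadsto> ([Cross (Suc m) True, Cross m True] @ double_overpass (Suc m) n) @ [Cap (Suc m + n)]"
    by (intro reduces_suffix double_overpass_Suc)
  also have "\<dots> = [Cross (Suc m) True, Cross m True] @ (double_overpass (Suc m) n @ [Cap (Suc m + n)])" by simp
  also have "\<dots> \<leadsto> [Cross (Suc m) True, Cross m True] @ [Cap (Suc m)]"
    by (intro reduces_prefix Suc.IH)
  also have "\<dots> = [Cross (Suc m) True] @ [Cross m True, Cap (Suc m)]" by simp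
  also have "\<dots> \<leadsto> [Cross (Suc m) True] @ [Cross (Suc m) (\<not> True), Cap m]"
    by (intro reduces_prefix red_through_cap)
  also have "\<dots> = [Cross (Suc m) True, Cross (Suc m) (\<not> True)] @ [Cap m]" by simp
  also have "\<dots> \<leadsto> [] @ [Cap m]"
    by (intro reduces_suffix red_reidemeister_2) simp
  finally show ?case by simp
qed (simp add: double_overpass_def)

lemma double_overpass_cross: "double_overpass m n @ [Cross (m + n) b] \<leadsto> Cross m b # double_overpass m n"
proof (induction n arbitrary: m)
  case (Suc n)
  have "double_overpass m (Suc n) @ [Cross (Suc m + n) b] \<leadsto> ([Cross (Suc m) True, Cross m True] @ double_overpass (Suc m) n) @ [Cross (Suc m + n) b]"
    by (intro reduces_suffix double_overpass_Suc)
  also have "\<dots> = [Cross (Suc m) True, Cross m True] @ (double_overpass (Suc m) n @ [Cross (Suc m + n) b])" by simp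
  also have "\<dots> \<leadsto> [Cross (Suc m) True, Cross m True] @ (Cross (Suc m) b # double_overpass (Suc m) n)"
    by (intro reduces_prefix Suc.IH)
  also have "\<dots> = [Cross (Suc m) True, Cross m True, Cross (Suc m) b] @ double_overpass (Suc m) n" by simp
  also have "\<dots> \<leadsto> [Cross m b, Cross (Suc m) True, Cross m True] @ double_overpass (Suc m) n"
    by (intro reduces_suffix red_reidemeister_3) simp
  also have "\<dots> = Cross m b # ([Cross (Suc m) True, Cross m True] @ double_overpass (Suc m) n)" by simp
  also have "\<dots> \<leadsto> Cross m b # double_overpass m (Suc n)"
    by (intro reduces_Cons double_overpass_Suc)
  finally show ?case by simp
qed (simp add: double_overpass_def)

text \<open>\<open>shuffle T s\<close> is the braid that leads from the level with all \<open>T\<close>-strands to the left of the others to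
  the level \<open>s\<close>, the \<open>T\<close>-strands passing over the others.\<close>

abbreviation others :: "('c \<Rightarrow> bool) \<Rightarrow> 'c clevel \<Rightarrow> 'c clevel" where
  "others T s \<equiv> keep (\<lambda>c. \<not> T c) s"

text \<open>Recursion from the right end of the level: the last strand, if it satisfies
  \<open>T\<close>, passes over all the others at once, and everything else happens to its
  left.\<close>

primrec shuffle_rev :: "('c \<Rightarrow> bool) \<Rightarrow> 'c clevel \<Rightarrow> event list" where
  "shuffle_rev T [] = []"
| "shuffle_rev T (x # s) = (if T (snd x) then overpass (length (keep T s)) (length (others T s)) else []) @ shuffle_rev T s"

definition shuffle :: "('c \<Rightarrow> bool) \<Rightarrow> 'c clevel \<Rightarrow> event list" where
  "shuffle T s = shuffle_rev T (rev s)"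

definition sorted_level :: "('c \<Rightarrow> bool) \<Rightarrow> 'c clevel \<Rightarrow> level" where
  "sorted_level T s = map fst (keep T s @ others T s)"

lemma shuffle_simps [simp]: "shuffle T [] = []"
  "shuffle T (s @ [x]) = (if T (snd x) then overpass (length (keep T s)) (length (others T s)) else []) @ shuffle T s"
  by (simp_all add: shuffle_def flip: rev_filter)

lemma shuffle_two:
  "shuffle T (s @ [x, y]) = (if T (snd x) then
      if T (snd y) then double_overpass (length (keep T s)) (length (others T s)) else overpass (length (keep T s)) (length (others T s))
      else if T (snd y) then overpass (length (keep T s)) (Suc (length (others T s))) else []) @ shuffle T s"
  using shuffle_simps(2)[of T "s @ [x]" y] by (simp add: double_overpass_def)

lemma length_sorted_level [simp]: "length (sorted_level T s) = length s"
  by (simp add: sorted_level_def sum_length_filter_compl)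

lemma run_shuffle: "run (shuffle T s) (sorted_level T s) = Some (map fst s)"
proof (induction s rule: rev_induct)
  case (snoc x s)
  show ?case
  proof (cases "T (snd x)")
    case True
    have "run (overpass (length (keep T s)) (length (others T s))) (map fst (keep T s) @ fst x # map fst (others T s) @ []) = 
        Some (map fst (keep T s) @ map fst (others T s) @ fst x # [])"
      by (rule run_overpass) simp_all
    then show ?thesis using run_append_right[OF snoc.IH, of "[fst x]"] True by (simp add: sorted_level_def)
  next
    case False
    then show ?thesis using run_append_right[OF snoc.IH, of "[fst x]"] by (simp add: sorted_level_def)
  qed
qed (simp add: sorted_level_def)

fun over :: "('c \<Rightarrow> bool) \<Rightarrow> 'c cevent \<Rightarrow> 'c clevel \<Rightarrow> bool" where
  "over T (CCross i b) s \<longleftrightarrow>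
     (T (snd (s ! i)) \<and> \<not> T (snd (s ! Suc i)) \<longrightarrow> b) \<and> (\<not> T (snd (s ! i)) \<and> T (snd (s ! Suc i)) \<longrightarrow> \<not> b)"
| "over T _ s \<longleftrightarrow> True"

text \<open>What the event becomes on the sorted level: it acts in the \<open>T\<close>-part or,
  shifted, in the other part. A crossing between the parts disappears, being absorbed by the change
  of the shuffle.\<close>

definition separated :: "('c \<Rightarrow> bool) \<Rightarrow> 'c cevent \<Rightarrow> 'c clevel \<Rightarrow> event list" where
  "separated T e s = map erase (sub1 T e s) @ map (shift (length (keep T s))) (map erase (sub1 (\<lambda>c. \<not> T c) e s))"

lemma run_separated:
  assumes "capply e s = Some t"
  shows "run (separated T e s) (sorted_level T s) = Some (sorted_level T t)"
proof -
  have 1: "run (map erase (sub1 T e s)) (map fst (keep T s)) = Some (map fst (keep T t))"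
    by (rule crun_erase[OF crun_sub1[OF assms]])
  have 2: "run (map erase (sub1 (\<lambda>c. \<not> T c) e s)) (map fst (others T s)) = Some (map fst (others T t))"
    by (rule crun_erase[OF crun_sub1[OF assms]])
  have "sub1 (\<lambda>c. \<not> T c) e s = [] \<or> length (keep T t) = length (keep T s)"
  proof -
    have "sub1 (\<lambda>c. \<not> T c) e s = [] \<or> sub1 T e s = []" by (cases e) auto
    then show ?thesis using crun_sub1[OF assms, of T] by auto
  qed
  then have "run (map (shift (length (keep T s))) (map erase (sub1 (\<lambda>c. \<not> T c) e s))) (map fst (keep T t) @ map fst (others T s)) = 
      Some (map fst (keep T t) @ map fst (others T t))"
    using run_shift[of "map fst (keep T t)" "length (keep T t)" "map erase (sub1 (\<lambda>c. \<not> T c) e s)" "map fst (others T s)"] 2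
    by auto
  with run_append_right[OF 1, of "map fst (others T s)"] show ?thesis
    by (simp add: separated_def sorted_level_def)
qed

section \<open>Moving an event through the shuffle\<close>

lemma shuffle_top_cup:
  assumes "capply (CCup (length s) d c) s = Some t"
  shows "iso (sorted_level T s) (map fst t) (shuffle T s @ [Cup (length s) d]) (separated T (CCup (length s) d c) s @ shuffle T t)"
proof -
  have t: "t = s @ [(d, c), (opposite d, c)]" using assms by simp
  let ?m = "length (keep T s)" and ?n = "length (others T s)"
  have mn: "?m + ?n = length s" by (rule sum_length_filter_compl)
  have run: "run (shuffle T s @ [Cup (length s) d]) (sorted_level T s) = Some (map fst t)"
    using run_shuffle[of T s] by (simp add: t)
  have "shuffle T s @ [Cup (length s) d] \<leadsto> Cup (length s) d # shuffle T s"
    using exchange_word_event[OF run_shuffle[of T s], of "Cup 0 d"] by simp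
  then have 1: "iso (sorted_level T s) (map fst t) (shuffle T s @ [Cup (length s) d]) (Cup (length s) d # shuffle T s)"
    using run by (rule reduces_iso)
  show ?thesis
  proof (cases "T c")
    case True
    have eq: "separated T (CCup (length s) d c) s @ shuffle T t = (Cup ?m d # double_overpass ?m ?n) @ shuffle T s"
      using True by (simp add: separated_def t shuffle_two)
    have "run (separated T (CCup (length s) d c) s @ shuffle T t) (sorted_level T s) = Some (map fst t)"
      using run_separated[OF assms, of T] run_shuffle[of T t] by simp
    moreover have "(Cup ?m d # double_overpass ?m ?n) @ shuffle T s \<leadsto> [Cup (?m + ?n) d] @ shuffle T s"
      by (intro reduces_suffix double_overpass_cup)
    ultimately have "iso (sorted_level T s) (map fst t) (separated T (CCup (length s) d c) s @ shuffle T t) (Cup (length s) d # shuffle T s)"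
      using reduces_iso unfolding eq mn by simp
    with 1 show ?thesis using iso_sym iso_trans by blast
  next
    case False
    have "separated T (CCup (length s) d c) s @ shuffle T t = Cup (length s) d # shuffle T s"
      using False mn by (simp add: separated_def t shuffle_two add.commute)
    with 1 show ?thesis by simp
  qed
qed

lemma shuffle_top_cap:
  assumes t: "capply (CCap (length s)) (s @ [x, y]) = Some t"
  shows "iso (sorted_level T (s @ [x, y])) (map fst t) (shuffle T (s @ [x, y]) @ [Cap (length s)])
     (separated T (CCap (length s)) (s @ [x, y]) @ shuffle T t)"
proof (rule reduces_iso)
  let ?m = "length (keep T s)" and ?n = "length (others T s)"
  have mn: "?m + ?n = length s" by (rule sum_length_filter_compl)
  have ts: "t = s" "snd x = snd y"
    using t capply_CCap_append[of s "length s" x y "[]"] by (simp_all del: capply.simps split: if_splits)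
  have sh: "shuffle T (s @ [x, y]) = (if T (snd x) then double_overpass ?m ?n else []) @ shuffle T s"
    using ts by (simp add: shuffle_two)
  have ex: "shuffle T s @ [Cap (length s)] \<leadsto> Cap (length s) # shuffle T s"
    using exchange_word_event[OF run_shuffle[of T s], of "Cap 0"] by simp
  show "shuffle T (s @ [x, y]) @ [Cap (length s)] \<leadsto> separated T (CCap (length s)) (s @ [x, y]) @ shuffle T t"
  proof (cases "T (snd x)")
    case True
    have "shuffle T (s @ [x, y]) @ [Cap (length s)] = double_overpass ?m ?n @ (shuffle T s @ [Cap (length s)])"
      using True by (simp add: sh)
    also have "\<dots> \<leadsto> double_overpass ?m ?n @ (Cap (length s) # shuffle T s)"
      by (intro reduces_prefix ex)
    also have "\<dots> = (double_overpass ?m ?n @ [Cap (?m + ?n)]) @ shuffle T s" by (simp add: mn)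
    also have "\<dots> \<leadsto> [Cap ?m] @ shuffle T s"
      by (intro reduces_suffix double_overpass_cap)
    finally show ?thesis using True ts by (simp add: separated_def)
  next
    case False
    then show ?thesis using ex ts mn by (simp add: sh separated_def add.commute)
  qed
  show "run (shuffle T (s @ [x, y]) @ [Cap (length s)]) (sorted_level T (s @ [x, y])) = Some (map fst t)"
    using run_shuffle[of T "s @ [x, y]"] capply_erase[OF t] by simp
qed

text \<open>If only the left strand satisfies \<open>T\<close>, the crossing prolongs its overpass
  by one step; if only the right one does, it cancels the last step by Reidemeister II. Both need
  the \<open>T\<close>-strand to be the upper one.\<close>

lemma shuffle_top_cross:
  assumes t: "capply (CCross (length s) b) (s @ [x, y]) = Some t" and o: "over T (CCross (length s) b) (s @ [x, y])"
  shows "iso (sorted_level T (s @ [x, y])) (map fst t) (shuffle T (s @ [x, y]) @ [Cross (length s) b])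
     (separated T (CCross (length s) b) (s @ [x, y]) @ shuffle T t)"
proof (rule reduces_iso)
  let ?m = "length (keep T s)" and ?n = "length (others T s)"
  have mn: "?m + ?n = length s" by (rule sum_length_filter_compl)
  have ts: "t = s @ [y, x]"
    using t capply_CCross_append[of s "length s" b x y "[]"] by (simp del: capply.simps)
  note sh = shuffle_two
  have ex: "shuffle T s @ [Cross (length s) b] \<leadsto> Cross (length s) b # shuffle T s"
    using exchange_word_event[OF run_shuffle[of T s], of "Cross 0 b"] by simp
  have sep: "separated T (CCross (length s) b) (s @ [x, y]) = (if T (snd x) \<and> T (snd y) then [Cross ?m b]
     else if \<not> T (snd x) \<and> \<not> T (snd y) then [Cross (length s) b] else [])"
    using mn by (simp add: separated_def nth_append add.commute)
  have o': "T (snd x) \<Longrightarrow> \<not> T (snd y) \<Longrightarrow> b" "\<not> T (snd x) \<Longrightarrow> T (snd y) \<Longrightarrow> \<not> b"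
    using o by (simp_all add: nth_append)
  show "shuffle T (s @ [x, y]) @ [Cross (length s) b] \<leadsto> separated T (CCross (length s) b) (s @ [x, y]) @ shuffle T t"
  proof (cases "T (snd x)"; cases "T (snd y)")
    assume T: "T (snd x)" "T (snd y)"
    have "shuffle T (s @ [x, y]) @ [Cross (length s) b] = double_overpass ?m ?n @ (shuffle T s @ [Cross (length s) b])"
      using T by (simp add: sh)
    also have "\<dots> \<leadsto> double_overpass ?m ?n @ (Cross (length s) b # shuffle T s)"
      by (intro reduces_prefix ex)
    also have "\<dots> = (double_overpass ?m ?n @ [Cross (?m + ?n) b]) @ shuffle T s" by (simp add: mn)
    also have "\<dots> \<leadsto> (Cross ?m b # double_overpass ?m ?n) @ shuffle T s"
      by (intro reduces_suffix double_overpass_cross)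
    finally show ?thesis using T by (simp add: sep ts sh)
  next
    assume T: "T (snd x)" "\<not> T (snd y)"
    have "shuffle T (s @ [x, y]) @ [Cross (length s) b] = overpass ?m ?n @ (shuffle T s @ [Cross (length s) b])"
      using T by (simp add: sh)
    also have "\<dots> \<leadsto> overpass ?m ?n @ (Cross (length s) b # shuffle T s)"
      by (intro reduces_prefix ex)
    also have "\<dots> = overpass ?m (Suc ?n) @ shuffle T s"
      using o' T mn by (simp add: overpass_snoc del: overpass.simps)
    finally show ?thesis using T by (simp add: sep ts sh)
  next
    assume T: "\<not> T (snd x)" "T (snd y)"
    have "shuffle T (s @ [x, y]) @ [Cross (length s) b] = overpass ?m (Suc ?n) @ (shuffle T s @ [Cross (length s) b])"
      using T by (simp add: sh del: overpass.simps)
    also have "\<dots> \<leadsto> overpass ?m (Suc ?n) @ (Cross (length s) b # shuffle T s)"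
      by (intro reduces_prefix ex)
    also have "\<dots> = overpass ?m ?n @ [Cross (length s) True, Cross (length s) b] @ shuffle T s"
      using mn by (simp add: overpass_snoc del: overpass.simps)
    also have "\<dots> \<leadsto> overpass ?m ?n @ [] @ shuffle T s"
      using o' T by (intro reduces_context red_reidemeister_2) simp
    finally show ?thesis using T by (simp add: sep ts sh)
  next
    assume T: "\<not> T (snd x)" "\<not> T (snd y)"
    then show ?thesis using ex by (simp add: sep ts sh)
  qed
  show "run (shuffle T (s @ [x, y]) @ [Cross (length s) b]) (sorted_level T (s @ [x, y])) = Some (map fst t)"
    using run_shuffle[of T "s @ [x, y]"] capply_erase[OF t] by simp
qed

text \<open>Events of the \<open>T\<close>-part lie to the left of the travelling strand, those of
  the other part beneath it. The available reduction points one way or the other according to the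
  event, hence the symmetric \<open>iso\<close>.\<close>

lemma overpass_separated:
  assumes t: "capply e s = Some t" and x: "T (snd x)"
  shows "iso (sorted_level T (s @ [x])) (sorted_level T t @ [fst x])
     (overpass (length (keep T s)) (length (others T s)) @ separated T e s)
     (separated T e (s @ [x]) @ overpass (length (keep T t)) (length (others T t)))"
proof -
  let ?m = "length (keep T s)" and ?n = "length (others T s)"
  let ?u = "overpass ?m ?n @ separated T e s"
  let ?v = "separated T e (s @ [x]) @ overpass (length (keep T t)) (length (others T t))"
  have ov: "run (overpass (length (keep T s)) (length (others T s))) (sorted_level T (s @ [x])) = Some (sorted_level T s @ [fst x])" for s
    using run_overpass[of "map fst (keep T s)" _ "map fst (others T s)" _ "fst x" "[]"] x by (simp add: sorted_level_def)
  have run_u: "run ?u (sorted_level T (s @ [x])) = Some (sorted_level T t @ [fst x])"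
    using ov[of s] run_append_right[OF run_separated[OF t]] by simp
  have pre: "pos (erase e) + strands_in (erase e) \<le> length s"
    using apply_event_length[OF capply_erase[OF t]] by simp
  have t': "capply e (s @ [x]) = Some (t @ [x])" using capply_prefix[OF pre] t by simp
  have run_v: "run ?v (sorted_level T (s @ [x])) = Some (sorted_level T t @ [fst x])"
    using run_separated[OF t', of T] ov[of t] by simp
  have sep: "separated T e (s @ [x]) = map erase (sub1 T e s) @ map (shift (Suc ?m)) (map erase (sub1 (\<lambda>c. \<not> T c) e s))"
    using x by (simp add: separated_def sub1_prefix[OF pre])
  have "?u \<leadsto> ?v \<or> ?v \<leadsto> ?u"
  proof (cases e)
    case (CCup i d c)
    with t obtain a b where s: "s = a @ b" "length a = i" "t = a @ (d, c) # (opposite d, c) # b" by (metis capply_CCup_E)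
    let ?i = "length (keep T a)" and ?j = "length (others T a)"
    show ?thesis
    proof (cases "T c")
      case True
      have "overpass (?m + strands_in (Cup ?i d)) ?n @ [Cup ?i d] \<leadsto> Cup ?i d # overpass (?m + strands_out (Cup ?i d)) ?n"
        using s by (intro overpass_exchange_left) simp
      then show ?thesis unfolding sep using s CCup True by (simp add: separated_def del: sub1.simps)
    next
      case False
      have "Cup (Suc (?m + ?j)) d # overpass ?m (?n + 2) \<leadsto> overpass ?m ?n @ [Cup (?m + ?j) d]"
        using s by (intro cup_overpass) simp
      then show ?thesis unfolding sep using s CCup False by (simp add: separated_def add.commute del: sub1.simps overpass.simps)
    qed
  next
    case (CCap i)
    with t obtain a d c b where s: "s = a @ (d, c) # (opposite d, c) # b" "length a = i" "t = a @ b" by (metis capply_CCap_E)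
    let ?i = "length (keep T a)" and ?j = "length (others T a)"
    let ?m' = "length (keep T t)" and ?n' = "length (others T t)"
    show ?thesis
    proof (cases "T c")
      case True
      have "overpass (?m' + strands_in (Cap ?i)) ?n @ [Cap ?i] \<leadsto> Cap ?i # overpass (?m' + strands_out (Cap ?i)) ?n"
        using s by (intro overpass_exchange_left) simp
      then show ?thesis unfolding sep using s CCap True by (simp add: separated_def del: sub1.simps)
    next
      case False
      have "overpass ?m (?n' + 2) @ [Cap (?m + ?j)] \<leadsto> Cap (Suc (?m + ?j)) # overpass ?m ?n'"
        using s by (intro overpass_cap) simp
      then show ?thesis unfolding sep using s CCap False by (simp add: separated_def add.commute del: sub1.simps overpass.simps)
    qed
  next
    case (CCross i b')
    with t obtain a y z b where s: "s = a @ y # z # b" "length a = i" "t = a @ z # y # b" by (metis capply_CCross_E)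
    let ?i = "length (keep T a)" and ?j = "length (others T a)"
    have l: "length (keep T t) = ?m" "length (others T t) = ?n" using s by auto
    consider "T (snd y)" "T (snd z)" | "\<not> T (snd y)" "\<not> T (snd z)" | "T (snd y) \<noteq> T (snd z)" by blast
    then show ?thesis
    proof cases
      case 1
      obtain q where q: "?m = q + 2" "?i \<le> q" using s 1 by simp
      have "overpass (q + strands_in (Cross ?i b')) ?n @ [Cross ?i b'] \<leadsto> Cross ?i b' # overpass (q + strands_out (Cross ?i b')) ?n"
        using q by (intro overpass_exchange_left) simp
      then have "overpass ?m ?n @ [Cross ?i b'] \<leadsto> Cross ?i b' # overpass ?m ?n" by (simp add: q(1))
      moreover have "separated T e s = [Cross ?i b']" "separated T e (s @ [x]) = [Cross ?i b']"
        using s CCross 1 unfolding sep by (simp_all add: separated_def del: sub1.simps)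
      ultimately show ?thesis by (simp add: l)
    next
      case 2
      have "overpass ?m ?n @ [Cross (?m + ?j) b'] \<leadsto> Cross (Suc (?m + ?j)) b' # overpass ?m ?n"
        using s 2 by (intro overpass_cross) simp
      moreover have "separated T e s = [Cross (?m + ?j) b']" "separated T e (s @ [x]) = [Cross (Suc (?m + ?j)) b']"
        using s CCross 2 unfolding sep by (simp_all add: separated_def del: sub1.simps)
      ultimately show ?thesis by (simp add: l)
    next
      case 3
      then have "separated T e s = []" "separated T e (s @ [x]) = []"
        using s CCross unfolding sep by (auto simp: separated_def simp del: sub1.simps)
      then show ?thesis by (simp add: l)
    qed
  qed
  then show ?thesis using reduces_iso[OF _ run_u] reduces_iso[OF _ run_v] iso_sym by blast
qed

text \<open>Induction on the strands to the right of the event: those satisfying \<open>T\<close>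
  are carried past it by \<open>overpass_separated\<close>, until the event sits at the right end of
  the level.\<close>

lemma shuffle_event:
  assumes "capply e s = Some t" "over T e s"
  shows "iso (sorted_level T s) (map fst t) (shuffle T s @ [erase e]) (separated T e s @ shuffle T t)"
  using assms
proof (induction s arbitrary: t rule: rev_induct)
  case Nil
  then obtain d c where "e = CCup 0 d c" by (cases e) (auto split: if_splits)
  with shuffle_top_cup[of "[]" d c t T] Nil show ?case by simp
next
  case (snoc x s)
  note len = apply_event_length[OF capply_erase[OF snoc.prems(1)], unfolded length_map]
  show ?case
  proof (cases "pos (erase e) + strands_in (erase e) \<le> length s")
    case pre: True
    from snoc.prems(1) capply_prefix[OF pre, of "[x]"] obtain t' where t': "capply e s = Some t'" "t = t' @ [x]" by auto
    have "over T e s" using snoc.prems(2) pre by (cases e) (auto simp: nth_append)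
    from snoc.IH[OF t'(1) this] have IH: "iso (sorted_level T s) (map fst t') (shuffle T s @ [erase e]) (separated T e s @ shuffle T t')" .
    from iso_append_right[OF IH, of "[fst x]"] have R: "iso (sorted_level T s @ [fst x]) (map fst t) (shuffle T s @ [erase e]) (separated T e s @ shuffle T t')"
      by (simp add: t'(2))
    show ?thesis
    proof (cases "T (snd x)")
      case True
      let ?o = "overpass (length (keep T s)) (length (others T s))"
      let ?o' = "overpass (length (keep T t')) (length (others T t'))"
      have "run ?o (sorted_level T (s @ [x])) = Some (sorted_level T s @ [fst x])"
        using run_overpass[of "map fst (keep T s)" _ "map fst (others T s)" _ "fst x" "[]"] True by (simp add: sorted_level_def)
      then have 1: "iso (sorted_level T (s @ [x])) (map fst t) (?o @ (shuffle T s @ [erase e])) (?o @ (separated T e s @ shuffle T t'))"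
        by (rule iso_append[OF iso_refl R])
      have 2: "iso (sorted_level T (s @ [x])) (map fst t) ((?o @ separated T e s) @ shuffle T t') ((separated T e (s @ [x]) @ ?o') @ shuffle T t')"
        using run_append_right[OF run_shuffle[of T t'], of "[fst x]"]
        by (intro iso_append[OF overpass_separated[where T = T, OF t'(1) True] iso_refl]) (simp add: t'(2))
      from 1 2 have "iso (sorted_level T (s @ [x])) (map fst t) (?o @ (shuffle T s @ [erase e])) ((separated T e (s @ [x]) @ ?o') @ shuffle T t')"
        unfolding append_assoc by (rule iso_trans)
      then show ?thesis using True by (simp add: t'(2))
    next
      case False
      have "separated T e (s @ [x]) = separated T e s"
        using False by (simp add: separated_def sub1_prefix[OF pre])
      moreover have "sorted_level T (s @ [x]) = sorted_level T s @ [fst x]" using False by (simp add: sorted_level_def)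
      ultimately show ?thesis using R False by (simp add: t'(2))
    qed
  next
    case pre: False
    show ?thesis
    proof (cases e)
      case (CCup i d c)
      with pre len have "i = length (s @ [x])" by simp
      with shuffle_top_cup snoc.prems(1) CCup show ?thesis by (metis erase.simps(1))
    next
      case (CCap i)
      with pre len have "Suc i = length s" by simp
      then obtain s' y where s: "s = s' @ [y]" "length s' = i" by (cases s rule: rev_cases) auto
      with shuffle_top_cap[of s' y x t T] snoc.prems(1) CCap show ?thesis by simp
    next
      case (CCross i b)
      with pre len have "Suc i = length s" by simp
      then obtain s' y where s: "s = s' @ [y]" "length s' = i" by (cases s rule: rev_cases) auto
      with shuffle_top_cross[of s' b y x t T] snoc.prems CCross show ?thesis by simp
    qed
  qed
qed

fun over_word :: "('c \<Rightarrow> bool) \<Rightarrow> 'c cevent list \<Rightarrow> 'c clevel \<Rightarrow> bool" where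
  "over_word T [] s \<longleftrightarrow> True"
| "over_word T (e # W) s \<longleftrightarrow> over T e s \<and> over_word T W (the (capply e s))"

lemma over_word_append: "crun X s = Some t \<Longrightarrow> over_word T (X @ Y) s \<longleftrightarrow> over_word T X s \<and> over_word T Y t"
  by (induction X arbitrary: s) (auto split: option.splits)

text \<open>Each event is moved through the shuffle; if it belongs to the \<open>T\<close>-part, it
  then slides below all events of the other part, which lie to its right.\<close>

lemma pull_apart_level:
  assumes "crun W [] = Some s" "over_word T W []"
  shows "iso [] (map fst s) (map erase W)
    (map erase (sub T W []) @ map (shift (length (keep T s))) (map erase (sub (\<lambda>c. \<not> T c) W [])) @ shuffle T s)"
  using assms
proof (induction W arbitrary: s rule: rev_induct)
  case (snoc e W)
  from snoc.prems(1) obtain r where r: "crun W [] = Some r" "capply e r = Some s"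
    by (metis crun_append_SomeE crun_ConsE crun.simps(1) option.inject)
  have o: "over_word T W []" "over T e r" using snoc.prems(2) over_word_append[OF r(1)] by simp_all
  let ?A = "map erase (sub T W [])" and ?B = "map erase (sub (\<lambda>c. \<not> T c) W [])"
  let ?m = "length (keep T r)"
  have runA: "run ?A [] = Some (map fst (keep T r))" using crun_erase[OF crun_sub[OF r(1), of T]] by simp
  have runB: "run ?B [] = Some (map fst (others T r))" using crun_erase[OF crun_sub[OF r(1), of "\<lambda>c. \<not> T c"]] by simp
  have runAB: "run (?A @ map (shift ?m) ?B) [] = Some (sorted_level T r)"
    using runA runB run_shift[of "map fst (keep T r)" ?m ?B "[]"] by (simp add: sorted_level_def)
  have "run [erase e] (map fst r) = Some (map fst s)" using capply_erase[OF r(2)] by simp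
  then have 1: "iso [] (map fst s) (map erase W @ [erase e]) ((?A @ map (shift ?m) ?B @ shuffle T r) @ [erase e])"
    by (rule iso_append[OF snoc.IH[OF r(1) o(1)] iso_refl])
  have 2: "iso [] (map fst s) ((?A @ map (shift ?m) ?B) @ (shuffle T r @ [erase e])) ((?A @ map (shift ?m) ?B) @ (separated T e r @ shuffle T s))"
    by (rule iso_append[OF iso_refl[OF runAB] shuffle_event[OF r(2) o(2)]])
  have 3: "iso [] (map fst s) ((?A @ map (shift ?m) ?B) @ (separated T e r @ shuffle T s))
     (map erase (sub T (W @ [e]) []) @ map (shift (length (keep T s))) (map erase (sub (\<lambda>c. \<not> T c) (W @ [e]) [])) @ shuffle T s)"
  proof -
    have sub: "sub T (W @ [e]) [] = sub T W [] @ sub1 T e r" for T using sub_append[OF r(1), of T "[e]"] r(2) by simp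
    have run: "run ((?A @ map (shift ?m) ?B) @ (separated T e r @ shuffle T s)) [] = Some (map fst s)"
      by (simp only: run_append_Some[OF runAB] run_append_Some[OF run_separated[OF r(2)]] run_shuffle)
    have "sub1 T e r = [] \<or> (\<exists>f. sub1 T e r = [f]) \<and> sub1 (\<lambda>c. \<not> T c) e r = []"
      by (cases e) auto
    then consider "sub1 T e r = []" | f where "sub1 T e r = [f]" "sub1 (\<lambda>c. \<not> T c) e r = []"
      by blast
    then show ?thesis
    proof cases
      case 1
      then have "keep T s = keep T r" using crun_sub1[OF r(2), of T] by simp
      then show ?thesis using 1 iso_refl[OF run] by (simp add: sub separated_def)
    next
      case 2
      from crun_sub1[OF r(2), of T] 2 have "capply f (keep T r) = Some (keep T s)" by (simp split: option.splits)
      from capply_erase[OF this] have f: "apply_event (erase f) (map fst (keep T r)) = Some (map fst (keep T s))" .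
      have "run (?A @ (erase f # map (shift (length (keep T s))) ?B) @ shuffle T s) [] = Some (map fst s)"
      proof -
        have "run (map (shift (length (keep T s))) ?B) (map fst (keep T s)) = Some (map fst (keep T s) @ map fst (others T r))"
          using runB run_shift[of "map fst (keep T s)" "length (keep T s)" ?B "[]"] by simp
        moreover have "others T s = others T r" using crun_sub1[OF r(2), of "\<lambda>c. \<not> T c"] 2 by simp
        ultimately have "run (erase f # map (shift (length (keep T s))) ?B) (map fst (keep T r)) = Some (sorted_level T s)"
          using f by (simp add: sorted_level_def del: map_map)
        then show ?thesis by (simp only: run_append_Some[OF runA] run_append_Some run_shuffle)
      qed
      moreover have "?A @ (erase f # map (shift (length (keep T s))) ?B) @ shuffle T s \<leadsto> ?A @ (map (shift ?m) ?B @ [erase f]) @ shuffle T s"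
        using exchange_event_word[OF f, of ?B] by (intro reduces_context) simp
      ultimately have "iso [] (map fst s) (?A @ (erase f # map (shift (length (keep T s))) ?B) @ shuffle T s) (?A @ (map (shift ?m) ?B @ [erase f]) @ shuffle T s)"
        using reduces_iso by blast
      then show ?thesis using iso_sym 2 by (simp add: sub separated_def)
    qed
  qed
  show ?case
    using iso_trans[OF iso_trans[OF 1[unfolded append_assoc] 2[unfolded append_assoc]] 3[unfolded append_assoc]] by simp
qed (simp add: iso_refl)

text \<open>The level at the top is empty, so the shuffle and the shift are trivial, and only the
  two stacked sublinks remain.\<close>

lemma pull_apart:
  assumes "crun W [] = Some []" "over_word T W []"
  shows "word_isotopic [] (map erase W) (map erase (sub T W []) @ map erase (sub (\<lambda>c. \<not> T c) W []))"
proof -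
  have "shift 0 = id" by auto
  then show ?thesis using pull_apart_level[OF assms] by (simp add: iso_def)
qed

section \<open>Uniqueness\<close>

text \<open>If all crossings are good, the diagram is layered by its colours, with the smallest one
  on top; crossings within one colour are unrestricted.\<close>

fun good_crossing :: "nat cevent \<Rightarrow> nat clevel \<Rightarrow> bool" where
  "good_crossing (CCross i b) s \<longleftrightarrow>
     (snd (s ! i) < snd (s ! Suc i) \<longrightarrow> b) \<and> (snd (s ! Suc i) < snd (s ! i) \<longrightarrow> \<not> b)"
| "good_crossing _ s \<longleftrightarrow> True"

fun bad_crossings :: "nat cevent list \<Rightarrow> nat clevel \<Rightarrow> nat" where
  "bad_crossings [] s = 0"
| "bad_crossings (e # W) s = (if good_crossing e s then 0 else 1) + bad_crossings W (the (capply e s))"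

lemma bad_crossings_append:
  "crun X s = Some t \<Longrightarrow> bad_crossings (X @ Y) s = bad_crossings X s + bad_crossings Y t"
  by (induction X arbitrary: s) (auto split: option.splits)

lemma bad_crossings_obtain:
  assumes "crun W s = Some t" "bad_crossings W s > 0"
  obtains X i b Y r where "W = X @ [CCross i b] @ Y" "crun X s = Some r" "\<not> good_crossing (CCross i b) r"
  using assms
proof (induction W arbitrary: s thesis)
  case (Cons e W)
  from Cons.prems(2) obtain r where r: "capply e s = Some r" "crun W r = Some t" by (rule crun_ConsE)
  show ?case
  proof (cases "good_crossing e s")
    case True
    then have "bad_crossings W r > 0" using Cons.prems(3) r by simp
    from Cons.IH[OF _ r(2) this] obtain X i b Y r' where
      "W = X @ [CCross i b] @ Y" "crun X r = Some r'" "\<not> good_crossing (CCross i b) r'" by metis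
    with r(1) show ?thesis by (intro Cons.prems(1)[of "e # X" i b Y r']) simp_all
  next
    case False
    then obtain i b where "e = CCross i b" by (cases e) auto
    with False show ?thesis by (intro Cons.prems(1)[of "[]" i b W s]) simp_all
  qed
qed simp

text \<open>The least colour then passes over everything, which makes it the one to be pulled away
  by \<open>pull_apart\<close>.\<close>

lemma bad_crossings_over_word:
  assumes "crun W s = Some t" "bad_crossings W s = 0" "\<And>x. x \<in> colours W \<union> snd ` set s \<Longrightarrow> c \<le> x"
  shows "over_word (\<lambda>x. x = c) W s"
  using assms
proof (induction W arbitrary: s)
  case (Cons e W)
  from Cons.prems(1) obtain r where r: "capply e s = Some r" "crun W r = Some t" by (rule crun_ConsE)
  have good: "good_crossing e s" "bad_crossings W r = 0"
    using Cons.prems(2) r(1) by (auto split: if_splits)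
  have "over (\<lambda>x. x = c) e s"
  proof (cases e)
    case (CCross i b)
    from r(1) CCross have "Suc i < length s" by (auto split: if_splits)
    then have "snd (s ! i) \<in> snd ` set s" "snd (s ! Suc i) \<in> snd ` set s" by simp_all
    then have "c \<le> snd (s ! i)" "c \<le> snd (s ! Suc i)" using Cons.prems(3) by blast+
    then show ?thesis using good(1) CCross by auto
  qed simp_all
  moreover have "over_word (\<lambda>x. x = c) W r"
    by (rule Cons.IH[OF r(2) good(2)], rule Cons.prems(3)) (use capply_colours[OF r(1)] in auto)
  ultimately show ?case using r(1) by simp
qed simp

lemma bad_crossings_sub:
  "crun W s = Some t \<Longrightarrow> bad_crossings W s = 0 \<Longrightarrow> bad_crossings (sub T W s) (keep T s) = 0"
proof (induction W arbitrary: s)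
  case (Cons e W)
  from Cons.prems(1) obtain r where r: "capply e s = Some r" "crun W r = Some t" by (rule crun_ConsE)
  have good: "good_crossing e s" "bad_crossings W r = 0"
    using Cons.prems(2) r(1) by (auto split: if_splits)
  have "bad_crossings (sub1 T e s) (keep T s) = 0"
  proof (cases e)
    case (CCross i b)
    from r(1) obtain a x y d where s: "s = a @ x # y # d" "length a = i" unfolding CCross by (metis capply_CCross_E)
    then show ?thesis using good(1) by (simp add: CCross nth_append)
  qed (auto split: if_splits)
  then show ?case
    using Cons.IH[OF r(2) good(2)] r(1) bad_crossings_append[OF crun_sub1[OF r(1), of T], of "sub T W r"] by simp
qed simp

text \<open>The least colour is pulled off the rest. In what remains no crossing is bad, because its
  crossings come from \<open>W\<close> with their colours.\<close>

lemma stack_of_components: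
  assumes "crun W [] = Some []" "bad_crossings W [] = 0"
  shows "\<exists>Ks. word_isotopic [] (map erase W) (concat Ks) \<and> length Ks = card (colours W) \<and> (\<forall>u \<in> set Ks. closed u)"
  using assms
proof (induction "card (colours W)" arbitrary: W)
  case 0
  then have "colours W = {}" by simp
  then have "sub (\<lambda>_. True) W [] = sub (\<lambda>_. False) W []" by (intro sub_cong[OF 0(2)]) simp
  then have "W = []" using sub_True[OF 0(2)] by (simp add: sub_False)
  then show ?case by (intro exI[of _ "[]"]) simp
next
  case (Suc n)
  then have ne: "colours W \<noteq> {}" by auto
  define c where "c = Min (colours W)"
  have c: "c \<in> colours W" "\<And>x. x \<in> colours W \<Longrightarrow> c \<le> x" using ne by (simp_all add: c_def)
  let ?T = "\<lambda>x. x = c" and ?N = "\<lambda>x. x \<noteq> c"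
  have "over_word ?T W []"
    using c(2) by (intro bad_crossings_over_word[OF Suc.prems]) simp
  from pull_apart[OF Suc.prems(1) this]
  have 1: "word_isotopic [] (map erase W) (map erase (sub ?T W []) @ map erase (sub ?N W []))" .
  have T: "closed (map erase (sub ?T W []))" using c(1) by (intro closed_sub[OF Suc.prems(1)]) auto
  have N: "crun (sub ?N W []) [] = Some []" using crun_sub[OF Suc.prems(1), of ?N] by simp
  have "colours (sub ?N W []) = colours W - {c}" by (auto simp: colours_sub)
  then have card: "card (colours (sub ?N W [])) = n" using Suc.hyps(2) c(1) by simp
  have "bad_crossings (sub ?N W []) [] = 0" using bad_crossings_sub[OF Suc.prems, of ?N] by simp
  from Suc.hyps(1)[OF card[symmetric] N this] obtain Ks where Ks:
    "word_isotopic [] (map erase (sub ?N W [])) (concat Ks)" "length Ks = n" "\<forall>u \<in> set Ks. closed u"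
    using card by auto
  have "run (map erase (sub ?T W [])) [] = Some []" "run (map erase (sub ?N W [])) [] = Some []"
    using T crun_erase[OF N] by (simp_all add: closed_def)
  from word_isotopic_context[OF Ks(1) this, of "[]"] 
  have "word_isotopic [] (map erase (sub ?T W []) @ map erase (sub ?N W [])) (map erase (sub ?T W []) @ concat Ks)" by simp
  with 1 have "word_isotopic [] (map erase W) (concat (map erase (sub ?T W []) # Ks))"
    using word_isotopic_trans by simp
  then show ?case using Ks(2,3) T Suc.hyps(2) by (intro exI[of _ "map erase (sub ?T W []) # Ks"]) simp
qed

lemma regular_imp_ambient: "regular_isotopic D D' \<Longrightarrow> ambient_isotopic D D'"
  unfolding regular_isotopic_def ambient_isotopic_def
proof (induction rule: equivclp_induct)
  case (step y z)
  have mono: "isotopy_move y z \<Longrightarrow> local_move (\<lambda>u v. planar_move u v \<or> reidemeister_1 u v \<or> reidemeister_2 u v \<or> reidemeister_3 u v) y z" for y z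
    unfolding local_move_def by blast
  from step(2) mono[of y z] mono[of z y] step(3) show ?case
    using equivclp_into_equivclp[of _ D y z] by blast
qed simp

text \<open>The stack has as many parts as the diagram has components, and every part has at least
  one; by counting, each part is a knot.\<close>

lemma unlinked_if_good:
  assumes V: "full_lift D V" and "bad_crossings V [] = 0"
  shows "\<exists>r \<ge> 1. unlinked_knots r D"
proof -
  from V have l: "crun V [] = Some []" "map erase V = events D" "card (colours V) = card (components D)"
    by (auto simp: full_lift_def is_lift_def)
  from stack_of_components[OF l(1) assms(2)] obtain us where us:
    "word_isotopic [] (events D) (concat us)" "length us = card (components D)" "\<forall>u \<in> set us. closed u"
    using l by auto
  define Ks where "Ks = map Abs_link_diagram us"
  have map: "map events Ks = us" using us(3) by (simp add: Ks_def map_idI)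
  from word_isotopic_closed[OF us(1)] have cl: "closed (concat us)" and iso: "regular_isotopic D (Abs_link_diagram (concat us))" by simp_all
  let ?D = "Abs_link_diagram (concat us)"
  have ev: "events ?D = concat (map events Ks)" using cl map by simp
  have pos: "1 \<le> card (components K)" for K using components_nonempty[of K] by (simp add: Suc_leI card_gt_0_iff)
  have "sum_list (map (\<lambda>K. card (components K)) Ks) = length Ks"
    using card_components_concat[OF ev] card_components_isotopic[OF iso] us(2) by (simp add: Ks_def)
  moreover have "length L \<le> sum_list (map (\<lambda>K. card (components K)) L) \<and>
    (sum_list (map (\<lambda>K. card (components K)) L) = length L \<longrightarrow> (\<forall>K \<in> set L. card (components K) = 1))" for L
  proof (induction L)
    case (Cons K L)
    then show ?case using pos[of K] by auto
  qed simp
  ultimately have "\<forall>K \<in> set Ks. knot_diagram K" by (auto simp: knot_diagram_def)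
  then have "unlinked_knots (length Ks) D"
    unfolding unlinked_knots_def using ev regular_imp_ambient[OF iso] by blast
  moreover have "1 \<le> length Ks" using us(2) pos[of D] by (simp add: Ks_def)
  ultimately show ?thesis by blast
qed

definition mixed_skein :: "(link_diagram \<Rightarrow> laurent_zwaE) \<Rightarrow> bool" where
  "mixed_skein H \<longleftrightarrow> (\<forall>k i Lpos Lneg Lzero.
       conway_triple k i Lpos Lneg Lzero \<and> mixed_crossing Lpos k i \<longrightarrow>
       H Lpos - H Lneg = z_var * H Lzero)"

definition crossings :: "event list \<Rightarrow> nat" where
  "crossings u = length (filter (\<lambda>e. \<exists>i b. e = Cross i b) u)"

text \<open>Nested induction: switching a bad crossing keeps the number of crossings and lowers the
  number of bad ones; smoothing it lowers the number of crossings, and the smoothed diagram may be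
  coloured afresh.\<close>

lemma mixed_skein_unique:
  assumes H: "mixed_skein H" "mixed_skein H'"
    and unlinked: "\<And>r K. 1 \<le> r \<Longrightarrow> unlinked_knots r K \<Longrightarrow> H K = H' K"
  shows "H D = H' D"
proof -
  have exists: "\<exists>V :: nat cevent list. full_lift D V" for D
  proof -
    obtain f :: "_ \<Rightarrow> nat" where f: "inj_on f (components D)"
      using finite_imp_inj_to_nat_seg[OF finite_components[of D]] by auto
    have "full_lift D (recolour f (universal D))"
      using is_lift_recolour[OF is_lift_universal] card_image[OF f] by (simp add: full_lift_def colours_universal)
    then show ?thesis by blast
  qed
  have main: "H D = H' D" if "full_lift D V" for D and V :: "nat cevent list"
    using that
  proof (induction "crossings (events D)" arbitrary: D V rule: less_induct)
    case less
    note outer = less.hyps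
    show ?case using less.prems outer
    proof (induction "bad_crossings V []" arbitrary: D V rule: less_induct)
      case less
      note inner = less.hyps and V = less.prems(1) and outer = less.prems(2)
      from V have l: "crun V [] = Some []" "map erase V = events D" by (auto simp: full_lift_def is_lift_def)
      show ?case
      proof (cases "bad_crossings V [] = 0")
        case True
        with unlinked_if_good[OF V] unlinked show ?thesis by blast
      next
        case False
        then obtain X i b Y s where X: "V = X @ [CCross i b] @ Y" "crun X [] = Some s" "\<not> good_crossing (CCross i b) s"
          using bad_crossings_obtain[OF l(1)] by (metis neq0_conv)
        let ?W = "X @ [CCross i (\<not> b)] @ Y"
        let ?xs = "map erase X" and ?ys = "map erase Y"
        have D: "events D = ?xs @ [Cross i b] @ ?ys" using l(2) X(1) by simp
        from l(1) X(1,2) obtain t where t: "capply (CCross i b) s = Some t" "crun Y t = Some []"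
          by (metis crun_append_Some append_Cons append_Nil crun_ConsE)
        from t(1) have i: "Suc i < length s" by (auto split: if_splits)
        then have i': "Suc i < length (map fst s)" by simp
        have c: "snd (s ! i) \<noteq> snd (s ! Suc i)" using X(3) by auto
        have runX: "run ?xs [] = Some (map fst s)" using crun_erase[OF X(2)] by simp
        have cl: "closed (?xs @ [Cross i r] @ ?ys)" for r
          using closed_events[of D] D runX i by (auto simp: closed_def run_append)
        let ?p = "map fst s ! i" and ?q = "map fst s ! Suc i"
        have "?xs \<noteq> []" using runX i by auto
        then have cl0: "closed (?xs @ smoothing i ?p ?q @ ?ys)"
          using cl[of b] run_smoothing[OF i', of b] runX i by (simp add: closed_def run_append)
        define D' where "D' = Abs_link_diagram (?xs @ [Cross i (\<not> b)] @ ?ys)"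
        define D0 where "D0 = Abs_link_diagram (?xs @ smoothing i ?p ?q @ ?ys)"
        have ev: "events D' = ?xs @ [Cross i (\<not> b)] @ ?ys" "events D0 = ?xs @ smoothing i ?p ?q @ ?ys"
          using cl cl0 by (simp_all add: D'_def D0_def)
        have W: "full_lift D' ?W"
          using V lift_flip[of D X i b Y D' "\<not> b"] card_components_flip[OF D ev(1)] X(1) ev(1) by (simp add: full_lift_def)
        \<comment> \<open>A crossing acts on the level in the same way whatever its sign, so the
          rest of the word meets the same colours as before.\<close>
        have bad: "bad_crossings ?W [] < bad_crossings V []"
        proof -
          have "capply (CCross i (\<not> b)) s = Some t" using t(1) by simp
          then show ?thesis unfolding X(1) bad_crossings_append[OF X(2)] using t(1) X(3)
            by (auto simp del: capply.simps)
        qed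
        have cr: "crossings (events D') = crossings (events D)" "crossings (events D0) < crossings (events D)"
          unfolding D ev by (simp_all add: crossings_def smoothing_def)
        have HD': "H D' = H' D'"
          using outer cr(1) by (intro inner[OF bad W]) simp
        obtain V0 :: "nat cevent list" where "full_lift D0 V0" using exists by blast
        then have HD0: "H D0 = H' D0" using outer cr(2) by blast
        \<comment> \<open>Colours are constant along components, so strands of different colours
          belong to different components.\<close>
        have mixed: "mixed_crossing E (length X) i" if "is_lift E (X @ [CCross i r] @ Y)" for E r
        proof -
          have "colour_at (X @ [CCross i r] @ Y) (length X, j) = Some (snd (s ! j))" if "j \<le> Suc i" for j
            using X(2) i that by (simp add: colour_at_def)
          then have "colour_at (X @ [CCross i r] @ Y) (length X, i) \<noteq> colour_at (X @ [CCross i r] @ Y) (length X, Suc i)"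
            using c by simp
          then show ?thesis using same_component_colour[OF that] unfolding mixed_crossing_def by blast
        qed
        have lifts: "is_lift D (X @ [CCross i b] @ Y)" "is_lift D' (X @ [CCross i (\<not> b)] @ Y)"
          using V W X(1) by (simp_all add: full_lift_def)
        show ?thesis
        proof (cases "b = (?p = ?q)")
          case True
          then have "conway_triple (length X) i D D' D0"
            unfolding conway_triple_def using runX i D ev
            by (intro exI[of _ ?xs] exI[of _ ?ys] exI[of _ "map fst s"]) simp
          with mixed[OF lifts(1)] H have "H D - H D' = z_var * H D0" "H' D - H' D' = z_var * H' D0"
            unfolding mixed_skein_def by blast+
          then have "H D - H' D' = H' D - H' D'" using HD' HD0 by simp
          then show ?thesis by simp
        next
          case False
          then have "conway_triple (length X) i D' D D0"
            unfolding conway_triple_def using runX i D ev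
            by (intro exI[of _ ?xs] exI[of _ ?ys] exI[of _ "map fst s"]) auto
          with mixed[OF lifts(2)] H have "H D' - H D = z_var * H D0" "H' D' - H' D = z_var * H' D0"
            unfolding mixed_skein_def by blast+
          then have "H' D' - H D = H' D' - H' D" using HD' HD0 by simp
          then show ?thesis by simp
        qed
      qed
    qed
  qed
  from exists[of D] main show ?thesis by blast
qed

theorem theorem1:
  fixes R :: "link_diagram \<Rightarrow> laurent_wa"
  assumes "regular_homflypt R"
  shows "\<exists>!H :: link_diagram \<Rightarrow> laurent_zwaE.
    regular_isotopy_invariant H \<and>
    (\<forall>k i Lpos Lneg Lzero.
       conway_triple k i Lpos Lneg Lzero \<and> mixed_crossing Lpos k i \<longrightarrow>
       H Lpos - H Lneg = z_var * H Lzero) \<and>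
    (\<forall>r K. 1 \<le> r \<and> unlinked_knots r K \<longrightarrow>
       H K = E_pow (1 - int r) * include_wa (R K))"
proof (rule ex1I[of _ "extended_homflypt R"])
  show "regular_isotopy_invariant (extended_homflypt R) \<and>
    (\<forall>k i Lpos Lneg Lzero.
       conway_triple k i Lpos Lneg Lzero \<and> mixed_crossing Lpos k i \<longrightarrow>
       extended_homflypt R Lpos - extended_homflypt R Lneg = z_var * extended_homflypt R Lzero) \<and>
    (\<forall>r K. 1 \<le> r \<and> unlinked_knots r K \<longrightarrow>
       extended_homflypt R K = E_pow (1 - int r) * include_wa (R K))"
    using extended_homflypt_isotopic[OF assms] extended_homflypt_skein[OF assms] extended_homflypt_unlinked_knots[OF assms]
    unfolding regular_isotopy_invariant_def by blast
  fix H :: "link_diagram \<Rightarrow> laurent_zwaE"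
  assume H: "regular_isotopy_invariant H \<and>
    (\<forall>k i Lpos Lneg Lzero.
       conway_triple k i Lpos Lneg Lzero \<and> mixed_crossing Lpos k i \<longrightarrow>
       H Lpos - H Lneg = z_var * H Lzero) \<and>
    (\<forall>r K. 1 \<le> r \<and> unlinked_knots r K \<longrightarrow>
       H K = E_pow (1 - int r) * include_wa (R K))"
  have "mixed_skein H" using H unfolding mixed_skein_def by blast
  moreover have "mixed_skein (extended_homflypt R)"
    using extended_homflypt_skein[OF assms] unfolding mixed_skein_def by blast
  moreover have "H K = extended_homflypt R K" if "1 \<le> r" "unlinked_knots r K" for r K
    using H that extended_homflypt_unlinked_knots[OF assms that(2)] by simp
  ultimately have "H D = extended_homflypt R D" for D by (rule mixed_skein_unique)
  then show "H = extended_homflypt R" by (rule ext)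
qed

end
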